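(* For $n\ge 1$ let $X_n$ be the star graph with $n$ leaves, on which the symmetric group $S_n$ acts by permuting the leaves. For every $n\geq 4$ there are isomorphisms of $S_n$-representations over $\mathbb{Q}$: (1) $H_1(\mathrm{Conf}_2(X_n);\mathbb{Q}) \cong \mathrm{Sp}_n(1,1) \oplus \mathrm{Sp}_n(2)$; (2) $H_1(\mathrm{UConf}_2(X_n);\mathbb{Q}) \cong \mathrm{Sp}_n(1,1)$.
   Context: The star graph $X_n$ is the tree with a single internal vertex joined by an edge to each of $n$ leaves labeled $1,\dots,n$; it is regarded as a topological space (1-dimensional CW complex). $\mathrm{Conf}_k(G)=\{(x_1,\dots,x_k)\in G^k : x_i\neq x_j \text{ for } i\ne j\}$ is the ordered configuration space and $\mathrm{UConf}_k(G)=\mathrm{Conf}_k(G)/S_k$ is the unordered one (quotient by permuting coordinates). The action of $S_n$ on the graph induces actions on these spaces and on their homology. For a partition $\lambda=(\lambda_1,\dots,\lambda_r)$ and $n\geq |\lambda|+\lambda_1$, $\lambda[n]=(n-|\lambda|,\lambda_1,\dots,\lambda_r)$, and $\mathrm{Sp}_n(\lambda)$ denotes the irreducible $\mathbb{Q}[S_n]$-representation (Specht module) indexed by the partition $\lambda[n]$ of $n$ (with the convention that $(n)$ indexes the trivial representation). *)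

theory Defs
  imports "HOL-Homology.Homology" "HOL-Algebra.Sym_Groups"
begin

section \<open>Configuration spaces of star graphs\<close>

text \<open>
  The star graph with leaves \<open>1, \<dots>, n\<close> is realised as the union of the segments joining the
  origin (the internal vertex) to the unit vectors \<open>e\<^sub>1, \<dots>, e\<^sub>n\<close> (the leaves).  Points are
  functions on all of \<open>nat\<close>; they vanish outside \<open>{1..n}\<close>.
\<close>

definition star_graph :: "nat \<Rightarrow> (nat \<Rightarrow> real) topology" where
  "star_graph n = subtopology (powertop_real UNIV)
     (\<Union>i\<in>{1..n}. {(\<lambda>j. if j = i then t else 0) | t. 0 \<le> t \<and> t \<le> 1})"

text \<open>The coordinates are permuted so that \<open>\<sigma>\<close> takes the leaf \<open>e\<^sub>i\<close> to the leaf \<open>e\<^bsub>\<sigma> i\<^esub>\<close>.\<close>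

definition star_map :: "(nat \<Rightarrow> nat) \<Rightarrow> (nat \<Rightarrow> real) \<Rightarrow> (nat \<Rightarrow> real)" where
  "star_map \<sigma> x = x \<circ> inv_into UNIV \<sigma>"

text \<open>
  A \<open>k\<close>-tuple is an extensional function on \<open>{..<k}\<close>, as usual for \<^const>\<open>product_topology\<close>.
\<close>

definition Conf :: "nat \<Rightarrow> 'a topology \<Rightarrow> (nat \<Rightarrow> 'a) topology" where
  "Conf k X = subtopology (product_topology (\<lambda>_. X) {..<k}) {x. inj_on x {..<k}}"

definition Conf_map :: "nat \<Rightarrow> ('a \<Rightarrow> 'b) \<Rightarrow> (nat \<Rightarrow> 'a) \<Rightarrow> (nat \<Rightarrow> 'b)" where
  "Conf_map k f x = restrict (f \<circ> x) {..<k}"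

definition quotient_topology :: "'a topology \<Rightarrow> ('a \<Rightarrow> 'b) \<Rightarrow> 'b topology" where
  "quotient_topology X q =
     topology (\<lambda>U. U \<subseteq> q ` topspace X \<and> openin X {x \<in> topspace X. q x \<in> U})"

lemma openin_quotient_topology:
  "openin (quotient_topology X q) U \<longleftrightarrow>
     U \<subseteq> q ` topspace X \<and> openin X {x \<in> topspace X. q x \<in> U}"
proof -
  let ?L = "\<lambda>U. U \<subseteq> q ` topspace X \<and> openin X {x \<in> topspace X. q x \<in> U}"
  have "?L (S \<inter> T)" if "?L S" "?L T" for S T
  proof -
    have "{x \<in> topspace X. q x \<in> S \<inter> T} = {x \<in> topspace X. q x \<in> S} \<inter> {x \<in> topspace X. q x \<in> T}"
      by auto
    with that show ?thesis by auto
  qed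
  moreover have "?L (\<Union>\<K>)" if "\<forall>K\<in>\<K>. ?L K" for \<K>
  proof -
    have "{x \<in> topspace X. q x \<in> \<Union>\<K>} = (\<Union>K\<in>\<K>. {x \<in> topspace X. q x \<in> K})"
      by auto
    with that show ?thesis by auto
  qed
  ultimately have "istopology ?L"
    unfolding istopology_def by blast
  then show ?thesis
    by (simp add: quotient_topology_def topology_inverse')
qed

lemma topspace_quotient_topology [simp]:
  "topspace (quotient_topology X q) = q ` topspace X"
proof -
  have "{x \<in> topspace X. q x \<in> q ` topspace X} = topspace X" by auto
  then have "openin (quotient_topology X q) (q ` topspace X)"
    by (simp add: openin_quotient_topology)
  moreover have "topspace (quotient_topology X q) \<subseteq> q ` topspace X"
    using openin_quotient_topology openin_topspace by metis
  ultimately show ?thesis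
    using openin_subset by blast
qed

lemma quotient_map_quotient_topology: "quotient_map X (quotient_topology X q) q"
  by (auto simp: quotient_map_def openin_quotient_topology)

definition perm_orbit :: "nat \<Rightarrow> (nat \<Rightarrow> 'a) \<Rightarrow> (nat \<Rightarrow> 'a) set" where
  "perm_orbit k x = {x \<circ> \<tau> | \<tau>. \<tau> permutes {..<k}}"

definition UConf :: "nat \<Rightarrow> 'a topology \<Rightarrow> (nat \<Rightarrow> 'a) set topology" where
  "UConf k X = quotient_topology (Conf k X) (perm_orbit k)"

definition UConf_map :: "nat \<Rightarrow> ('a \<Rightarrow> 'b) \<Rightarrow> (nat \<Rightarrow> 'a) set \<Rightarrow> (nat \<Rightarrow> 'b) set" where
  "UConf_map k f A = Conf_map k f ` A"


section \<open>Rational representations\<close>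

definition rat_field :: "rat ring" where
  "rat_field = \<lparr>carrier = UNIV, monoid.mult = (*), one = 1, zero = 0, add = (+)\<rparr>"

text \<open>
  A representation is a \<open>\<rat>\<close>-vector space together with an action.  The multiplicative fields
  \<open>mult\<close> and \<open>one\<close>, which \<^typ>\<open>('a, 'b) module\<close> inherits from \<^typ>\<open>'b ring\<close>, are irrelevant for
  modules and left undefined below.
\<close>

record ('g, 'v) rep = "(rat, 'v) module" +
  action :: "'g \<Rightarrow> 'v \<Rightarrow> 'v"

definition with_action :: "(rat, 'v) module \<Rightarrow> ('g \<Rightarrow> 'v \<Rightarrow> 'v) \<Rightarrow> ('g, 'v) rep" where
  "with_action V a = module.extend V (rep.fields a)"

definition linear_map ::
  "(rat, 'v, 'c) module_scheme \<Rightarrow> (rat, 'w, 'd) module_scheme \<Rightarrow> ('v \<Rightarrow> 'w) \<Rightarrow> bool" where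
  "linear_map V W f \<longleftrightarrow>
     f \<in> carrier V \<rightarrow> carrier W \<and>
     (\<forall>x\<in>carrier V. \<forall>y\<in>carrier V. f (x \<oplus>\<^bsub>V\<^esub> y) = f x \<oplus>\<^bsub>W\<^esub> f y) \<and>
     (\<forall>q. \<forall>x\<in>carrier V. f (q \<odot>\<^bsub>V\<^esub> x) = q \<odot>\<^bsub>W\<^esub> f x)"

definition representation :: "('g, 'm) monoid_scheme \<Rightarrow> ('g, 'v) rep \<Rightarrow> bool" where
  "representation G V \<longleftrightarrow>
     group G \<and> module rat_field V \<and>
     (\<forall>g\<in>carrier G. linear_map V V (action V g)) \<and>
     (\<forall>v\<in>carrier V. action V \<one>\<^bsub>G\<^esub> v = v) \<and>
     (\<forall>g\<in>carrier G. \<forall>h\<in>carrier G. \<forall>v\<in>carrier V.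
        action V (g \<otimes>\<^bsub>G\<^esub> h) v = action V g (action V h v))"

definition rep_iso ::
  "('g, 'm) monoid_scheme \<Rightarrow> ('g, 'v) rep \<Rightarrow> ('g, 'w) rep \<Rightarrow> bool" where
  "rep_iso G V W \<longleftrightarrow>
     representation G V \<and> representation G W \<and>
     (\<exists>f. bij_betw f (carrier V) (carrier W) \<and> linear_map V W f \<and>
        (\<forall>g\<in>carrier G. \<forall>v\<in>carrier V. f (action V g v) = action W g (f v)))"

definition rep_sum :: "('g, 'v) rep \<Rightarrow> ('g, 'w) rep \<Rightarrow> ('g, 'v \<times> 'w) rep" where
  "rep_sum V W =
     \<lparr>carrier = carrier V \<times> carrier W, monoid.mult = undefined, one = undefined,
      zero = (\<zero>\<^bsub>V\<^esub>, \<zero>\<^bsub>W\<^esub>),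
      add = (\<lambda>(v, w) (v', w'). (v \<oplus>\<^bsub>V\<^esub> v', w \<oplus>\<^bsub>W\<^esub> w')),
      smult = (\<lambda>q (v, w). (q \<odot>\<^bsub>V\<^esub> v, q \<odot>\<^bsub>W\<^esub> w)),
      action = (\<lambda>g (v, w). (action V g v, action W g w))\<rparr>"


section \<open>Free rational vector spaces\<close>

text \<open>Rational counterparts of the functions \<open>frag_cmul\<close> and \<open>frag_extend\<close> of the library.\<close>

definition qscale :: "rat \<Rightarrow> ('a \<Rightarrow>\<^sub>0 rat) \<Rightarrow> ('a \<Rightarrow>\<^sub>0 rat)" where
  "qscale q c = Poly_Mapping.map ((*) q) c"

lemma lookup_qscale [simp]: "Poly_Mapping.lookup (qscale q c) x = q * Poly_Mapping.lookup c x"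
  by (simp add: qscale_def Poly_Mapping.map.rep_eq when_def)

global_interpretation qvec: vector_space qscale
  defines qspan = qvec.span
  by unfold_locales (auto intro!: poly_mapping_eqI simp: lookup_add algebra_simps)

definition qextend :: "('a \<Rightarrow> ('b \<Rightarrow>\<^sub>0 rat)) \<Rightarrow> ('a \<Rightarrow>\<^sub>0 rat) \<Rightarrow> ('b \<Rightarrow>\<^sub>0 rat)" where
  "qextend b c = (\<Sum>x\<in>Poly_Mapping.keys c. qscale (Poly_Mapping.lookup c x) (b x))"

definition qpush :: "('a \<Rightarrow> 'b) \<Rightarrow> ('a \<Rightarrow>\<^sub>0 rat) \<Rightarrow> ('b \<Rightarrow>\<^sub>0 rat)" where
  "qpush h = qextend (\<lambda>x. Poly_Mapping.single (h x) 1)"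

definition subspace_module :: "('a \<Rightarrow>\<^sub>0 rat) set \<Rightarrow> (rat, 'a \<Rightarrow>\<^sub>0 rat) module" where
  "subspace_module V =
     \<lparr>carrier = V, monoid.mult = undefined, one = undefined,
      zero = 0, add = (+), smult = qscale\<rparr>"

text \<open>
  The quotient of a subspace \<open>V\<close> by a subspace \<open>W \<subseteq> V\<close>; its elements are cosets of \<open>W\<close>.  Adding
  the elements of \<open>W\<close> in the scalar multiplication matters only for the scalar \<open>0\<close>.
\<close>

definition quotient_module ::
  "('a \<Rightarrow>\<^sub>0 rat) set \<Rightarrow> ('a \<Rightarrow>\<^sub>0 rat) set \<Rightarrow> (rat, ('a \<Rightarrow>\<^sub>0 rat) set) module" where
  "quotient_module V W =
     \<lparr>carrier = {{v + w | w. w \<in> W} | v. v \<in> V}, monoid.mult = undefined, one = undefined,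
      zero = W,
      add = (\<lambda>A B. {a + b | a b. a \<in> A \<and> b \<in> B}),
      smult = (\<lambda>q A. {qscale q a + w | a w. a \<in> A \<and> w \<in> W})\<rparr>"


section \<open>Singular homology with rational coefficients\<close>

text \<open>
  The library's homology groups have integer coefficients, so its chain complex is
  repeated here with coefficients in \<open>\<rat>\<close>, on the same singular simplices and faces.
\<close>

definition qchains :: "nat \<Rightarrow> 'a topology \<Rightarrow> (((nat \<Rightarrow> real) \<Rightarrow> 'a) \<Rightarrow>\<^sub>0 rat) set" where
  "qchains p X = {c. Poly_Mapping.keys c \<subseteq> singular_simplex_set p X}"

definition qboundary ::
  "nat \<Rightarrow> (((nat \<Rightarrow> real) \<Rightarrow> 'a) \<Rightarrow>\<^sub>0 rat) \<Rightarrow> (((nat \<Rightarrow> real) \<Rightarrow> 'a) \<Rightarrow>\<^sub>0 rat)" where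
  "qboundary p c =
     (if p = 0 then 0
      else qextend (\<lambda>f. \<Sum>k\<le>p. Poly_Mapping.single (singular_face p k f) ((-1) ^ k)) c)"

definition qcycles :: "nat \<Rightarrow> 'a topology \<Rightarrow> (((nat \<Rightarrow> real) \<Rightarrow> 'a) \<Rightarrow>\<^sub>0 rat) set" where
  "qcycles p X = {c \<in> qchains p X. qboundary p c = 0}"

definition qboundaries :: "nat \<Rightarrow> 'a topology \<Rightarrow> (((nat \<Rightarrow> real) \<Rightarrow> 'a) \<Rightarrow>\<^sub>0 rat) set" where
  "qboundaries p X = qboundary (Suc p) ` qchains (Suc p) X"

definition rat_homology ::
  "nat \<Rightarrow> 'a topology \<Rightarrow> (rat, (((nat \<Rightarrow> real) \<Rightarrow> 'a) \<Rightarrow>\<^sub>0 rat) set) module" where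
  "rat_homology p X = quotient_module (qcycles p X) (qboundaries p X)"

text \<open>The map induced by a continuous \<open>f\<close> from some space to \<open>Y\<close>, sending \<open>[c]\<close> to \<open>[f\<^sub># c]\<close>.\<close>

definition rat_homology_map ::
  "nat \<Rightarrow> 'b topology \<Rightarrow> ('a \<Rightarrow> 'b) \<Rightarrow>
     (((nat \<Rightarrow> real) \<Rightarrow> 'a) \<Rightarrow>\<^sub>0 rat) set \<Rightarrow> (((nat \<Rightarrow> real) \<Rightarrow> 'b) \<Rightarrow>\<^sub>0 rat) set" where
  "rat_homology_map p Y f A =
     {qpush (simplex_map p f) c + b | c b. c \<in> A \<and> b \<in> qboundaries p Y}"

definition homology_rep ::
  "nat \<Rightarrow> 'a topology \<Rightarrow> ('g \<Rightarrow> 'a \<Rightarrow> 'a) \<Rightarrow>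
     ('g, (((nat \<Rightarrow> real) \<Rightarrow> 'a) \<Rightarrow>\<^sub>0 rat) set) rep" where
  "homology_rep p X a = with_action (rat_homology p X) (\<lambda>g. rat_homology_map p X (a g))"


section \<open>Specht modules\<close>

text \<open>
  Partitions are lists of parts; cells are pairs (row, column), counted from \<open>0\<close>.  A tableau is
  only relevant on the cells of the diagram.  A tabloid, that is, a row-equivalence class of tableaux,
  is represented by the list of its rows, each row being a set of entries.
\<close>

definition cells :: "nat list \<Rightarrow> (nat \<times> nat) set" where
  "cells \<mu> = {(i, j). i < length \<mu> \<and> j < \<mu> ! i}"

definition tableau :: "nat list \<Rightarrow> (nat \<times> nat \<Rightarrow> nat) \<Rightarrow> bool" where
  "tableau \<mu> t \<longleftrightarrow> bij_betw t (cells \<mu>) {1..sum_list \<mu>}"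

definition tabloid :: "nat list \<Rightarrow> (nat \<times> nat \<Rightarrow> nat) \<Rightarrow> nat set list" where
  "tabloid \<mu> t = map (\<lambda>i. {t (i, j) | j. j < \<mu> ! i}) [0..<length \<mu>]"

definition column_stabilizer :: "nat list \<Rightarrow> (nat \<times> nat \<Rightarrow> nat) \<Rightarrow> (nat \<Rightarrow> nat) set" where
  "column_stabilizer \<mu> t =
     {\<sigma>. \<sigma> permutes {1..sum_list \<mu>} \<and>
        (\<forall>(i, j)\<in>cells \<mu>. \<exists>i'. (i', j) \<in> cells \<mu> \<and> \<sigma> (t (i, j)) = t (i', j))}"

definition polytabloid :: "nat list \<Rightarrow> (nat \<times> nat \<Rightarrow> nat) \<Rightarrow> (nat set list \<Rightarrow>\<^sub>0 rat)" where
  "polytabloid \<mu> t =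
     (\<Sum>\<sigma>\<in>column_stabilizer \<mu> t. Poly_Mapping.single (tabloid \<mu> (\<sigma> \<circ> t)) (of_int (sign \<sigma>)))"

definition specht :: "nat list \<Rightarrow> (nat \<Rightarrow> nat, nat set list \<Rightarrow>\<^sub>0 rat) rep" where
  "specht \<mu> = with_action
     (subspace_module (qspan {polytabloid \<mu> t | t. tableau \<mu> t}))
     (\<lambda>\<sigma>. qpush (map ((`) \<sigma>)))"

text \<open>\<open>Sp n \<nu>\<close> is indexed by the padded partition \<open>(n - |\<nu>|, \<nu>\<^sub>1, \<dots>, \<nu>\<^sub>r)\<close>; it is meant for \<open>n \<ge> |\<nu>| + \<nu>\<^sub>1\<close>.\<close>

definition Sp :: "nat \<Rightarrow> nat list \<Rightarrow> (nat \<Rightarrow> nat, nat set list \<Rightarrow>\<^sub>0 rat) rep" where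
  "Sp n \<nu> = specht ((n - sum_list \<nu>) # \<nu>)"

end

theory Submission
  imports Defs "HOL-Analysis.Further_Topology"
begin

text \<open>
  Let \<open>a\<^sub>i\<close> and \<open>b\<^sub>j\<close> be the configurations with one point at the internal vertex and the first,
  respectively the second, point at the end of a leg.  For \<open>i \<noteq> j\<close> there is a path \<open>p\<^sub>i\<^sub>j\<close> from \<open>a\<^sub>i\<close> to \<open>b\<^sub>j\<close>
  through the configuration with the points at the ends of legs \<open>i\<close> and \<open>j\<close>.  The map
  \<open>M \<mapsto> \<Sum> M\<^sub>i\<^sub>j [p\<^sub>i\<^sub>j]\<close> identifies the first homology of the ordered configuration space with the matrices with
  zero diagonal whose row and column sums vanish, that is, with the cycles of the complete bipartite graph
  without a perfect matching.  It is onto because the configuration space is covered by open star-shaped sets,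
  in which a path is homologous to the difference of the segments from its end points to the centre; after
  subdivision, this rewrites every cycle in terms of the \<open>p\<^sub>i\<^sub>j\<close>.  It is injective because for each \<open>(i, j)\<close> there
  is a map to the punctured plane that winds once around \<open>0\<close> along \<open>p\<^sub>i\<^sub>j\<close> and has zero winding along the other paths.
  Exchanging the two points turns \<open>p\<^sub>i\<^sub>j\<close> into the reverse of \<open>p\<^sub>j\<^sub>i\<close>, so the unordered configuration space
  yields the antisymmetric matrices.  In terms of tabloids, the antisymmetric matrices with vanishing row sums
  are spanned by the oriented triangles, which are the polytabloids of shape \<open>(n - 2, 1, 1)\<close>, and the
  symmetric ones by the alternating squares, which are the polytabloids of shape \<open>(n - 2, 2)\<close>.
\<close>

section \<open>Linear maps on free rational vector spaces\<close>

text \<open>The potentials replace barycentric subdivision and Mayer-Vietoris. A potential assigns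
  to every point, with no continuity at all, a 1-chain leading to a base point. If every path
  \<open>g\<close> is congruent to \<open>h (g 0) - h (g 1)\<close> modulo boundaries and edges, the
  terms in \<open>h\<close> cancel on a cycle, so only an interval is ever subdivided. Since the
  base point depends on which of the two points is farther out, the potential must jump where they
  are equally far from the vertex, and it is this jump that brings in p_ij. In the other direction,
  the variation of a logarithm is defined on single, possibly open, paths. It is therefore a cochain
  whose values are the coefficients of M, and injectivity is read off without knowing any homology
  group. The unordered space inherits both halves: short paths lift through local sections, and the
  winding map is the product of the old one over the two points of an orbit. Coefficients in a field
  of characteristic 0 are used twice: to divide by 2 when a matrix is split into its symmetric and
  antisymmetric parts, and to embed the coefficients into the complex numbers. The alternating
  squares have four distinct corners, whence n \<ge> 4.\<close>

abbreviation (input) "lookup \<equiv> Poly_Mapping.lookup"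
abbreviation (input) "keys \<equiv> Poly_Mapping.keys"
abbreviation (input) "single \<equiv> Poly_Mapping.single"

abbreviation qhom :: "(('a \<Rightarrow>\<^sub>0 rat) \<Rightarrow> ('b \<Rightarrow>\<^sub>0 rat)) \<Rightarrow> bool" where
  "qhom \<equiv> module_hom qscale qscale"

lemma qextend_superset:
  assumes "finite S" "keys c \<subseteq> S"
  shows "qextend b c = (\<Sum>x\<in>S. qscale (lookup c x) (b x))"
  unfolding qextend_def using assms
  by (intro sum.mono_neutral_left) (auto simp: in_keys_iff)

lemma qhom_qextend: "qhom (qextend b)"
proof
  fix c d :: "'a \<Rightarrow>\<^sub>0 rat" and q :: rat
  have "keys (c + d) \<subseteq> keys c \<union> keys d"
    by (rule keys_add)
  then show "qextend b (c + d) = qextend b c + qextend b d"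
    by (simp add: qextend_superset[of "keys c \<union> keys d"]
        lookup_add qvec.scale_left_distrib sum.distrib)
  have "keys (qscale q c) \<subseteq> keys c"
    by (auto simp: in_keys_iff)
  then show "qextend b (qscale q c) = qscale q (qextend b c)"
    by (simp add: qextend_superset[of "keys c"] qvec.scale_sum_right)
qed

lemmas qhom_qpush = qhom_qextend[of "\<lambda>x. single (h x) 1" for h, folded qpush_def]

lemmas qextend_simps [simp] =
  qhom_qextend[THEN module_hom.add] qhom_qextend[THEN module_hom.diff] qhom_qextend[THEN module_hom.neg]
  qhom_qextend[THEN module_hom.zero] qhom_qextend[THEN module_hom.scale] qhom_qextend[THEN module_hom.sum]
  qhom_qpush[THEN module_hom.add] qhom_qpush[THEN module_hom.diff] qhom_qpush[THEN module_hom.neg]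
  qhom_qpush[THEN module_hom.zero] qhom_qpush[THEN module_hom.scale] qhom_qpush[THEN module_hom.sum]

lemma qextend_single [simp]: "qextend b (single x q) = qscale q (b x)"
  by (simp add: qextend_superset[of "{x}"])

lemma qscale_single [simp]:
  "qscale q (single x r) = single x (q * r)"
  by (rule poly_mapping_eqI) (simp add: lookup_single when_def)

lemma qpush_single [simp]: "qpush h (single x q) = single (h x) q"
  by (simp add: qpush_def)

lemma qvec_expansion:
  "c = (\<Sum>x\<in>keys c. qscale (lookup c x) (single x 1))"
  by (rule poly_mapping_eqI)
    (auto simp: lookup_sum lookup_single when_def in_keys_iff)

lemma qhom_expansion:
  assumes "module_hom qscale s f"
  shows "f c = (\<Sum>x\<in>keys c. s (lookup c x) (f (single x 1)))"
  by (rule trans[OF arg_cong[OF qvec_expansion[of c], of f]])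
    (simp only: module_hom.sum[OF assms] module_hom.scale[OF assms])

lemma qhom_eqI:
  assumes "qhom f" "qhom g"
    and "\<And>x. x \<in> keys c \<Longrightarrow> f (single x 1) = g (single x 1)"
  shows "f c = g c"
  unfolding qhom_expansion[OF assms(1), of c] qhom_expansion[OF assms(2), of c]
  using assms(3) by (intro sum.cong) auto

text \<open>Together with \<open>qhom_eqI\<close> this is the induction principle for chains: a
  linear claim is checked on basis elements. Only those in \<open>keys c\<close> occur, so that the
  support of \<open>c\<close>, for instance in the singular simplices of a space, is
  available.\<close>

lemma qhom_in_subspace:
  assumes "qhom f" "qvec.subspace S"
    and "\<And>x. x \<in> keys c \<Longrightarrow> f (single x 1) \<in> S"
  shows "f c \<in> S"
  by (subst qhom_expansion[OF assms(1)], use assms in \<open>intro qvec.subspace_sum qvec.subspace_scale\<close>) auto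

lemma qhom_compose: "qhom f \<Longrightarrow> qhom g \<Longrightarrow> qhom (\<lambda>x. g (f x))"
  using module_hom_compose[of qscale qscale f qscale g] by (simp add: comp_def)

lemma qhom_id: "qhom (\<lambda>x. x)"
  by (auto simp: module_hom_iff qvec.module_axioms)

lemma qpush_qpush: "qpush f (qpush g c) = qpush (\<lambda>x. f (g x)) c"
  by (rule qhom_eqI[OF qhom_compose[OF qhom_qpush qhom_qpush] qhom_qpush]) simp

lemma qpush_cong: "(\<And>x. x \<in> keys c \<Longrightarrow> f x = g x) \<Longrightarrow> qpush f c = qpush g c"
  by (rule qhom_eqI[OF qhom_qpush qhom_qpush]) simp

lemma qpush_ident: "(\<And>x. x \<in> keys c \<Longrightarrow> f x = x) \<Longrightarrow> qpush f c = c"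
  by (rule qhom_eqI[OF qhom_qpush qhom_id]) simp

lemma subspace_keys: "qvec.subspace {c. keys c \<subseteq> A}"
proof (rule qvec.subspaceI)
  fix x y :: "'a \<Rightarrow>\<^sub>0 rat"
  assume "x \<in> {c. keys c \<subseteq> A}" "y \<in> {c. keys c \<subseteq> A}"
  then show "x + y \<in> {c. keys c \<subseteq> A}"
    using keys_add[of x y] by blast
qed (auto simp: in_keys_iff)

lemma keys_qpush: "keys (qpush f c) \<subseteq> f ` keys c"
proof -
  have "qpush f c \<in> {d. keys d \<subseteq> f ` keys c}"
    by (rule qhom_in_subspace[OF qhom_qpush subspace_keys]) auto
  then show ?thesis by simp
qed

lemma lookup_qpush_inj:
  assumes "inj f"
  shows "lookup (qpush f c) (f x) = lookup c x"
proof -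
  have "lookup (qpush f c) (f x)
      = (\<Sum>y\<in>keys c. if x = y then lookup c y else 0)"
    unfolding qpush_def qextend_def lookup_sum lookup_qscale lookup_single
    by (intro sum.cong refl) (use assms in \<open>simp add: inj_eq when_def eq_commute\<close>)
  then show ?thesis
    by (simp add: in_keys_iff)
qed

section \<open>Representations\<close>

lemma cring_rat_field: "cring rat_field"
proof (rule cringI)
  show "abelian_group rat_field"
  proof (rule abelian_groupI)
    show "\<exists>y\<in>carrier rat_field. y \<oplus>\<^bsub>rat_field\<^esub> x = \<zero>\<^bsub>rat_field\<^esub>" for x
      by (rule bexI[of _ "- x"]) (auto simp: rat_field_def)
  qed (auto simp: rat_field_def)
  show "comm_monoid rat_field"
    by unfold_locales (auto simp: rat_field_def)
qed (auto simp: rat_field_def algebra_simps)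

lemma with_action_simps [simp]:
  "carrier (with_action V a) = carrier V"
  "add (with_action V a) = add V"
  "zero (with_action V a) = zero V"
  "smult (with_action V a) = smult V"
  "action (with_action V a) = a"
  by (simp_all add: with_action_def module.defs rep.defs)

text \<open>Every axiom for \<open>W\<close> is pulled back along the bijection, so quotient
  modules, direct sums and Specht modules are never verified to be modules by hand. The zero has to
  be matched explicitly: before \<open>W\<close> is known to be a group, additivity of
  \<open>f\<close> does not determine the image of zero.\<close>

lemma rep_iso_transport:
  assumes V: "representation G V"
    and bij: "bij_betw f (carrier V) (carrier W)"
    and lin: "linear_map V W f"
    and zero: "f \<zero>\<^bsub>V\<^esub> = \<zero>\<^bsub>W\<^esub>"
    and equi: "\<And>g v. g \<in> carrier G \<Longrightarrow> v \<in> carrier V \<Longrightarrow> f (action V g v) = action W g (f v)"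
  shows "rep_iso G V W"
proof -
  interpret G: group G using V by (simp add: representation_def)
  interpret V: module rat_field V using V by (simp add: representation_def)
  have cW: "carrier W = f ` carrier V"
    using bij by (simp add: bij_betw_def)
  have surj: "\<exists>v\<in>carrier V. w = f v" if "w \<in> carrier W" for w
    using bij that by (auto simp: bij_betw_def)
  have add: "f x \<oplus>\<^bsub>W\<^esub> f y = f (x \<oplus>\<^bsub>V\<^esub> y)" if "x \<in> carrier V" "y \<in> carrier V" for x y
    using lin that by (simp add: linear_map_def)
  have smult: "q \<odot>\<^bsub>W\<^esub> f x = f (q \<odot>\<^bsub>V\<^esub> x)" if "x \<in> carrier V" for x q
    using lin that by (simp add: linear_map_def)
  have [simp]: "q \<in> carrier rat_field" for q by (simp add: rat_field_def)
  have act: "action V g v \<in> carrier V" if "g \<in> carrier G" "v \<in> carrier V" for g v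
    using V that by (auto simp: representation_def linear_map_def)
  have W: "module rat_field W"
  proof (rule moduleI[OF cring_rat_field])
    show "abelian_group W"
    proof (rule abelian_groupI)
      show "\<exists>y\<in>carrier W. y \<oplus>\<^bsub>W\<^esub> x = \<zero>\<^bsub>W\<^esub>" if x: "x \<in> carrier W" for x
      proof -
        obtain v where v: "v \<in> carrier V" "x = f v" using surj[OF x] by blast
        then have "f (\<ominus>\<^bsub>V\<^esub> v) \<oplus>\<^bsub>W\<^esub> x = \<zero>\<^bsub>W\<^esub>"
          by (simp add: add zero V.l_neg)
        with v show ?thesis by (auto simp: cW)
      qed
    qed (auto simp: cW add V.a_ac simp flip: zero)
  qed (auto simp: cW add smult V.smult_l_distr V.smult_r_distr V.smult_assoc1)
  have "representation G W"
    unfolding representation_def linear_map_def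
  proof (intro conjI ballI allI funcsetI)
    fix v assume "v \<in> carrier W"
    then obtain x where "x \<in> carrier V" "v = f x" using surj by blast
    then show "action W \<one>\<^bsub>G\<^esub> v = v"
      using V by (simp add: representation_def flip: equi)
  next
    fix g h v assume "v \<in> carrier W" and gh: "g \<in> carrier G" "h \<in> carrier G"
    then obtain x where x: "x \<in> carrier V" "v = f x" using surj by blast
    with gh V show "action W (g \<otimes>\<^bsub>G\<^esub> h) v = action W g (action W h v)"
      by (simp add: representation_def act flip: equi)
  next
    fix g v assume "v \<in> carrier W" and g: "g \<in> carrier G"
    then obtain x where x: "x \<in> carrier V" "v = f x" using surj by blast
    with g show "action W g v \<in> carrier W"
      by (simp add: cW act flip: equi)
    fix w assume "w \<in> carrier W"
    then obtain y where y: "y \<in> carrier V" "w = f y" using surj by blast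
    with g x V show "action W g (v \<oplus>\<^bsub>W\<^esub> w) = action W g v \<oplus>\<^bsub>W\<^esub> action W g w"
      by (simp add: act add representation_def linear_map_def flip: equi)
  next
    fix g v q assume "v \<in> carrier W" and g: "g \<in> carrier G"
    then obtain x where x: "x \<in> carrier V" "v = f x" using surj by blast
    with g V show "action W g (q \<odot>\<^bsub>W\<^esub> v) = q \<odot>\<^bsub>W\<^esub> action W g v"
      by (simp add: act smult representation_def linear_map_def flip: equi)
  qed (use W G.is_group in auto)
  with V bij lin equi show ?thesis
    unfolding rep_iso_def by blast
qed

text \<open>Symmetry and transitivity in one: a space of matrices \<open>V\<close> is mapped both to
  homology and to the Specht side, and the two arrows starting at \<open>V\<close> are
  joined.\<close>

lemma rep_iso_span:
  assumes "rep_iso G V W" "rep_iso G V U"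
  shows "rep_iso G W U"
proof -
  from assms(1) obtain f where V: "representation G V" and W: "representation G W"
    and f: "bij_betw f (carrier V) (carrier W)" "linear_map V W f"
      "\<And>g v. g \<in> carrier G \<Longrightarrow> v \<in> carrier V \<Longrightarrow> f (action V g v) = action W g (f v)"
    unfolding rep_iso_def by blast
  from assms(2) obtain h where U: "representation G U"
    and h: "bij_betw h (carrier V) (carrier U)" "linear_map V U h"
      "\<And>g v. g \<in> carrier G \<Longrightarrow> v \<in> carrier V \<Longrightarrow> h (action V g v) = action U g (h v)"
    unfolding rep_iso_def by blast
  interpret V: module rat_field V using V by (simp add: representation_def)
  define f' where "f' = the_inv_into (carrier V) f"
  have f': "bij_betw f' (carrier W) (carrier V)"
    unfolding f'_def by (rule bij_betw_the_inv_into[OF f(1)])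
  have f'f: "f' (f v) = v" if "v \<in> carrier V" for v
    unfolding f'_def using f(1) that by (simp add: the_inv_into_f_f bij_betw_def)
  have surj: "\<exists>v\<in>carrier V. w = f v" if "w \<in> carrier W" for w
    using f(1) that by (auto simp: bij_betw_def)
  have [simp]: "q \<in> carrier rat_field" for q by (simp add: rat_field_def)
  have act: "action V g v \<in> carrier V" if "g \<in> carrier G" "v \<in> carrier V" for g v
    using V that by (auto simp: representation_def linear_map_def)
  have "bij_betw (h \<circ> f') (carrier W) (carrier U)"
    by (rule bij_betw_trans[OF f' h(1)])
  moreover have "linear_map W U (h \<circ> f')"
    unfolding linear_map_def
  proof (intro conjI ballI allI funcsetI)
    fix x assume "x \<in> carrier W"
    then show "(h \<circ> f') x \<in> carrier U"
      using \<open>bij_betw (h \<circ> f') _ _\<close> by (auto simp: bij_betw_def)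
  next
    fix x y assume "x \<in> carrier W" "y \<in> carrier W"
    then obtain v w where "v \<in> carrier V" "w \<in> carrier V" "x = f v" "y = f w"
      using surj by meson
    moreover from this have "x \<oplus>\<^bsub>W\<^esub> y = f (v \<oplus>\<^bsub>V\<^esub> w)"
      using f(2) by (simp add: linear_map_def)
    ultimately show "(h \<circ> f') (x \<oplus>\<^bsub>W\<^esub> y) = (h \<circ> f') x \<oplus>\<^bsub>U\<^esub> (h \<circ> f') y"
      using h(2) by (simp add: f'f linear_map_def)
  next
    fix q x assume "x \<in> carrier W"
    then obtain v where "v \<in> carrier V" "x = f v"
      using surj by meson
    moreover from this have "q \<odot>\<^bsub>W\<^esub> x = f (q \<odot>\<^bsub>V\<^esub> v)"
      using f(2) by (simp add: linear_map_def)
    ultimately show "(h \<circ> f') (q \<odot>\<^bsub>W\<^esub> x) = q \<odot>\<^bsub>U\<^esub> (h \<circ> f') x"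
      using h(2) by (simp add: f'f linear_map_def)
  qed
  moreover have "(h \<circ> f') (action W g w) = action U g ((h \<circ> f') w)"
    if gw: "g \<in> carrier G" "w \<in> carrier W" for g w
  proof -
    obtain v where "v \<in> carrier V" "w = f v" using surj[OF gw(2)] by blast
    with gw show ?thesis by (simp add: f'f act h(3) flip: f(3))
  qed
  ultimately show ?thesis
    unfolding rep_iso_def using W U by blast
qed

lemma subspace_module_simps [simp]:
  "carrier (subspace_module V) = V"
  "add (subspace_module V) = (+)"
  "zero (subspace_module V) = 0"
  "smult (subspace_module V) = qscale"
  by (simp_all add: subspace_module_def)

lemma representation_subspace:
  assumes "group G" "qvec.subspace S"
    and closed: "\<And>g c. g \<in> carrier G \<Longrightarrow> c \<in> S \<Longrightarrow> qpush (a g) c \<in> S"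
    and one: "\<And>x. a \<one>\<^bsub>G\<^esub> x = x"
    and mult: "\<And>g h x. g \<in> carrier G \<Longrightarrow> h \<in> carrier G \<Longrightarrow> a (g \<otimes>\<^bsub>G\<^esub> h) x = a g (a h x)"
  shows "representation G (with_action (subspace_module S) (\<lambda>g. qpush (a g)))"
proof -
  let ?V = "with_action (subspace_module S) (\<lambda>g. qpush (a g))"
  have neg: "- x \<in> S" if "x \<in> S" for x
    using qvec.subspace_neg[OF assms(2) that] .
  have "module rat_field ?V"
  proof (rule moduleI[OF cring_rat_field])
    show "abelian_group ?V"
    proof (rule abelian_groupI)
      fix x assume "x \<in> carrier ?V"
      then show "\<exists>y\<in>carrier ?V.
        y \<oplus>\<^bsub>?V\<^esub> x
        = \<zero>\<^bsub>?V\<^esub>"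
        using neg by (auto intro!: bexI[of _ "- x"])
    qed (use assms(2) in \<open>auto simp: qvec.subspace_def algebra_simps\<close>)
  qed (use assms(2) in \<open>auto simp: qvec.subspace_def rat_field_def qvec.scale_left_distrib
        qvec.scale_right_distrib\<close>)
  with assms(1) show ?thesis
    unfolding representation_def linear_map_def
    by (auto simp: closed one mult qpush_qpush qpush_ident intro!: qpush_cong simp: module_hom.add[OF qhom_qpush]
        module_hom.scale[OF qhom_qpush])
qed

section \<open>Singular chains of dimension one\<close>

lemma qhom_qboundary: "qhom (qboundary p)"
  unfolding qboundary_def
  by (cases "p = 0") (auto simp: module_hom_iff qvec.module_axioms
      module_hom.add[OF qhom_qextend] module_hom.scale[OF qhom_qextend])

lemmas qboundary_simps [simp] =
  qhom_qboundary[THEN module_hom.add] qhom_qboundary[THEN module_hom.diff]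
  qhom_qboundary[THEN module_hom.neg] qhom_qboundary[THEN module_hom.zero]
  qhom_qboundary[THEN module_hom.scale] qhom_qboundary[THEN module_hom.sum]

lemma subspace_qchains: "qvec.subspace (qchains p X)"
  unfolding qchains_def by (rule subspace_keys)

lemma subspace_qboundaries: "qvec.subspace (qboundaries p X)"
  unfolding qboundaries_def
  using qhom_qboundary subspace_qchains by (rule module_hom.subspace_image)

lemma subspace_qcycles: "qvec.subspace (qcycles p X)"
  unfolding qcycles_def
  using subspace_qchains[of p X] by (auto simp: qvec.subspace_def)

lemma singular_face_simplex_map':
  assumes "p > 0" "k \<le> p"
  shows "singular_face p k (simplex_map p h f) = simplex_map (p - 1) h (singular_face p k f)"
  using assms unfolding singular_face_def simplex_map_def
  by (auto simp: fun_eq_iff restrict_def simplical_face_in_standard_simplex)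

lemma qboundary_qpush:
  assumes "p > 0"
  shows "qboundary p (qpush (simplex_map p h) c) = qpush (simplex_map (p - 1) h) (qboundary p c)"
  by (rule qhom_eqI[OF qhom_compose[OF qhom_qpush qhom_qboundary] qhom_compose[OF qhom_qboundary qhom_qpush]])
    (use assms in \<open>simp add: qboundary_def singular_face_simplex_map'\<close>)

lemma qpush_qchains:
  assumes "continuous_map X Y h" "c \<in> qchains p X"
  shows "qpush (simplex_map p h) c \<in> qchains p Y"
  using assms keys_qpush[of "simplex_map p h" c] singular_simplex_simplex_map[of p X _ Y h]
  unfolding qchains_def by blast

lemma qpush_qboundaries:
  assumes "continuous_map X Y h" "c \<in> qboundaries p X"
  shows "qpush (simplex_map p h) c \<in> qboundaries p Y"
proof -
  obtain d where d: "d \<in> qchains (Suc p) X" "c = qboundary (Suc p) d"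
    using assms(2) by (auto simp: qboundaries_def)
  then have "qpush (simplex_map p h) c = qboundary (Suc p) (qpush (simplex_map (Suc p) h) d)"
    by (simp add: qboundary_qpush)
  then show ?thesis
    using qpush_qchains[OF assms(1) d(1)] by (auto simp: qboundaries_def)
qed

text \<open>The map sends \<open>M\<close> to the class of \<open>qpush s M\<close>, which turns the
  computation of homology into three claims about chains: cycles, every class hit, no nonzero
  boundary. Equivariance is demanded only for indices in the support of some \<open>M\<close>,
  because for unordered points the simplices are permuted correctly only when their paths lie in the
  configuration space.\<close>

lemma homology_rep_iso:
  fixes s :: "'e \<Rightarrow> (nat \<Rightarrow> real) \<Rightarrow> 'x"
  assumes Z: "representation G (with_action (subspace_module Z) (\<lambda>g. qpush (b g)))"
    and sub: "qvec.subspace Z"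
    and cycle: "\<And>M. M \<in> Z \<Longrightarrow> qpush s M \<in> qcycles p X"
    and surj: "\<And>c. c \<in> qcycles p X \<Longrightarrow> \<exists>M\<in>Z. c - qpush s M \<in> qboundaries p X"
    and inj: "\<And>M. M \<in> Z \<Longrightarrow> qpush s M \<in> qboundaries p X \<Longrightarrow> M = 0"
    and cont: "\<And>g. g \<in> carrier G \<Longrightarrow> continuous_map X X (a g)"
    and equi: "\<And>g M x. g \<in> carrier G \<Longrightarrow> M \<in> Z \<Longrightarrow> x \<in> keys M
        \<Longrightarrow> simplex_map p (a g) (s x) = s (b g x)"
  shows "rep_iso G (with_action (subspace_module Z) (\<lambda>g. qpush (b g))) (homology_rep p X a)"
proof -
  let ?B = "qboundaries p X" and ?V = "with_action (subspace_module Z) (\<lambda>g. qpush (b g))"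
  define f where "f M = {qpush s M + w | w. w \<in> ?B}" for M
  note B = subspace_qboundaries[of p X]
  note B0 = qvec.subspace_0[OF B] and Badd = qvec.subspace_add[OF B]
    and Bdiff = qvec.subspace_diff[OF B] and Bscale = qvec.subspace_scale[OF B]
  have coset_eqI: "{v + w | w. w \<in> ?B} = {v' + w | w. w \<in> ?B}" if "v - v' \<in> ?B" for v v'
  proof -
    have "v + w = v' + (v - v' + w)" "v' + w = v + (w - (v - v'))" for w by simp_all
    with that Badd Bdiff show ?thesis by blast
  qed
  have mem_f: "qpush s M + w \<in> f M" if "w \<in> ?B" for M w
    using that by (auto simp: f_def)
  have carr: "carrier (homology_rep p X a) = (\<lambda>v. {v + w | w. w \<in> ?B}) ` qcycles p X"
    by (auto simp: homology_rep_def rat_homology_def quotient_module_def)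
  show ?thesis
  proof (rule rep_iso_transport[OF Z, where f = f])
    show "bij_betw f (carrier ?V)
        (carrier (homology_rep p X a))"
      unfolding bij_betw_def
    proof (intro conjI inj_onI)
      fix M M' assume M: "M \<in> carrier ?V"
        "M' \<in> carrier ?V" "f M = f M'"
      then have "qpush s M \<in> f M'"
        using mem_f[OF B0, of M] by simp
      then obtain w where "w \<in> ?B" "qpush s M = qpush s M' + w"
        by (auto simp: f_def)
      then have "qpush s (M - M') \<in> ?B"
        by simp
      then show "M = M'"
        using inj[of "M - M'"] M qvec.subspace_diff[OF sub] by simp
    next
      show "f ` carrier ?V
          = carrier (homology_rep p X a)"
        unfolding carr f_def using cycle by (auto dest!: surj) (blast dest: coset_eqI)
    qed
    show "linear_map ?V (homology_rep p X a) f"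
      unfolding linear_map_def
    proof (intro conjI ballI allI funcsetI)
      fix M assume "M \<in> carrier ?V"
      then show "f M \<in> carrier (homology_rep p X a)"
        unfolding carr f_def using cycle by auto
    next
      fix M M' :: "'e \<Rightarrow>\<^sub>0 rat"
      have "f (M + M') = {a + b | a b. a \<in> f M \<and> b \<in> f M'}"
      proof (intro equalityI subsetI)
        fix x assume "x \<in> f (M + M')"
        then obtain w where "w \<in> ?B" "x = (qpush s M + w) + (qpush s M' + 0)"
          by (auto simp: f_def algebra_simps)
        then show "x \<in> {a + b | a b. a \<in> f M \<and> b \<in> f M'}"
          using mem_f B0 by blast
      next
        fix x assume "x \<in> {a + b | a b. a \<in> f M \<and> b \<in> f M'}"
        then obtain w w' where "w \<in> ?B" "w' \<in> ?B" "x = (qpush s M + w) + (qpush s M' + w')"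
          by (auto simp: f_def)
        then have "x = qpush s (M + M') + (w + w')" "w + w' \<in> ?B"
          by (auto simp: algebra_simps Badd)
        then show "x \<in> f (M + M')"
          using mem_f by blast
      qed
      then show "f (M \<oplus>\<^bsub>?V\<^esub> M')
          = f M \<oplus>\<^bsub>homology_rep p X a\<^esub> f M'"
        by (simp add: homology_rep_def rat_homology_def quotient_module_def)
    next
      fix q and M :: "'e \<Rightarrow>\<^sub>0 rat"
      have "f (qscale q M) = {qscale q a + w | a w. a \<in> f M \<and> w \<in> ?B}"
      proof (intro equalityI subsetI)
        fix x assume "x \<in> f (qscale q M)"
        then obtain w where "w \<in> ?B" "x = qscale q (qpush s M + 0) + w"
          by (auto simp: f_def )
        then show "x \<in> {qscale q a + w | a w. a \<in> f M \<and> w \<in> ?B}"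
          using mem_f B0 by blast
      next
        fix x assume "x \<in> {qscale q a + w | a w. a \<in> f M \<and> w \<in> ?B}"
        then obtain w w' where "w \<in> ?B" "w' \<in> ?B" "x = qscale q (qpush s M + w) + w'"
          by (auto simp: f_def)
        then have "x = qpush s (qscale q M) + (qscale q w + w')" "qscale q w + w' \<in> ?B"
          by (auto simp: qvec.scale_right_distrib algebra_simps
              intro!: Badd Bscale)
        then show "x \<in> f (qscale q M)"
          using mem_f by blast
      qed
      then show "f (q \<odot>\<^bsub>?V\<^esub> M)
          = q \<odot>\<^bsub>homology_rep p X a\<^esub> f M"
        by (simp add: homology_rep_def rat_homology_def quotient_module_def)
    qed
    show "f \<zero>\<^bsub>?V\<^esub> = \<zero>\<^bsub>homology_rep p X a\<^esub>"
      by (simp add: f_def homology_rep_def rat_homology_def quotient_module_def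
          )
    fix g M assume g: "g \<in> carrier G"
      and "M \<in> carrier ?V"
    then have M: "M \<in> Z" by simp
    have push: "qpush (simplex_map p (a g)) (qpush s M) = qpush s (qpush (b g) M)"
      unfolding qpush_qpush using equi[OF g M] by (rule qpush_cong)
    have "f (qpush (b g) M)
        = {qpush (simplex_map p (a g)) c + w | c w. c \<in> f M \<and> w \<in> ?B}"
    proof (intro equalityI subsetI)
      fix x assume "x \<in> f (qpush (b g) M)"
      then obtain w where "w \<in> ?B" "x = qpush (simplex_map p (a g)) (qpush s M + 0) + w"
        by (auto simp: f_def push)
      then show "x \<in> {qpush (simplex_map p (a g)) c + w | c w. c \<in> f M \<and> w \<in> ?B}"
        using mem_f B0 by blast
    next
      fix x assume "x \<in> {qpush (simplex_map p (a g)) c + w | c w. c \<in> f M \<and> w \<in> ?B}"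
      then obtain w w' where "w \<in> ?B" "w' \<in> ?B"
          "x = qpush (simplex_map p (a g)) (qpush s M + w) + w'"
        by (auto simp: f_def)
      then have "x = qpush s (qpush (b g) M) + (qpush (simplex_map p (a g)) w + w')"
          "qpush (simplex_map p (a g)) w + w' \<in> ?B"
        by (auto simp: push algebra_simps
              intro!: Badd qpush_qboundaries[OF cont[OF g]])
      then show "x \<in> f (qpush (b g) M)"
        using mem_f by blast
    qed
    then show "f (action ?V g M)
        = action (homology_rep p X a) g (f M)"
      by (simp add: homology_rep_def rat_homology_map_def)
  qed
qed

section \<open>Paths as singular 1-simplices\<close>

definition path_simplex :: "(real \<Rightarrow> 'a) \<Rightarrow> (nat \<Rightarrow> real) \<Rightarrow> 'a" where
  "path_simplex g = restrict (\<lambda>x. g (x 1)) (standard_simplex 1)"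

definition point_simplex :: "'a \<Rightarrow> (nat \<Rightarrow> real) \<Rightarrow> 'a" where
  "point_simplex x = restrict (\<lambda>_. x) (standard_simplex 0)"

abbreviation path_chain :: "(real \<Rightarrow> 'a) \<Rightarrow> ((nat \<Rightarrow> real) \<Rightarrow> 'a) \<Rightarrow>\<^sub>0 rat" where
  "path_chain g \<equiv> single (path_simplex g) 1"

abbreviation bary1 :: "real \<Rightarrow> nat \<Rightarrow> real" where
  "bary1 t \<equiv> \<lambda>i. if i = 0 then 1 - t else if i = 1 then t else 0"

lemma bary1_in_simplex: "t \<in> {0..1} \<Longrightarrow> bary1 t \<in> standard_simplex 1"
  by (auto simp: standard_simplex_def)

lemma standard_simplex_1D:
  assumes "x \<in> standard_simplex 1"
  shows "x = bary1 (x 1)" "x 1 \<in> {0..1}"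
proof -
  have "x 0 + x 1 = 1" "\<And>i. i > 1 \<Longrightarrow> x i = 0" "x 1 \<in> {0..1}"
    using assms by (auto simp: standard_simplex_def)
  then show "x = bary1 (x 1)" "x 1 \<in> {0..1}"
    by (auto simp: fun_eq_iff)
qed

lemma continuous_map_bary1:
  "continuous_map (top_of_set {0..1}) (subtopology (powertop_real UNIV) (standard_simplex 1)) bary1"
  unfolding continuous_map_in_subtopology continuous_map_componentwise_UNIV
proof (intro conjI allI)
  show "continuous_map (top_of_set {0..1}) euclideanreal (\<lambda>x. bary1 x i)" for i
    by (cases "i = 0"; cases "i = 1") (auto intro!: continuous_intros)
qed (use bary1_in_simplex in auto)

lemma path_simplex_bary1: "t \<in> {0..1} \<Longrightarrow> path_simplex g (bary1 t) = g t"
  using bary1_in_simplex[of t] by (auto simp: path_simplex_def)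

lemma path_simplex_cong: "(\<And>t. t \<in> {0..1} \<Longrightarrow> g t = h t) \<Longrightarrow> path_simplex g = path_simplex h"
  using standard_simplex_1D(2) by (auto simp: path_simplex_def fun_eq_iff restrict_def)

lemma singular_simplex_path:
  assumes "pathin X g"
  shows "singular_simplex 1 X (path_simplex g)"
proof -
  have "continuous_map (subtopology (powertop_real UNIV) (standard_simplex 1)) (top_of_set {0..1}) (\<lambda>x. x 1)"
    unfolding continuous_map_in_subtopology
    using standard_simplex_1D(2)
    by (auto intro!: continuous_map_from_subtopology continuous_map_product_projection)
  then have "continuous_map (subtopology (powertop_real UNIV) (standard_simplex 1)) X (g \<circ> (\<lambda>x. x 1))"
    using assms unfolding pathin_def by (rule continuous_map_compose)
  then show ?thesis
    by (auto simp: singular_simplex_def path_simplex_def comp_def)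
qed

lemma path_chain_in_qchains: "pathin X g \<Longrightarrow> path_chain g \<in> qchains 1 X"
  using singular_simplex_path[of X g] by (simp add: qchains_def)

text \<open>Singular simplices are extensional on the standard simplex, so a 1-simplex literally
  equals the simplex of its path; no homology is involved in passing from simplices to
  paths.\<close>

lemma singular_simplex_1_path:
  assumes "singular_simplex 1 X f"
  shows "pathin X (\<lambda>t. f (bary1 t))" "f = path_simplex (\<lambda>t. f (bary1 t))"
proof -
  show "pathin X (\<lambda>t. f (bary1 t))"
    using continuous_map_compose[OF continuous_map_bary1] assms
    by (fastforce simp: pathin_def singular_simplex_def comp_def)
  show "f = path_simplex (\<lambda>t. f (bary1 t))"
    unfolding path_simplex_def
  proof (rule ext)
    fix x
    show "f x = restrict (\<lambda>x. f (bary1 (x 1))) (standard_simplex 1) x"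
    proof (cases "x \<in> standard_simplex 1")
      case True
      then show ?thesis using standard_simplex_1D(1)[OF True] by simp
    next
      case False
      then show ?thesis using assms by (auto simp: singular_simplex_def extensional_def)
    qed
  qed
qed

lemma simplex_map_path: "simplex_map 1 h (path_simplex g) = path_simplex (\<lambda>t. h (g t))"
  by (auto simp: simplex_map_def path_simplex_def fun_eq_iff restrict_def)

lemma simplical_face_0_vertex:
  "simplical_face 0 (\<lambda>j::nat. if j = 0 then 1 else 0) = bary1 1"
  "simplical_face 1 (\<lambda>j::nat. if j = 0 then 1 else 0) = bary1 0"
  by (auto simp: simplical_face_def fun_eq_iff)

lemma qboundary_path_chain:
  "qboundary 1 (path_chain g)
    = single (point_simplex (g 1)) 1 - single (point_simplex (g 0)) 1"
proof -
  have "singular_face 1 k (path_simplex g) = point_simplex (g t)"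
    if "simplical_face k (\<lambda>j::nat. if j = 0 then 1 else 0) = bary1 t" "t \<in> {0..1}" for k t
  proof (rule ext)
    fix x
    show "singular_face 1 k (path_simplex g) x = point_simplex (g t) x"
    proof (cases "x \<in> standard_simplex 0")
      case True
      then have "simplical_face k x = bary1 t"
        using that(1) by (simp add: standard_simplex_0)
      with True show ?thesis
        using path_simplex_bary1[OF that(2), of g] by (simp add: singular_face_def point_simplex_def)
    qed (simp add: singular_face_def point_simplex_def)
  qed
  from this[OF simplical_face_0_vertex(1)] this[OF simplical_face_0_vertex(2)]
  have "singular_face 1 0 (path_simplex g) = point_simplex (g 1)"
    "singular_face 1 1 (path_simplex g) = point_simplex (g 0)"
    by simp_all
  then show ?thesis
    by (simp add: qboundary_def single_uminus)
qed

section \<open>Homologies between paths, obtained from triangles\<close>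

definition std_triangle :: "(real \<times> real) set" where
  "std_triangle = {(s, t). 0 \<le> s \<and> 0 \<le> t \<and> s + t \<le> 1}"

lemma convex_std_triangle: "convex std_triangle"
proof -
  have "std_triangle = {z. inner (1,0) z \<ge> 0} \<inter> {z. inner (0,1) z \<ge> 0} \<inter> {z. inner (1,1) z \<le> 1}"
    by (auto simp: std_triangle_def)
  also have "convex \<dots>"
    by (intro convex_Int convex_halfspace_ge convex_halfspace_le)
  finally show ?thesis .
qed

abbreviation bary2 :: "real \<times> real \<Rightarrow> nat \<Rightarrow> real" where
  "bary2 p \<equiv> \<lambda>i. if i = 0 then 1 - fst p - snd p else if i = 1 then fst p else if i = 2 then snd p else 0"

lemma bary2_in_simplex: "p \<in> std_triangle \<Longrightarrow> bary2 p \<in> standard_simplex 2"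
  by (auto simp: standard_simplex_def std_triangle_def numeral_2_eq_2)

lemma standard_simplex_2D:
  assumes "x \<in> standard_simplex 2"
  shows "x = bary2 (x 1, x 2)" "(x 1, x 2) \<in> std_triangle"
proof -
  have "x 0 + x 1 + x 2 = 1" "\<And>i. i > 2 \<Longrightarrow> x i = 0" "\<And>i. 0 \<le> x i"
    using assms by (auto simp: standard_simplex_def numeral_2_eq_2)
  then show "x = bary2 (x 1, x 2)" "(x 1, x 2) \<in> std_triangle"
    by (auto simp: fun_eq_iff std_triangle_def) (smt (verit))+
qed

lemma continuous_map_bary2:
  "continuous_map (top_of_set std_triangle) (subtopology (powertop_real UNIV) (standard_simplex 2)) bary2"
  unfolding continuous_map_in_subtopology continuous_map_componentwise_UNIV
proof (intro conjI allI)
  show "continuous_map (top_of_set std_triangle) euclideanreal (\<lambda>x. bary2 x i)" for i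
    by (cases "i = 0"; cases "i = 1"; cases "i = 2") (auto intro!: continuous_intros)
qed (use bary2_in_simplex in auto)

lemma simplical_face_1_bary:
  "simplical_face 0 (bary1 t) = bary2 (linepath (1,0) (0,1) t)"
  "simplical_face 1 (bary1 t) = bary2 (linepath (0,0) (0,1) t)"
  "simplical_face 2 (bary1 t) = bary2 (linepath (0,0) (1,0) t)"
  by (auto simp: simplical_face_def fun_eq_iff linepath_def)

lemma singular_face_2:
  assumes "\<And>p. p \<in> std_triangle \<Longrightarrow> f (bary2 p) = G p"
  shows "singular_face 2 0 f = path_simplex (G \<circ> linepath (1,0) (0,1))"
    "singular_face 2 1 f = path_simplex (G \<circ> linepath (0,0) (0,1))"
    "singular_face 2 2 f = path_simplex (G \<circ> linepath (0,0) (1,0))"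
proof -
  have "singular_face 2 k f = path_simplex (G \<circ> l)"
    if *: "\<And>t. simplical_face k (bary1 t) = bary2 (l t)" and l: "\<And>t. t \<in> {0..1} \<Longrightarrow> l t \<in> std_triangle" for k l
  proof (rule ext)
    fix x
    show "singular_face 2 k f x = path_simplex (G \<circ> l) x"
    proof (cases "x \<in> standard_simplex 1")
      case True
      note x = standard_simplex_1D[OF True]
      have "simplical_face k x = bary2 (l (x 1))"
        using *[of "x 1"] x(1) by simp
      then show ?thesis
        using True assms[OF l[OF x(2)]] by (simp add: singular_face_def path_simplex_def)
    qed (auto simp: singular_face_def path_simplex_def)
  qed
  note * = this
  have lp: "linepath a b t \<in> std_triangle" if "a \<in> std_triangle" "b \<in> std_triangle" "t \<in> {0..1}" for a b t
    using that convex_std_triangle linepath_image_01[of a b] closed_segment_subset[of a std_triangle b]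
    by (metis image_eqI subsetD)
  show "singular_face 2 0 f = path_simplex (G \<circ> linepath (1,0) (0,1))"
    "singular_face 2 1 f = path_simplex (G \<circ> linepath (0,0) (0,1))"
    "singular_face 2 2 f = path_simplex (G \<circ> linepath (0,0) (1,0))"
    by (rule *[OF simplical_face_1_bary(1) lp] *[OF simplical_face_1_bary(2) lp]
        *[OF simplical_face_1_bary(3) lp]; simp add: std_triangle_def)+
qed

lemma qboundary_2_single:
  assumes "\<And>p. p \<in> std_triangle \<Longrightarrow> f (bary2 p) = G p"
  shows "qboundary 2 (single f 1) = path_chain (G \<circ> linepath (1,0) (0,1))
    - path_chain (G \<circ> linepath (0,0) (0,1)) + path_chain (G \<circ> linepath (0,0) (1,0))"
  using singular_face_2[of f G, OF assms]
  by (simp add: qboundary_def numeral_2_eq_2 single_uminus)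

lemma singular_simplex_2_triangle:
  assumes "singular_simplex 2 X f"
  shows "continuous_map (top_of_set std_triangle) X (f \<circ> bary2)"
  using assms continuous_map_compose[OF continuous_map_bary2]
  by (auto simp: singular_simplex_def)

lemma path_simplex_linepath:
  "path_simplex ((\<lambda>p. g (A + fst p *\<^sub>R U + snd p *\<^sub>R V)) \<circ> linepath a b)
    = path_simplex (g \<circ> linepath (A + fst a *\<^sub>R U + snd a *\<^sub>R V) (A + fst b *\<^sub>R U + snd b *\<^sub>R V))"
  by (rule path_simplex_cong) (simp add: linepath_def algebra_simps)

text \<open>The affine map from the standard triangle to the triangle \<open>P\<close>,
  \<open>Q\<close>, \<open>R\<close> stays in the convex set \<open>D\<close>, and \<open>g\<close>
  composed with it is a singular 2-simplex. Degenerate triangles are allowed, and the next lemmas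
  live on them.\<close>

lemma triangle_in_qboundaries:
  fixes g :: "real \<times> real \<Rightarrow> 'a"
  assumes g: "continuous_map (top_of_set D) X g" and D: "convex D" and P: "P \<in> D" "Q \<in> D" "R \<in> D"
  shows "path_chain (g \<circ> linepath Q R) - path_chain (g \<circ> linepath P R) + path_chain (g \<circ> linepath P Q)
    \<in> qboundaries 1 X"
proof -
  define A where "A p = P + fst p *\<^sub>R (Q - P) + snd p *\<^sub>R (R - P)" for p :: "real \<times> real"
  have A_in: "A p \<in> D" if "p \<in> std_triangle" for p
  proof -
    have "A p = (1 - fst p - snd p) *\<^sub>R P + fst p *\<^sub>R Q + snd p *\<^sub>R R"
      by (simp add: A_def algebra_simps)
    then have "A p \<in> convex hull {P, Q, R}"
      unfolding convex_hull_3 using that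
      by (intro CollectI exI[of _ "1 - fst p - snd p"] exI[of _ "fst p"] exI[of _ "snd p"])
        (auto simp: std_triangle_def)
    with P show ?thesis
      using hull_minimal[of "{P, Q, R}" D convex] D by auto
  qed
  define f where "f = restrict (\<lambda>x. g (A (x 1, x 2))) (standard_simplex 2)"
  have "continuous_map (subtopology (powertop_real UNIV) (standard_simplex 2)) (top_of_set D) (\<lambda>x. A (x 1, x 2))"
    unfolding continuous_map_in_subtopology
  proof
    show "continuous_map (subtopology (powertop_real UNIV) (standard_simplex 2)) euclidean (\<lambda>x. A (x 1, x 2))"
      unfolding A_def fst_conv snd_conv euclidean_product_topology continuous_map_iff_continuous
      by (intro continuous_intros continuous_on_subset[OF continuous_on_product_coordinates] subset_UNIV)
  qed (use A_in standard_simplex_2D in auto)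
  then have "continuous_map (subtopology (powertop_real UNIV) (standard_simplex 2)) X (g \<circ> (\<lambda>x. A (x 1, x 2)))"
    using g by (rule continuous_map_compose)
  then have "singular_simplex 2 X f"
    by (auto simp: singular_simplex_def f_def comp_def)
  then have "qboundary 2 (single f 1) \<in> qboundaries 1 X"
    by (auto simp: qboundaries_def qchains_def numeral_2_eq_2 intro!: imageI)
  also have "qboundary 2 (single f 1)
      = path_chain ((\<lambda>p. g (A p)) \<circ> linepath (1,0) (0,1)) - path_chain ((\<lambda>p. g (A p)) \<circ> linepath (0,0) (0,1))
        + path_chain ((\<lambda>p. g (A p)) \<circ> linepath (0,0) (1,0))"
    using bary2_in_simplex by (intro qboundary_2_single) (simp add: f_def)
  finally show ?thesis
    by (simp add: A_def path_simplex_linepath)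
qed

text \<open>A path is a map on a strip that depends only on the first coordinate, and three points
  on the axis span a flattened triangle. The order of \<open>a\<close>, \<open>b\<close>,
  \<open>c\<close> is free, which also covers constant and reversed paths.\<close>

lemma path_split_in_qboundaries:
  assumes g: "pathin X g" and abc: "a \<in> {0..1}" "b \<in> {0..1}" "c \<in> {0..1}"
  shows "path_chain (g \<circ> linepath b c) - path_chain (g \<circ> linepath a c) + path_chain (g \<circ> linepath a b)
    \<in> qboundaries 1 X"
proof -
  have "continuous_map (top_of_set ({0..1} \<times> UNIV)) (top_of_set {0..1}) (fst :: real \<times> real \<Rightarrow> real)"
    by (auto simp: continuous_map_iff_continuous continuous_map_in_subtopology intro!: continuous_intros)
  then have "continuous_map (top_of_set ({0..1} \<times> UNIV)) X (g \<circ> (fst :: real \<times> real \<Rightarrow> real))"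
    using g unfolding pathin_def by (rule continuous_map_compose)
  from triangle_in_qboundaries[OF this _ _ _ _, of "(a, 0)" "(b, 0)" "(c, 0)"] abc
  show ?thesis
    by (simp add: convex_Times comp_def linepath_def)
qed

lemma const_path_in_qboundaries:
  assumes "x \<in> topspace X"
  shows "path_chain (\<lambda>_. x) \<in> qboundaries 1 X"
proof -
  have "pathin X (\<lambda>_. x)" using assms by simp
  from path_split_in_qboundaries[OF this, of 0 0 0] show ?thesis by (simp add: comp_def)
qed

lemma path_reverse_in_qboundaries:
  assumes "pathin X g"
  shows "path_chain g + path_chain (\<lambda>t. g (1 - t)) \<in> qboundaries 1 X"
proof -
  have "g 0 \<in> topspace X"
    using path_start_in_topspace[OF assms] .
  \<comment> \<open>With \<open>a = c\<close> the triangle runs along \<open>g\<close> and back; its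
    third side is constant and is itself a boundary.\<close>
  from qvec.subspace_add[OF subspace_qboundaries path_split_in_qboundaries[OF assms, of 0 1 0]
      const_path_in_qboundaries[OF this]]
  show ?thesis
    by (simp add: comp_def linepath_def add.commute)
qed

text \<open>Two triangles that share the diagonal from \<open>(0,0)\<close> to \<open>(1,1)\<close>,
  which cancels in the difference.\<close>

lemma square_in_qboundaries:
  fixes K :: "real \<times> real \<Rightarrow> 'a"
  assumes K: "continuous_map (top_of_set ({0..1} \<times> {0..1})) X K"
  shows "path_chain (\<lambda>t. K (t, 0)) + path_chain (\<lambda>t. K (1, t))
    - path_chain (\<lambda>t. K (0, t)) - path_chain (\<lambda>t. K (t, 1)) \<in> qboundaries 1 X"
proof -
  have D: "convex ({0..1::real} \<times> {0..1::real})" by (simp add: convex_Times)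
  have "path_chain (K \<circ> linepath (1,0) (1,1)) - path_chain (K \<circ> linepath (0,0) (1,1))
      + path_chain (K \<circ> linepath (0,0) (1,0)) \<in> qboundaries 1 X"
    "path_chain (K \<circ> linepath (0,1) (1,1)) - path_chain (K \<circ> linepath (0,0) (1,1))
      + path_chain (K \<circ> linepath (0,0) (0,1)) \<in> qboundaries 1 X"
    by (rule triangle_in_qboundaries[OF K D]; simp)+
  from qvec.subspace_diff[OF subspace_qboundaries this] show ?thesis
    by (simp add: linepath_def comp_def algebra_simps)
qed

text \<open>Apply the square to \<open>K (t, u) = H (u, g t)\<close>: one side is \<open>g\<close>,
  the opposite one is constant at \<open>c\<close> and hence a boundary, and the remaining two are
  the tracks of the end points under the contraction.\<close>

lemma contraction_in_qboundaries:
  assumes H: "continuous_map (prod_topology (top_of_set {0..1}) (subtopology X S)) X H"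
    and H0: "\<And>z. z \<in> S \<Longrightarrow> H (0, z) = z" and H1: "\<And>z. z \<in> S \<Longrightarrow> H (1, z) = c"
    and g: "pathin (subtopology X S) g"
  shows "path_chain g - (path_chain (\<lambda>u. H (u, g 0)) - path_chain (\<lambda>u. H (u, g 1))) \<in> qboundaries 1 X"
proof -
  have gS: "g t \<in> topspace X \<inter> S" if "t \<in> {0..1}" for t
    using g that by (auto simp: pathin_def continuous_map_def)
  have "continuous_map (prod_topology (top_of_set {0..1}) (top_of_set {0..1}))
      (prod_topology (top_of_set {0..1}) (subtopology X S)) (\<lambda>p. (snd p, g (fst p)))"
    by (intro continuous_map_pairedI continuous_map_snd
        continuous_map_compose[OF continuous_map_fst g[unfolded pathin_def], unfolded comp_def])
  from continuous_map_compose[OF this H]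
  have "continuous_map (top_of_set ({0..1} \<times> {0..1})) X (\<lambda>p. H (snd p, g (fst p)))"
    by (simp add: comp_def prod_topology_subtopology subtopology_subtopology Times_Int_Times)
  from square_in_qboundaries[OF this]
  have "path_chain (\<lambda>t. H (0, g t)) + path_chain (\<lambda>u. H (u, g 1)) - path_chain (\<lambda>u. H (u, g 0))
      - path_chain (\<lambda>t. H (1, g t)) \<in> qboundaries 1 X"
    by simp
  moreover have "path_simplex (\<lambda>t. H (0, g t)) = path_simplex g"
    "path_simplex (\<lambda>t. H (1, g t)) = path_simplex (\<lambda>_. c)"
    using gS H0 H1 by (auto intro!: path_simplex_cong)
  moreover have "c \<in> topspace X"
  proof -
    have "(1 :: real, g 0) \<in> topspace (prod_topology (top_of_set {0..1}) (subtopology X S))"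
      using gS by simp
    then have "H (1, g 0) \<in> topspace X"
      using H by (blast dest: continuous_map_image_subset_topspace)
    then show ?thesis using H1 gS[of 0] by simp
  qed
  ultimately show ?thesis
    using qvec.subspace_add[OF subspace_qboundaries _ const_path_in_qboundaries[of c X]]
    by (fastforce simp: algebra_simps)
qed

text \<open>The potential \<open>h\<close> stands for a choice of paths from the points of \<open>X\<close> to base points.\<close>

lemma path_local_to_global:
  assumes N: "qvec.subspace N" "qboundaries 1 X \<subseteq> N"
    and local: "\<And>y. y \<in> topspace X \<Longrightarrow> \<exists>V. openin X V \<and> y \<in> V \<and>
      (\<forall>g. pathin (subtopology X V) g \<longrightarrow> path_chain g - (h (g 0) - h (g 1)) \<in> N)"
    and g: "pathin X g"
  shows "path_chain g - (h (g 0) - h (g 1)) \<in> N"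
proof -
  have cg: "continuous_map (top_of_set {0..1}) X g" using g by (simp add: pathin_def)
  \<comment> \<open>\<open>Bolzano\<close> passes from short intervals to \<open>{0..1}\<close>, in
    place of a Lebesgue number. Its local hypothesis ranges over all short intervals around a point,
    including those that stick out of \<open>{0..1}\<close>, so the bounds are built into
    \<open>P\<close>.\<close>
  define P where "P a b \<longleftrightarrow> (0 \<le> a \<longrightarrow> a \<le> b \<longrightarrow> b \<le> 1 \<longrightarrow>
    path_chain (g \<circ> linepath a b) - (h (g a) - h (g b)) \<in> N)" for a b :: real
  have "P 0 1"
  proof (rule Bolzano[of 0 1 P])
    fix a b c :: real assume abc: "P a b" "P b c" "a \<le> b" "b \<le> c"
    show "P a c"
      unfolding P_def
    proof (intro impI)
      assume "0 \<le> a" "a \<le> c" "c \<le> 1"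
      with abc have ab: "path_chain (g \<circ> linepath a b) - (h (g a) - h (g b)) \<in> N"
        and bc: "path_chain (g \<circ> linepath b c) - (h (g b) - h (g c)) \<in> N"
        by (auto simp: P_def)
      have "path_chain (g \<circ> linepath b c) - path_chain (g \<circ> linepath a c) + path_chain (g \<circ> linepath a b) \<in> N"
        using path_split_in_qboundaries[OF g, of a b c] \<open>0 \<le> a\<close> abc(3,4) \<open>c \<le> 1\<close> N(2) by auto
      from qvec.subspace_diff[OF N(1) qvec.subspace_add[OF N(1) ab bc] this]
      show "path_chain (g \<circ> linepath a c) - (h (g a) - h (g c)) \<in> N"
        by (simp add: algebra_simps)
    qed
  next
    fix x :: real assume "0 \<le> x" "x \<le> 1"
    then have x: "x \<in> topspace (top_of_set {0..1})" by simp
    then have "g x \<in> topspace X"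
      using cg by (auto simp: continuous_map_def)
    then obtain V where V: "openin X V" "g x \<in> V"
      "\<And>g. pathin (subtopology X V) g \<Longrightarrow> path_chain g - (h (g 0) - h (g 1)) \<in> N"
      using local by blast
    have "openin (top_of_set {0..1}) {t \<in> {0..1}. g t \<in> V}"
      using openin_continuous_map_preimage[OF cg V(1)] by simp
    then have "\<forall>y\<in>{t \<in> {0..1}. g t \<in> V}. \<exists>e>0. \<forall>t\<in>{0..1}. dist t y < e \<longrightarrow> t \<in> {t \<in> {0..1}. g t \<in> V}"
      unfolding openin_euclidean_subtopology_iff by (rule conjunct2)
    from bspec[OF this, of x] x V(2)
    obtain d where d: "d > 0" "\<And>t. t \<in> {0..1} \<Longrightarrow> dist t x < d \<Longrightarrow> g t \<in> V"
      by auto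
    have "P a b" if ab: "a \<le> x" "x \<le> b" "b - a < d" for a b
      unfolding P_def
    proof (intro impI)
      assume *: "0 \<le> a" "a \<le> b" "b \<le> 1"
      have lp: "linepath a b t \<in> {a..b}" if "t \<in> {0..1}" for t
        using that linepath_image_01[of a b] \<open>a \<le> b\<close> by (auto simp: closed_segment_eq_real_ivl)
      have in01: "linepath a b t \<in> {0..1}" if "t \<in> {0..1}" for t
        using lp[OF that] * by auto
      have "continuous_map (top_of_set {0..1}) (top_of_set {0..1}) (linepath a b)"
        unfolding continuous_map_in_subtopology using in01
        by (auto simp: continuous_map_iff_continuous image_subset_iff)
      then have "continuous_map (top_of_set {0..1}) X (g \<circ> linepath a b)"
        using cg by (rule continuous_map_compose)
      moreover have "(g \<circ> linepath a b) t \<in> V" if "t \<in> {0..1}" for t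
      proof -
        have "dist (linepath a b t) x < d"
          using lp[OF that] ab by (auto simp: dist_real_def)
        then show ?thesis using d(2) in01[OF that] by simp
      qed
      ultimately have "pathin (subtopology X V) (g \<circ> linepath a b)"
        by (auto simp: pathin_def continuous_map_in_subtopology)
      from V(3)[OF this] show "path_chain (g \<circ> linepath a b) - (h (g a) - h (g b)) \<in> N"
        by (simp add: linepath_def)
    qed
    then show "\<exists>d>0. \<forall>a b. a \<le> x \<and> x \<le> b \<and> b - a < d \<longrightarrow> P a b"
      using d(1) by blast
  qed simp
  moreover have "path_simplex (g \<circ> linepath 0 1) = path_simplex g"
    by (rule path_simplex_cong) (simp add: linepath_def)
  ultimately show ?thesis
    by (simp add: P_def)
qed

text \<open>Let \<open>H\<close> extend \<open>h\<close> linearly to 0-chains. For a single path the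
  hypothesis says that the path plus \<open>H\<close> of its boundary lies in \<open>N\<close>; by
  linearity this holds for every 1-chain, and for a cycle the correction is
  \<open>H 0 = 0\<close>.\<close>

lemma qcycles_1_subset:
  assumes N: "qvec.subspace N"
    and paths: "\<And>g. pathin X g \<Longrightarrow> path_chain g - (h (g 0) - h (g 1)) \<in> N"
  shows "qcycles 1 X \<subseteq> N"
proof
  fix c assume c: "c \<in> qcycles 1 X"
  define H where "H = qextend (\<lambda>\<sigma>. h (\<sigma> (\<lambda>j::nat. if j = 0 then 1 else 0 :: real)))"
  have H: "H (single (point_simplex x) 1) = h x" for x
    by (simp add: H_def point_simplex_def standard_simplex_0)
  have "c + H (qboundary 1 c) \<in> N"
  proof (rule qhom_in_subspace[where f = "\<lambda>c. c + H (qboundary 1 c)", OF _ N])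
    show "qhom (\<lambda>c. c + H (qboundary 1 c))"
      by (auto simp: module_hom_iff qvec.module_axioms H_def qvec.scale_right_distrib)
    fix f assume "f \<in> keys c"
    then have "singular_simplex 1 X f"
      using c by (auto simp: qcycles_def qchains_def)
    note f = singular_simplex_1_path[OF this]
    let ?g = "\<lambda>t. f (bary1 t)"
    have "H (qboundary 1 (path_chain ?g)) = h (?g 1) - h (?g 0)"
      unfolding qboundary_path_chain using H by (simp add: H_def)
    then have "path_chain ?g + H (qboundary 1 (path_chain ?g)) = path_chain ?g - (h (?g 0) - h (?g 1))"
      by (simp only: diff_conv_add_uminus minus_add minus_minus ac_simps)
    then have "path_chain ?g + H (qboundary 1 (path_chain ?g)) \<in> N"
      using paths[OF f(1)] by (simp only:)
    then show "single f 1 + H (qboundary 1 (single f 1)) \<in> N"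
      using f(2) by simp
  qed
  moreover have "H (qboundary 1 c) = 0"
    using c by (simp add: qcycles_def H_def)
  ultimately show "c \<in> N" by simp
qed

text \<open>By linearity, a property of boundaries that defines a subspace is checked on the three
  sides of one triangle. Used both for boundaries being cycles and for cochains that vanish on
  boundaries.\<close>

lemma qboundaries_1_in_subspace:
  assumes N: "qvec.subspace N"
    and triangles: "\<And>G. continuous_map (top_of_set std_triangle) X G \<Longrightarrow>
      path_chain (G \<circ> linepath (1,0) (0,1)) - path_chain (G \<circ> linepath (0,0) (0,1))
        + path_chain (G \<circ> linepath (0,0) (1,0)) \<in> N"
  shows "qboundaries 1 X \<subseteq> N"
proof
  fix b assume "b \<in> qboundaries 1 X"
  then obtain c where c: "c \<in> qchains 2 X" "b = qboundary 2 c"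
    by (auto simp: qboundaries_def numeral_2_eq_2)
  have "qboundary 2 c \<in> N"
  proof (rule qhom_in_subspace[OF qhom_qboundary N])
    fix f assume "f \<in> keys c"
    then have "singular_simplex 2 X f"
      using c by (auto simp: qchains_def)
    from triangles[OF singular_simplex_2_triangle[OF this]]
    show "qboundary 2 (single f 1) \<in> N"
      by (subst qboundary_2_single[where G = "f \<circ> bary2"]) simp_all
  qed
  with c show "b \<in> N" by simp
qed

lemma qboundaries_subset_qcycles: "qboundaries 1 X \<subseteq> qcycles 1 X"
proof -
  have "qvec.subspace {c. qboundary 1 c = 0}"
    by (rule qvec.subspaceI) auto
  then have "qboundaries 1 X \<subseteq> {c. qboundary 1 c = 0}"
  proof (rule qboundaries_1_in_subspace)
    fix G :: "real \<times> real \<Rightarrow> 'a"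
    show "path_chain (G \<circ> linepath (1,0) (0,1)) - path_chain (G \<circ> linepath (0,0) (0,1))
        + path_chain (G \<circ> linepath (0,0) (1,0)) \<in> {c. qboundary 1 c = 0}"
      using qboundary_path_chain[of "G \<circ> linepath (1,0) (0,1)"] qboundary_path_chain[of "G \<circ> linepath (0,0) (0,1)"]
        qboundary_path_chain[of "G \<circ> linepath (0,0) (1,0)"]
      by (simp add: linepath_def)
  qed
  moreover have "qboundaries 1 X \<subseteq> qchains 1 X"
    using subspace_qchains
  proof (rule qboundaries_1_in_subspace)
    fix G :: "real \<times> real \<Rightarrow> 'a" assume G: "continuous_map (top_of_set std_triangle) X G"
    have "path_chain (G \<circ> linepath a b) \<in> qchains 1 X"
      if "a \<in> std_triangle" "b \<in> std_triangle" for a b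
    proof (rule path_chain_in_qchains)
      have "linepath a b ` {0..1} \<subseteq> std_triangle"
        unfolding linepath_image_01 using that convex_std_triangle by (rule closed_segment_subset)
      then have "continuous_map (top_of_set {0..1}) (top_of_set std_triangle) (linepath a b)"
        unfolding continuous_map_in_subtopology by (auto simp: continuous_map_iff_continuous)
      from continuous_map_compose[OF this G] show "pathin X (G \<circ> linepath a b)"
        by (simp add: pathin_def)
    qed
    then show "path_chain (G \<circ> linepath (1,0) (0,1)) - path_chain (G \<circ> linepath (0,0) (0,1))
        + path_chain (G \<circ> linepath (0,0) (1,0)) \<in> qchains 1 X"
      by (intro qvec.subspace_add qvec.subspace_diff subspace_qchains) (auto simp: std_triangle_def)
  qed
  ultimately show ?thesis by (auto simp: qcycles_def)
qed

section \<open>Variation of the logarithm\<close>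

text \<open>On a loop this is 2 pi i times the winding number around 0. Being defined on open paths
  too, it can be evaluated simplex by simplex.\<close>

definition log_var :: "(real \<Rightarrow> complex) \<Rightarrow> complex" where
  "log_var c = (SOME d. \<exists>l. continuous_on {0..1} l \<and> (\<forall>t\<in>{0..1}. c t = exp (l t)) \<and> d = l 1 - l 0)"

text \<open>The difference of two continuous logarithms takes values where \<open>exp\<close> is 1.
  Distinct such values are at least 2 pi apart, so the difference is constant on the
  interval.\<close>

lemma continuous_log_unique:
  fixes l l' :: "real \<Rightarrow> complex"
  assumes "continuous_on {a..b} l" "continuous_on {a..b} l'" "a \<le> b"
    and eq: "\<And>t. t \<in> {a..b} \<Longrightarrow> exp (l t) = exp (l' t)"
  shows "l b - l a = l' b - l' a"
proof -
  define d where "d t = l t - l' t" for t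
  have "d constant_on {a..b}"
  proof (rule continuous_discrete_range_constant)
    show "continuous_on {a..b} d"
      unfolding d_def using assms by (intro continuous_intros)
    have exp_d: "exp (d t) = 1" if "t \<in> {a..b}" for t
      using eq[OF that] by (simp add: d_def exp_diff)
    fix x assume x: "x \<in> {a..b}"
    have "2 * pi \<le> norm (d y - d x)" if "y \<in> {a..b}" "d y \<noteq> d x" for y
    proof -
      have "2 * pi \<le> \<bar>Im (d y) - Im (d x)\<bar>"
        using exp_complex_eqI[of "d y" "d x"] exp_d that x by force
      also have "\<dots> \<le> norm (d y - d x)"
        using abs_Im_le_cmod[of "d y - d x"] by simp
      finally show ?thesis .
    qed
    then show "\<exists>e>0. \<forall>y. y \<in> {a..b} \<and> d y \<noteq> d x \<longrightarrow> e \<le> norm (d y - d x)"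
      by (intro exI[of _ "2 * pi"]) auto
  qed simp
  then have "d a = d b"
    using \<open>a \<le> b\<close> by (auto simp: constant_on_def)
  then show ?thesis by (simp add: d_def algebra_simps)
qed

lemma log_var_eqI:
  assumes "continuous_on {0..1} l" "\<And>t. t \<in> {0..1} \<Longrightarrow> c t = exp (l t)"
  shows "log_var c = l 1 - l 0"
  unfolding log_var_def
proof (rule someI2)
  show "\<exists>l'. continuous_on {0..1} l' \<and> (\<forall>t\<in>{0..1}. c t = exp (l' t)) \<and> l 1 - l 0 = l' 1 - l' 0"
    using assms by blast
next
  fix d assume "\<exists>l'. continuous_on {0..1} l' \<and> (\<forall>t\<in>{0..1}. c t = exp (l' t)) \<and> d = l' 1 - l' 0"
  then obtain l' where l': "continuous_on {0..1} l'" "\<And>t. t \<in> {0..1} \<Longrightarrow> c t = exp (l' t)"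
    "d = l' 1 - l' 0" by blast
  then show "d = l 1 - l 0"
    using continuous_log_unique[OF l'(1) assms(1)] assms(2) by simp
qed

lemma log_var_cong: "(\<And>t. t \<in> {0..1} \<Longrightarrow> c t = c' t) \<Longrightarrow> log_var c = log_var c'"
  unfolding log_var_def by simp

text \<open>The singular cochain that stands in for the integral of dz/z along the image under
  \<open>F\<close>.\<close>

definition log_cochain :: "('a \<Rightarrow> complex) \<Rightarrow> (((nat \<Rightarrow> real) \<Rightarrow> 'a) \<Rightarrow>\<^sub>0 rat) \<Rightarrow> complex" where
  "log_cochain F c = (\<Sum>f\<in>keys c.
     of_rat (lookup c f) * log_var (\<lambda>t. F (f (bary1 t))))"

lemma log_cochain_superset:
  assumes "finite S" "keys c \<subseteq> S"
  shows "log_cochain F c = (\<Sum>f\<in>S. of_rat (lookup c f) * log_var (\<lambda>t. F (f (bary1 t))))"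
  unfolding log_cochain_def using assms
  by (intro sum.mono_neutral_left) (auto simp: in_keys_iff)

lemma log_cochain_hom: "module_hom qscale (\<lambda>q z. of_rat q * z) (log_cochain F)"
proof -
  have 1: "log_cochain F (c + d) = log_cochain F c + log_cochain F d"
    for c d :: "((nat \<Rightarrow> real) \<Rightarrow> 'a) \<Rightarrow>\<^sub>0 rat"
    using keys_add[of c d]
    by (simp add: log_cochain_superset[of "keys c \<union> keys d"]
        lookup_add of_rat_add ring_distribs sum.distrib)
  have "keys (qscale q c) \<subseteq> keys c" for q and c :: "((nat \<Rightarrow> real) \<Rightarrow> 'a) \<Rightarrow>\<^sub>0 rat"
    by (auto simp: in_keys_iff)
  then have 2: "log_cochain F (qscale q c) = of_rat q * log_cochain F c" for q c
    by (simp add: log_cochain_superset[of "keys c"] of_rat_mult sum_distrib_left mult.assoc)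
  have "Modules.module (\<lambda>q z. of_rat q * (z :: complex))"
    by unfold_locales (auto simp: of_rat_add of_rat_mult algebra_simps)
  with 1 2 show ?thesis
    by (simp add: module_hom_iff qvec.module_axioms)
qed

lemmas log_cochain_simps [simp] =
  log_cochain_hom[THEN module_hom.add] log_cochain_hom[THEN module_hom.diff]
  log_cochain_hom[THEN module_hom.zero] log_cochain_hom[THEN module_hom.scale]

lemma log_cochain_path_chain: "log_cochain F (path_chain g) = log_var (\<lambda>t. F (g t))"
  by (auto simp: log_cochain_superset[of "{path_simplex g}"] path_simplex_bary1 intro: log_var_cong)

text \<open>On a contractible triangle the map to the punctured plane has a continuous logarithm.
  The variation along each side is then a difference of its values at two corners, and the three
  differences telescope.\<close>

lemma log_cochain_qboundaries:
  assumes F: "continuous_map X (top_of_set (- {0})) F" and b: "b \<in> qboundaries 1 X"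
  shows "log_cochain F b = 0"
proof -
  have "qvec.subspace {c. log_cochain F c = 0}"
    by (rule qvec.subspaceI) auto
  then have "qboundaries 1 X \<subseteq> {c. log_cochain F c = 0}"
  proof (rule qboundaries_1_in_subspace)
    fix G :: "real \<times> real \<Rightarrow> 'a" assume "continuous_map (top_of_set std_triangle) X G"
    from continuous_map_compose[OF this F]
    have "continuous_on std_triangle (F \<circ> G)" "\<And>z. z \<in> std_triangle \<Longrightarrow> (F \<circ> G) z \<noteq> 0"
      unfolding continuous_map_in_subtopology by (auto simp: continuous_map_iff_continuous)
    then obtain l where l: "continuous_on std_triangle l" "\<And>z. z \<in> std_triangle \<Longrightarrow> (F \<circ> G) z = exp (l z)"
      using continuous_logarithm_on_contractible[OF _ convex_imp_contractible[OF convex_std_triangle]]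
      by metis
    have "log_cochain F (path_chain (G \<circ> linepath a b)) = l b - l a"
      if ab: "a \<in> std_triangle" "b \<in> std_triangle" for a b
    proof -
      have lp: "linepath a b ` {0..1} \<subseteq> std_triangle"
        unfolding linepath_image_01 using ab convex_std_triangle by (rule closed_segment_subset)
      have "log_var (\<lambda>t. F ((G \<circ> linepath a b) t)) = (l \<circ> linepath a b) 1 - (l \<circ> linepath a b) 0"
      proof (rule log_var_eqI)
        show "continuous_on {0..1} (l \<circ> linepath a b)"
          using l(1) lp by (intro continuous_on_compose) (auto intro: continuous_on_subset)
        show "F ((G \<circ> linepath a b) t) = exp ((l \<circ> linepath a b) t)" if "t \<in> {0..1}" for t
        proof -
          have "linepath a b t \<in> std_triangle" using lp that by blast
          from l(2)[OF this] show ?thesis by simp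
        qed
      qed
      then show ?thesis by (simp add: log_cochain_path_chain linepath_def)
    qed
    then show "path_chain (G \<circ> linepath (1,0) (0,1)) - path_chain (G \<circ> linepath (0,0) (0,1))
        + path_chain (G \<circ> linepath (0,0) (1,0)) \<in> {c. log_cochain F c = 0}"
      by (simp add: std_triangle_def)
  qed
  with b show ?thesis by auto
qed

section \<open>Two points on a star\<close>

definition leg :: "nat \<Rightarrow> real \<Rightarrow> nat \<Rightarrow> real" where
  "leg i t = (\<lambda>j. if j = i then t else 0)"

definition two_points :: "(nat \<Rightarrow> real) \<Rightarrow> (nat \<Rightarrow> real) \<Rightarrow> nat \<Rightarrow> nat \<Rightarrow> real" where
  "two_points x y = restrict (\<lambda>k. if k = 0 then x else y) {..<2}"

abbreviation conf_point :: "nat \<Rightarrow> real \<Rightarrow> nat \<Rightarrow> real \<Rightarrow> nat \<Rightarrow> nat \<Rightarrow> real" where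
  "conf_point i r j s \<equiv> two_points (leg i r) (leg j s)"

abbreviation star_conf :: "nat \<Rightarrow> (nat \<Rightarrow> nat \<Rightarrow> real) topology" where
  "star_conf n \<equiv> Conf 2 (star_graph n)"

text \<open>On a star, \<open>height\<close> is the distance from the internal vertex.\<close>

definition height :: "nat \<Rightarrow> (nat \<Rightarrow> real) \<Rightarrow> real" where
  "height n x = (\<Sum>j\<in>{1..n}. x j)"

lemma height_leg [simp]: "i \<in> {1..n} \<Longrightarrow> height n (leg i t) = t"
  by (simp add: height_def leg_def)

lemma leg_0 [simp]: "leg i 0 = (\<lambda>_. 0)"
  by (auto simp: leg_def)

lemma leg_apply: "leg i t j = (if j = i then t else 0)"
  by (simp add: leg_def)

lemma two_points_simps [simp]:
  "two_points x y 0 = x" "two_points x y 1 = y" "two_points x y (Suc 0) = y"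
  by (auto simp: two_points_def)

lemma two_points_eq_iff [simp]: "two_points x y = two_points x' y' \<longleftrightarrow> x = x' \<and> y = y'"
  by (metis two_points_simps(1,2))

lemma star_graph_eq:
  "star_graph n = subtopology (powertop_real UNIV) (\<Union>i\<in>{1..n}. leg i ` {0..1})"
proof -
  have "{(\<lambda>j. if j = i then t else 0) | t. 0 \<le> t \<and> t \<le> 1} = leg i ` {0..1}" for i
    by (auto simp: leg_def)
  then show ?thesis by (simp add: star_graph_def)
qed

lemma topspace_star_graph: "topspace (star_graph n) = (\<Union>i\<in>{1..n}. leg i ` {0..1})"
  by (simp add: star_graph_eq)

lemma extensional_two_points: "z \<in> extensional {..<2} \<Longrightarrow> z = two_points (z 0) (z 1)"
  by (auto simp: two_points_def extensional_def fun_eq_iff less_2_cases_iff)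

lemma topspace_star_conf:
  "topspace (star_conf n)
    = {two_points x y | x y. x \<in> topspace (star_graph n) \<and> y \<in> topspace (star_graph n) \<and> x \<noteq> y}"
proof -
  have "inj_on z {..<2} \<longleftrightarrow> z 0 \<noteq> z 1" for z :: "nat \<Rightarrow> nat \<Rightarrow> real"
  proof -
    have "{..<2::nat} = {0, 1}" by auto
    then show ?thesis by (simp add: inj_on_def) metis
  qed
  then have top: "topspace (star_conf n) = {z \<in> {..<2} \<rightarrow>\<^sub>E topspace (star_graph n). z 0 \<noteq> z 1}"
    unfolding Conf_def by auto
  show ?thesis
  proof (intro equalityI subsetI)
    fix z assume z: "z \<in> topspace (star_conf n)"
    then have "z = two_points (z 0) (z 1)"
      unfolding top by (intro extensional_two_points) (simp add: PiE_def)
    with z show "z \<in> {two_points x y | x y. x \<in> topspace (star_graph n) \<and> y \<in> topspace (star_graph n) \<and> x \<noteq> y}"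
      unfolding top by (intro CollectI exI[of _ "z 0"] exI[of _ "z 1"]) (simp add: PiE_iff)
  qed (auto simp: top PiE_iff two_points_def)
qed

lemma star_confE:
  assumes "z \<in> topspace (star_conf n)"
  obtains i r j s where "i \<in> {1..n}" "j \<in> {1..n}" "r \<in> {0..1}" "s \<in> {0..1}"
    "leg i r \<noteq> leg j s" "z = conf_point i r j s"
  using assms unfolding topspace_star_conf topspace_star_graph by blast

text \<open>Different heights separate the two points whatever their legs, even on one and the same
  leg. At equal heights distinct legs separate them, except at height 0, which all legs
  share.\<close>

lemma conf_point_in:
  assumes "i \<in> {1..n}" "j \<in> {1..n}" "r \<in> {0..1}" "s \<in> {0..1}" "r \<noteq> s \<or> i \<noteq> j \<and> 0 < r"
  shows "conf_point i r j s \<in> topspace (star_conf n)"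
proof -
  have "leg i r \<noteq> leg j s"
    using assms height_leg[of i n r] height_leg[of j n s] by (metis leg_apply order_less_irrefl)
  with assms show ?thesis
    unfolding topspace_star_conf topspace_star_graph by blast
qed

lemma two_points_extensional [simp]: "two_points x y \<in> extensional {..<2}"
  by (simp add: two_points_def)

lemma star_conf_extensional: "z \<in> topspace (star_conf n) \<Longrightarrow> z \<in> extensional {..<2}"
  by (auto simp: topspace_star_conf)

lemma continuous_map_star_conf:
  "continuous_map T (star_conf n) f \<longleftrightarrow>
    f \<in> topspace T \<rightarrow> topspace (star_conf n) \<and> (\<forall>k<2. \<forall>j. continuous_map T euclideanreal (\<lambda>a. f a k j))"
    (is "?l \<longleftrightarrow> ?r")
proof
  assume l: ?l
  have "continuous_map T euclideanreal (\<lambda>a. f a k j)" if "k < 2" for k j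
  proof -
    have "continuous_map T (product_topology (\<lambda>_. star_graph n) {..<2}) f"
      using l unfolding Conf_def by (simp add: continuous_map_in_subtopology)
    then have "continuous_map T (star_graph n) (\<lambda>a. f a k)"
      using that by (simp add: continuous_map_componentwise)
    then have "continuous_map T (powertop_real UNIV) (\<lambda>a. f a k)"
      unfolding star_graph_eq by (simp add: continuous_map_in_subtopology)
    then show ?thesis by (simp add: continuous_map_componentwise_UNIV)
  qed
  with l show ?r by (auto simp: continuous_map_def)
next
  assume r: ?r
  then have "f \<in> topspace T \<rightarrow> topspace (star_conf n)" by blast
  then have f: "f a \<in> extensional {..<2}" "inj_on (f a) {..<2}" "\<And>k. k < 2 \<Longrightarrow> f a k \<in> topspace (star_graph n)"
    if "a \<in> topspace T" for a
    using that unfolding Conf_def by (auto simp: PiE_iff)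
  have "continuous_map T (star_graph n) (\<lambda>a. f a k)" if "k < 2" for k
    unfolding star_graph_eq continuous_map_in_subtopology continuous_map_componentwise_UNIV
    using r that f(3) by (auto simp: topspace_star_graph)
  then show ?l
    unfolding Conf_def continuous_map_in_subtopology continuous_map_componentwise
    using f by auto
qed

lemma continuous_map_star_conf_coord:
  "k < 2 \<Longrightarrow> continuous_map (star_conf n) euclideanreal (\<lambda>z. z k j)"
  using continuous_map_star_conf[of "star_conf n" n "\<lambda>z. z"] by simp

lemma continuous_map_star_conf_height:
  "k < 2 \<Longrightarrow> continuous_map (star_conf n) euclideanreal (\<lambda>z. height n (z k))"
  unfolding height_def by (intro continuous_map_sum continuous_map_star_conf_coord) auto

text \<open>Linear interpolation in the ambient coordinates. It remains on the star only as long as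
  each point moves along a single leg, and the two points must not meet on the way; both are checked
  for each centre separately.\<close>

definition straight :: "(nat \<Rightarrow> nat \<Rightarrow> real) \<Rightarrow> (nat \<Rightarrow> nat \<Rightarrow> real) \<Rightarrow> real \<Rightarrow> nat \<Rightarrow> nat \<Rightarrow> real" where
  "straight c z u = restrict (\<lambda>k j. (1 - u) * z k j + u * c k j) {..<2}"

lemma straight_same_legs:
  "straight (conf_point i r' j s') (conf_point i r j s) u
    = conf_point i ((1 - u) * r + u * r') j ((1 - u) * s + u * s')"
  by (auto simp: straight_def two_points_def leg_def fun_eq_iff restrict_def)

lemma straight_two_points_0:
  "straight (two_points (leg i r') (\<lambda>_. 0)) (conf_point i r j s) u
    = conf_point i ((1 - u) * r + u * r') j ((1 - u) * s)"
  "straight (two_points (\<lambda>_. 0) (leg j s')) (conf_point i r j s) u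
    = conf_point i ((1 - u) * r) j ((1 - u) * s + u * s')"
  using straight_same_legs[of i r' j 0 r s u] straight_same_legs[of i 0 j s' r s u] by auto

abbreviation straight_chain where
  "straight_chain c z \<equiv> path_chain (straight c z)"

lemma straight_0: "z \<in> extensional {..<2} \<Longrightarrow> straight c z 0 = z"
  by (auto simp: straight_def extensional_def fun_eq_iff)

lemma straight_1: "c \<in> extensional {..<2} \<Longrightarrow> straight c z 1 = c"
  by (auto simp: straight_def extensional_def fun_eq_iff)

lemma continuous_map_straight:
  assumes "\<And>z u. z \<in> S \<Longrightarrow> u \<in> {0..1} \<Longrightarrow> straight c z u \<in> topspace (star_conf n)"
  shows "continuous_map (prod_topology (top_of_set {0..1}) (subtopology (star_conf n) S)) (star_conf n)
    (\<lambda>p. straight c (snd p) (fst p))"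
  unfolding continuous_map_star_conf
proof (intro conjI allI impI)
  fix k :: nat and j assume k: "k < 2"
  have 1: "continuous_map (prod_topology (top_of_set {0..1}) (subtopology (star_conf n) S)) euclideanreal fst"
    by (metis continuous_map_fst continuous_map_into_fulltopology)
  have 2: "continuous_map (prod_topology (top_of_set {0..1}) (subtopology (star_conf n) S)) euclideanreal
      (\<lambda>p. snd p k j)"
    using continuous_map_compose[OF continuous_map_snd
        continuous_map_from_subtopology[OF continuous_map_star_conf_coord[OF k]]]
    by (simp add: comp_def)
  have "continuous_map (prod_topology (top_of_set {0..1}) (subtopology (star_conf n) S)) euclideanreal
      (\<lambda>p. (1 - fst p) * snd p k j + fst p * c k j)"
    by (intro continuous_map_add continuous_map_real_mult continuous_map_diff 1 2) auto
  then show "continuous_map (prod_topology (top_of_set {0..1}) (subtopology (star_conf n) S)) euclideanreal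
      (\<lambda>p. straight c (snd p) (fst p) k j)"
    using k by (simp add: straight_def)
qed (use assms in auto)

lemma pathin_straight:
  assumes "\<And>u. u \<in> {0..1} \<Longrightarrow> straight c z u \<in> topspace (star_conf n)"
  shows "pathin (star_conf n) (straight c z)"
  unfolding pathin_def continuous_map_star_conf
  using assms
  by (auto simp: straight_def continuous_map_iff_continuous intro!: continuous_intros)

text \<open>The segments to \<open>c\<close> contract \<open>S\<close> inside the configuration
  space; they may leave \<open>S\<close>, so only the end result has to be a configuration.\<close>

lemma star_shaped_in_qboundaries:
  assumes S: "S \<subseteq> topspace (star_conf n)" and c: "c \<in> extensional {..<2}"
    and st: "\<And>z u. z \<in> S \<Longrightarrow> u \<in> {0..1} \<Longrightarrow> straight c z u \<in> topspace (star_conf n)"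
    and g: "pathin (subtopology (star_conf n) S) g"
  shows "path_chain g - (straight_chain c (g 0) - straight_chain c (g 1)) \<in> qboundaries 1 (star_conf n)"
proof -
  have "straight c z 0 = z" if "z \<in> S" for z
    using S that star_conf_extensional straight_0 by blast
  then show ?thesis
    using contraction_in_qboundaries[OF continuous_map_straight[OF st] _ _ g, where c = c]
      straight_1[OF c] by auto
qed

text \<open>The sets \<open>first_outer n i\<close>, \<open>second_outer n j\<close> and \<open>apart n i j\<close> with \<open>i \<noteq> j\<close> form an open cover by
  star-shaped sets.  The larger star-shaped set \<open>on_legs n i j\<close> contains the star centres of the first two
  kinds of sets, which allows the paths to the different centres to be compared.\<close>

definition first_outer :: "nat \<Rightarrow> nat \<Rightarrow> (nat \<Rightarrow> nat \<Rightarrow> real) set" where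
  "first_outer n i = {z \<in> topspace (star_conf n). height n (z 1) < z 0 i}"

definition second_outer :: "nat \<Rightarrow> nat \<Rightarrow> (nat \<Rightarrow> nat \<Rightarrow> real) set" where
  "second_outer n j = {z \<in> topspace (star_conf n). height n (z 0) < z 1 j}"

definition apart :: "nat \<Rightarrow> nat \<Rightarrow> nat \<Rightarrow> (nat \<Rightarrow> nat \<Rightarrow> real) set" where
  "apart n i j = {z \<in> topspace (star_conf n). 0 < z 0 i \<and> 0 < z 1 j}"

definition on_legs :: "nat \<Rightarrow> nat \<Rightarrow> nat \<Rightarrow> (nat \<Rightarrow> nat \<Rightarrow> real) set" where
  "on_legs n i j = {conf_point i r j s | r s. r \<in> {0..1} \<and> s \<in> {0..1} \<and> 0 < r + s}"

lemma openin_less: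
  assumes "continuous_map X euclideanreal f" "continuous_map X euclideanreal g"
  shows "openin X {x \<in> topspace X. f x < g x}"
proof -
  have "continuous_map X euclideanreal (\<lambda>x. g x - f x)"
    using assms by (intro continuous_map_diff)
  from openin_continuous_map_preimage[OF this, of "{0<..}"] show ?thesis by simp
qed

lemma openin_cover:
  "openin (star_conf n) (first_outer n i)" "openin (star_conf n) (second_outer n j)"
  "openin (star_conf n) (apart n i j)"
proof -
  show "openin (star_conf n) (first_outer n i)" "openin (star_conf n) (second_outer n j)"
    unfolding first_outer_def second_outer_def
    by (intro openin_less continuous_map_star_conf_coord continuous_map_star_conf_height; simp)+
  have "apart n i j = {z \<in> topspace (star_conf n). 0 < z 0 i} \<inter> {z \<in> topspace (star_conf n). 0 < z 1 j}"
    by (auto simp: apart_def)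
  also have "openin (star_conf n) \<dots>"
    by (intro openin_Int openin_less continuous_map_star_conf_coord) auto
  finally show "openin (star_conf n) (apart n i j)" .
qed

lemma first_outerE:
  assumes "z \<in> first_outer n i"
  obtains r j s where "i \<in> {1..n}" "j \<in> {1..n}" "0 \<le> s" "s < r" "r \<le> 1" "z = conf_point i r j s"
proof -
  from assms have "z \<in> topspace (star_conf n)" by (simp add: first_outer_def)
  then obtain i' r j s where *: "i' \<in> {1..n}" "j \<in> {1..n}" "r \<in> {0..1}" "s \<in> {0..1}"
      "z = conf_point i' r j s" by (rule star_confE)
  with assms have "i = i'" "s < r"
    by (auto simp: first_outer_def leg_apply split: if_splits)
  with * that show ?thesis by auto
qed

lemma second_outerE:
  assumes "z \<in> second_outer n j"
  obtains i r s where "i \<in> {1..n}" "j \<in> {1..n}" "0 \<le> r" "r < s" "s \<le> 1" "z = conf_point i r j s"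
proof -
  from assms have "z \<in> topspace (star_conf n)" by (simp add: second_outer_def)
  then obtain i r j' s where *: "i \<in> {1..n}" "j' \<in> {1..n}" "r \<in> {0..1}" "s \<in> {0..1}"
      "z = conf_point i r j' s" by (rule star_confE)
  with assms have "j = j'" "r < s"
    by (auto simp: second_outer_def leg_apply split: if_splits)
  with * that show ?thesis by auto
qed

lemma apartE:
  assumes "z \<in> apart n i j"
  obtains r s where "i \<in> {1..n}" "j \<in> {1..n}" "0 < r" "r \<le> 1" "0 < s" "s \<le> 1" "z = conf_point i r j s"
proof -
  from assms have "z \<in> topspace (star_conf n)" by (simp add: apart_def)
  then obtain i' r j' s where *: "i' \<in> {1..n}" "j' \<in> {1..n}" "r \<in> {0..1}" "s \<in> {0..1}"
      "z = conf_point i' r j' s" by (rule star_confE)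
  with assms have "i = i'" "j = j'" "0 < r" "0 < s"
    by (auto simp: apart_def leg_apply split: if_splits)
  with * that show ?thesis by auto
qed

lemma on_legs_subset:
  assumes "i \<in> {1..n}" "j \<in> {1..n}" "i \<noteq> j"
  shows "on_legs n i j \<subseteq> topspace (star_conf n)"
  using assms by (auto simp: on_legs_def intro!: conf_point_in)

abbreviation first_vertex :: "nat \<Rightarrow> nat \<Rightarrow> nat \<Rightarrow> real" where
  "first_vertex i \<equiv> two_points (leg i 1) (\<lambda>_. 0)"

abbreviation second_vertex :: "nat \<Rightarrow> nat \<Rightarrow> nat \<Rightarrow> real" where
  "second_vertex j \<equiv> two_points (\<lambda>_. 0) (leg j 1)"

text \<open>The first point moves out to the end of leg \<open>i\<close> while the second retreats
  to the vertex. The first stays strictly farther out, so they cannot meet even if the second one is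
  on leg \<open>i\<close> as well.\<close>

lemma first_outer_path:
  assumes g: "pathin (subtopology (star_conf n) (first_outer n i)) g"
  shows "path_chain g - (straight_chain (first_vertex i) (g 0) - straight_chain (first_vertex i) (g 1))
    \<in> qboundaries 1 (star_conf n)"
proof (rule star_shaped_in_qboundaries[OF _ _ _ g])
  fix z and u :: real assume "z \<in> first_outer n i" and u: "u \<in> {0..1}"
  then obtain r j s where *: "i \<in> {1..n}" "j \<in> {1..n}" "0 \<le> s" "s < r" "r \<le> 1" "z = conf_point i r j s"
    by (auto elim: first_outerE)
  have "(1 - u) * s \<le> (1 - u) * r"
    using * u by (simp add: mult_left_mono)
  moreover have "u = 1 \<or> (1 - u) * s < (1 - u) * r"
    using * u by (cases "u = 1") (auto intro!: mult_strict_left_mono)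
  moreover have "(1 - u) * r \<le> 1 - u" "(1 - u) * s \<le> 1 - u" "0 \<le> (1 - u) * s"
    using * u by (auto simp: mult_left_le)
  ultimately show "straight (first_vertex i) z u \<in> topspace (star_conf n)"
    using * u unfolding \<open>z = _\<close> straight_two_points_0 by (intro conf_point_in) auto
qed (auto simp: first_outer_def)

lemma second_outer_path:
  assumes g: "pathin (subtopology (star_conf n) (second_outer n j)) g"
  shows "path_chain g - (straight_chain (second_vertex j) (g 0) - straight_chain (second_vertex j) (g 1))
    \<in> qboundaries 1 (star_conf n)"
proof (rule star_shaped_in_qboundaries[OF _ _ _ g])
  fix z and u :: real assume "z \<in> second_outer n j" and u: "u \<in> {0..1}"
  then obtain i r s where *: "i \<in> {1..n}" "j \<in> {1..n}" "0 \<le> r" "r < s" "s \<le> 1" "z = conf_point i r j s"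
    by (auto elim: second_outerE)
  have "(1 - u) * r \<le> (1 - u) * s"
    using * u by (simp add: mult_left_mono)
  moreover have "u = 1 \<or> (1 - u) * r < (1 - u) * s"
    using * u by (cases "u = 1") (auto intro!: mult_strict_left_mono)
  moreover have "(1 - u) * r \<le> 1 - u" "(1 - u) * s \<le> 1 - u" "0 \<le> (1 - u) * r"
    using * u by (auto simp: mult_left_le)
  ultimately show "straight (second_vertex j) z u \<in> topspace (star_conf n)"
    using * u unfolding \<open>z = _\<close> straight_two_points_0 by (intro conf_point_in) auto
qed (auto simp: second_outer_def)

text \<open>Both points move outward on different legs and could only meet at the vertex. At the
  start this is excluded by \<open>0 < r + s\<close>, and afterwards both are off the
  vertex.\<close>

lemma on_legs_path:
  assumes ij: "i \<in> {1..n}" "j \<in> {1..n}" "i \<noteq> j"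
    and g: "pathin (star_conf n) g" "\<And>t. t \<in> {0..1} \<Longrightarrow> g t \<in> on_legs n i j"
  shows "path_chain g - (straight_chain (conf_point i 1 j 1) (g 0)
      - straight_chain (conf_point i 1 j 1) (g 1)) \<in> qboundaries 1 (star_conf n)"
proof (rule star_shaped_in_qboundaries[OF on_legs_subset[OF ij]])
  show "pathin (subtopology (star_conf n) (on_legs n i j)) g"
    using g by (auto simp: pathin_def continuous_map_in_subtopology)
  fix z and u :: real assume "z \<in> on_legs n i j" and u: "u \<in> {0..1}"
  then obtain r s where *: "r \<in> {0..1}" "s \<in> {0..1}" "0 < r + s" "z = conf_point i r j s"
    by (auto simp: on_legs_def)
  have "(1 - u) * r \<le> 1 - u" "(1 - u) * s \<le> 1 - u" "0 \<le> (1 - u) * r" "0 \<le> (1 - u) * s"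
    using * u by (auto simp: mult_left_le)
  moreover have "u = 0 \<or> 0 < u" using u by auto
  ultimately show "straight (conf_point i 1 j 1) z u \<in> topspace (star_conf n)"
    using * u ij unfolding \<open>z = _\<close> straight_same_legs by (intro conf_point_in) auto
qed simp

section \<open>The edge paths between vertex configurations\<close>

lemma pathin_conf_point:
  assumes "i \<in> {1..n}" "j \<in> {1..n}" "i \<noteq> j" "continuous_on {0..1} r" "continuous_on {0..1} s"
    and "\<And>t. t \<in> {0..1} \<Longrightarrow> r t \<in> {0..1} \<and> s t \<in> {0..1} \<and> 0 < r t + s t"
  shows "pathin (star_conf n) (\<lambda>t. conf_point i (r t) j (s t))"
  unfolding pathin_def continuous_map_star_conf
proof (intro conjI allI impI funcsetI)
  fix t assume "t \<in> topspace (top_of_set {0..1::real})"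
  then show "conf_point i (r t) j (s t) \<in> topspace (star_conf n)"
    using assms(1,2,3) assms(6)[of t] by (intro conf_point_in) auto
next
  fix k l :: nat assume "k < 2"
  then show "continuous_map (top_of_set {0..1}) euclideanreal (\<lambda>t. conf_point i (r t) j (s t) k l)"
    using assms(4,5) by (cases "k = 0") (auto simp: two_points_def leg_def continuous_map_iff_continuous)
qed

text \<open>Along \<open>edge_path i j\<close> the second point first moves out to the end of leg \<open>j\<close>, then the first one
  retreats from the end of leg \<open>i\<close> to the internal vertex.\<close>

definition edge_path :: "nat \<Rightarrow> nat \<Rightarrow> real \<Rightarrow> nat \<Rightarrow> nat \<Rightarrow> real" where
  "edge_path i j t = conf_point i (min 1 (2 - 2 * t)) j (min 1 (2 * t))"

definition edge_simplex :: "nat \<times> nat \<Rightarrow> (nat \<Rightarrow> real) \<Rightarrow> nat \<Rightarrow> nat \<Rightarrow> real" where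
  "edge_simplex e = path_simplex (edge_path (fst e) (snd e))"

definition off_diagonal :: "nat \<Rightarrow> (nat \<times> nat) set" where
  "off_diagonal n = {(i, j). i \<in> {1..n} \<and> j \<in> {1..n} \<and> i \<noteq> j}"

lemma edge_path_ends: "edge_path i j 0 = first_vertex i" "edge_path i j 1 = second_vertex j"
  by (simp_all add: edge_path_def)

lemma edge_path_on_legs: "t \<in> {0..1} \<Longrightarrow> edge_path i j t \<in> on_legs n i j"
  by (force simp: edge_path_def on_legs_def)

lemma pathin_edge_path:
  assumes "(i, j) \<in> off_diagonal n"
  shows "pathin (star_conf n) (edge_path i j)"
  unfolding edge_path_def[abs_def] using assms
  by (intro pathin_conf_point continuous_intros) (auto simp: off_diagonal_def)

text \<open>Both ends of the path are among the configurations in \<open>on_legs n i j\<close>, so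
  it is homologous to the detour through the centre of that set. This is the link between edges and
  changes of base point.\<close>

lemma edge_path_homologous:
  assumes "(i, j) \<in> off_diagonal n"
  shows "path_chain (edge_path i j) - (straight_chain (conf_point i 1 j 1) (first_vertex i)
      - straight_chain (conf_point i 1 j 1) (second_vertex j)) \<in> qboundaries 1 (star_conf n)"
  using on_legs_path[OF _ _ _ pathin_edge_path[OF assms] edge_path_on_legs] assms
  by (simp add: edge_path_ends off_diagonal_def)

section \<open>Surjectivity: all cycles are combinations of edges modulo boundaries\<close>

definition chain_span :: "'a topology \<Rightarrow> ('e \<Rightarrow> (nat \<Rightarrow> real) \<Rightarrow> 'a) \<Rightarrow> 'e set
    \<Rightarrow> (((nat \<Rightarrow> real) \<Rightarrow> 'a) \<Rightarrow>\<^sub>0 rat) set" where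
  "chain_span X s E = {b + qpush s M | b M. b \<in> qboundaries 1 X \<and> keys M \<subseteq> E}"

lemma subspace_chain_span: "qvec.subspace (chain_span X s E)"
proof -
  have "chain_span X s E = {b + c | b c. b \<in> qboundaries 1 X \<and> c \<in> qpush s ` {M. keys M \<subseteq> E}}"
    unfolding chain_span_def by blast
  also have "qvec.subspace \<dots>"
    using qvec.subspace_sums[OF subspace_qboundaries module_hom.subspace_image[OF qhom_qpush subspace_keys]]
    by simp
  finally show ?thesis .
qed

lemma qboundaries_subset_chain_span: "qboundaries 1 X \<subseteq> chain_span X s E"
proof
  fix b assume "b \<in> qboundaries 1 X"
  then have "b + qpush s 0 \<in> chain_span X s E"
    unfolding chain_span_def by fastforce
  then show "b \<in> chain_span X s E" by simp
qed

lemma single_in_chain_span: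
  assumes "e \<in> E"
  shows "single (s e) 1 \<in> chain_span X s E"
proof -
  have "0 + qpush s (single e 1) \<in> chain_span X s E"
    unfolding chain_span_def using assms qvec.subspace_0[OF subspace_qboundaries[of 1 X]]
    by fastforce
  then show ?thesis by simp
qed

text \<open>A route from \<open>z\<close> to a base point. If one point is farther out, the base
  point is the vertex configuration with that point at the end of its leg. In a tie the points are
  on different legs, both off the vertex, and the route goes out to \<open>c\<close> and then back
  to \<open>first_vertex i\<close>, whence the subtracted segment. Preferring
  \<open>first_vertex\<close> in a tie is a convention; it decides on which side of the tie the edge
  appears. \<open>SOME\<close> recovers a leg from its positive coordinate.\<close>

definition potential :: "nat \<Rightarrow> (nat \<Rightarrow> nat \<Rightarrow> real) \<Rightarrow> ((nat \<Rightarrow> real) \<Rightarrow> nat \<Rightarrow> nat \<Rightarrow> real) \<Rightarrow>\<^sub>0 rat" where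
  "potential n z =
    (let i = (SOME i. 0 < z 0 i); j = (SOME j. 0 < z 1 j); c = conf_point i 1 j 1 in
     if height n (z 1) < height n (z 0) then straight_chain (first_vertex i) z
     else if height n (z 0) < height n (z 1) then straight_chain (second_vertex j) z
     else straight_chain c z - straight_chain c (first_vertex i))"

lemma leg_support: "0 < r \<Longrightarrow> (SOME k. 0 < leg i r k) = i"
  by (rule some_equality) (auto simp: leg_apply split: if_splits)

lemma potential_first:
  assumes "z \<in> first_outer n i"
  shows "potential n z = straight_chain (first_vertex i) z"
  using assms by (auto elim!: first_outerE simp: potential_def leg_support)

lemma potential_second:
  assumes "z \<in> second_outer n j"
  shows "potential n z = straight_chain (second_vertex j) z"
  using assms by (auto elim!: second_outerE simp: potential_def leg_support)

lemma potential_equal: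
  assumes "i \<in> {1..n}" "j \<in> {1..n}" "0 < r"
  shows "potential n (conf_point i r j r)
    = straight_chain (conf_point i 1 j 1) (conf_point i r j r)
      - straight_chain (conf_point i 1 j 1) (first_vertex i)"
  using assms by (simp add: potential_def leg_support Let_def)

lemma conf_point_cases:
  assumes "z \<in> topspace (star_conf n)"
  obtains (first) i where "z \<in> first_outer n i"
  | (second) j where "z \<in> second_outer n j"
  | (equal) i j r where "(i, j) \<in> off_diagonal n" "0 < r" "r \<le> 1" "z = conf_point i r j r"
proof -
  obtain i r j s where *: "i \<in> {1..n}" "j \<in> {1..n}" "r \<in> {0..1}" "s \<in> {0..1}"
    "leg i r \<noteq> leg j s" "z = conf_point i r j s"
    using assms by (rule star_confE)
  consider "s < r" | "r < s" | "r = s" by linarith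
  then show thesis
  proof cases
    case 1
    then have "z \<in> first_outer n i"
      using * assms by (simp add: first_outer_def leg_apply)
    then show thesis by (rule first)
  next
    case 2
    then have "z \<in> second_outer n j"
      using * assms by (simp add: second_outer_def leg_apply)
    then show thesis by (rule second)
  next
    case 3
    with * have "i \<noteq> j" "r \<noteq> 0" by auto
    with * 3 show thesis by (intro equal[of i j r]) (auto simp: off_diagonal_def)
  qed
qed

abbreviation edge_span where
  "edge_span n \<equiv> chain_span (star_conf n) edge_simplex (off_diagonal n)"

lemma vertex_difference_in_edge_span:
  assumes "(i, j) \<in> off_diagonal n"
  shows "straight_chain (conf_point i 1 j 1) (first_vertex i)
    - straight_chain (conf_point i 1 j 1) (second_vertex j) \<in> edge_span n"
proof -
  have "path_chain (edge_path i j) \<in> edge_span n"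
    using single_in_chain_span[OF assms, of edge_simplex] by (simp add: edge_simplex_def)
  from qvec.subspace_diff[OF subspace_chain_span this
      subsetD[OF qboundaries_subset_chain_span edge_path_homologous[OF assms]]]
  show ?thesis by simp
qed

text \<open>The set \<open>apart n i j\<close> meets all three branches of the potential. In each
  one the route is compared, inside \<open>on_legs n i j\<close>, with the route through the centre
  of that set. Only the branch that ends at \<open>second_vertex j\<close> has the wrong base point,
  and correcting it costs exactly one edge.\<close>

lemma potential_apart:
  assumes ij: "(i, j) \<in> off_diagonal n" and z: "z \<in> apart n i j"
  shows "potential n z - (straight_chain (conf_point i 1 j 1) z
    - straight_chain (conf_point i 1 j 1) (first_vertex i)) \<in> edge_span n"
proof -
  let ?c = "conf_point i 1 j 1"
  obtain r s where z_eq: "i \<in> {1..n}" "j \<in> {1..n}" "0 < r" "r \<le> 1" "0 < s" "s \<le> 1" "z = conf_point i r j s"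
    using z by (rule apartE)
  have neq: "i \<noteq> j" using ij by (simp add: off_diagonal_def)
  have zt: "z \<in> topspace (star_conf n)" using z by (simp add: apart_def)
  have bounds: "(1 - u) * x \<in> {0..1}" "(1 - u) * x + u * 1 \<in> {0..1}" "0 < (1 - u) * x + u * 1"
    if "0 < x" "x \<le> 1" "u \<in> {0..1}" for x u :: real
  proof -
    have "0 \<le> (1 - u) * x" "(1 - u) * x \<le> 1 - u" using that by (auto simp: mult_left_le)
    then show "(1 - u) * x \<in> {0..1}" "(1 - u) * x + u * 1 \<in> {0..1}" using that by auto
    show "0 < (1 - u) * x + u * 1" using that by (cases "u = 0") (auto intro!: add_nonneg_pos)
  qed
  consider "s < r" | "r < s" | "r = s" by linarith
  then show ?thesis
  proof cases
    case 1
    then have "z \<in> first_outer n i"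
      using zt z_eq by (simp add: first_outer_def leg_apply)
    note pot = potential_first[OF this]
    have eq: "straight (first_vertex i) z = (\<lambda>u. conf_point i ((1 - u) * r + u * 1) j ((1 - u) * s))"
      unfolding z_eq(7) by (rule ext) (rule straight_two_points_0)
    have on: "straight (first_vertex i) z u \<in> on_legs n i j" if "u \<in> {0..1}" for u
      unfolding eq on_legs_def using bounds[OF z_eq(3,4) that] bounds(1)[OF z_eq(5,6) that] by force
    have "pathin (star_conf n) (straight (first_vertex i) z)"
      by (rule pathin_straight) (use on on_legs_subset z_eq neq in blast)
    from on_legs_path[OF z_eq(1,2) neq this on]
    have "straight_chain (first_vertex i) z - (straight_chain ?c z - straight_chain ?c (first_vertex i))
        \<in> qboundaries 1 (star_conf n)"
      using straight_0[OF star_conf_extensional[OF zt]] straight_1[OF two_points_extensional] by simp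
    then show ?thesis
      unfolding pot using qboundaries_subset_chain_span by blast
  next
    case 2
    then have "z \<in> second_outer n j"
      using zt z_eq by (simp add: second_outer_def leg_apply)
    note pot = potential_second[OF this]
    have eq: "straight (second_vertex j) z = (\<lambda>u. conf_point i ((1 - u) * r) j ((1 - u) * s + u * 1))"
      unfolding z_eq(7) by (rule ext) (rule straight_two_points_0)
    have on: "straight (second_vertex j) z u \<in> on_legs n i j" if "u \<in> {0..1}" for u
      unfolding eq on_legs_def using bounds[OF z_eq(5,6) that] bounds(1)[OF z_eq(3,4) that] by force
    have "pathin (star_conf n) (straight (second_vertex j) z)"
      by (rule pathin_straight) (use on on_legs_subset z_eq neq in blast)
    from on_legs_path[OF z_eq(1,2) neq this on]
    have "straight_chain (second_vertex j) z - (straight_chain ?c z - straight_chain ?c (second_vertex j))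
        \<in> qboundaries 1 (star_conf n)"
      using straight_0[OF star_conf_extensional[OF zt]] straight_1[OF two_points_extensional] by simp
    then have "straight_chain (second_vertex j) z - (straight_chain ?c z - straight_chain ?c (second_vertex j))
        \<in> edge_span n"
      using qboundaries_subset_chain_span by blast
    from qvec.subspace_add[OF subspace_chain_span this vertex_difference_in_edge_span[OF ij]]
    show ?thesis
      unfolding pot by (simp add: algebra_simps)
  next
    case 3
    with z_eq show ?thesis
      by (simp add: potential_equal qvec.subspace_0[OF subspace_chain_span])
  qed
qed

lemma star_conf_path:
  assumes g: "pathin (star_conf n) g"
  shows "path_chain g - (potential n (g 0) - potential n (g 1)) \<in> edge_span n"
proof (rule path_local_to_global[OF subspace_chain_span qboundaries_subset_chain_span _ g])
  have ends: "g 0 \<in> V" "g 1 \<in> V" if "pathin (subtopology (star_conf n) V) g" for g V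
    using that by (auto simp: pathin_def continuous_map_in_subtopology)
  fix z assume "z \<in> topspace (star_conf n)"
  then show "\<exists>V. openin (star_conf n) V \<and> z \<in> V \<and> (\<forall>g. pathin (subtopology (star_conf n) V) g \<longrightarrow>
      path_chain g - (potential n (g 0) - potential n (g 1)) \<in> edge_span n)"
  proof (cases rule: conf_point_cases)
    case (first i)
    show ?thesis
    proof (intro exI[of _ "first_outer n i"] conjI allI impI openin_cover first)
      fix g assume g: "pathin (subtopology (star_conf n) (first_outer n i)) g"
      show "path_chain g - (potential n (g 0) - potential n (g 1)) \<in> edge_span n"
        unfolding potential_first[OF ends(1)[OF g]] potential_first[OF ends(2)[OF g]]
        using first_outer_path[OF g] qboundaries_subset_chain_span by blast
    qed
  next
    case (second j)
    show ?thesis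
    proof (intro exI[of _ "second_outer n j"] conjI allI impI openin_cover second)
      fix g assume g: "pathin (subtopology (star_conf n) (second_outer n j)) g"
      show "path_chain g - (potential n (g 0) - potential n (g 1)) \<in> edge_span n"
        unfolding potential_second[OF ends(1)[OF g]] potential_second[OF ends(2)[OF g]]
        using second_outer_path[OF g] qboundaries_subset_chain_span by blast
    qed
  next
    case (equal i j r)
    then have ij: "i \<in> {1..n}" "j \<in> {1..n}" "i \<noteq> j" by (auto simp: off_diagonal_def)
    let ?c = "conf_point i 1 j 1"
    show ?thesis
    proof (intro exI[of _ "apart n i j"] conjI allI impI openin_cover)
      show "z \<in> apart n i j"
        using equal ij \<open>z \<in> topspace _\<close> by (simp add: apart_def leg_apply)
      fix g assume g: "pathin (subtopology (star_conf n) (apart n i j)) g"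
      have "apart n i j \<subseteq> on_legs n i j"
        by (force elim!: apartE simp: on_legs_def)
      then have "path_chain g - (straight_chain ?c (g 0) - straight_chain ?c (g 1))
          \<in> qboundaries 1 (star_conf n)"
        using g by (intro on_legs_path[OF ij]) (auto simp: pathin_def continuous_map_in_subtopology)
      then have 1: "path_chain g - (straight_chain ?c (g 0) - straight_chain ?c (g 1)) \<in> edge_span n"
        using qboundaries_subset_chain_span by blast
      have 2: "potential n (g t) - (straight_chain ?c (g t) - straight_chain ?c (first_vertex i)) \<in> edge_span n"
        if "t \<in> {0, 1}" for t
        using potential_apart[OF equal(1)] ends[OF g] that by auto
      \<comment> \<open>The segment from \<open>first_vertex i\<close> enters at both ends of
        \<open>g\<close> and cancels.\<close>
      from qvec.subspace_add[OF subspace_chain_span qvec.subspace_diff[OF subspace_chain_span 1 2[of 0]] 2[of 1]]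
      show "path_chain g - (potential n (g 0) - potential n (g 1)) \<in> edge_span n"
        by (simp add: algebra_simps)
    qed
  qed
qed

text \<open>A map to the punctured plane that winds once around \<open>0\<close> along \<open>edge_path i j\<close> and is
  positive off \<open>apart n i j\<close>.\<close>

definition edge_winding :: "nat \<Rightarrow> nat \<Rightarrow> nat \<Rightarrow> (nat \<Rightarrow> nat \<Rightarrow> real) \<Rightarrow> complex" where
  "edge_winding n i j z =
    (let p = height n (z 0); q = height n (z 1); m = min (z 0 i) (z 1 j)
     in Complex (p + q - 4 * m) (m * (p - q)))"

section \<open>Winding numbers of the edge paths\<close>

lemma edge_winding_conf_point:
  assumes "k \<in> {1..n}" "l \<in> {1..n}"
  shows "edge_winding n i j (conf_point k r l s)
    = (let m = min (leg k r i) (leg l s j) in Complex (r + s - 4 * m) (m * (r - s)))"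
  using assms by (simp add: edge_winding_def)

text \<open>Where \<open>m = 0\<close>, the value is the sum of the heights, which is positive
  because the points do not both sit at the vertex. Where \<open>m > 0\<close>, the imaginary part
  vanishes only for equal heights \<open>r = s\<close>, and there \<open>m = r\<close>, so the real
  part is 2r - 4r = -2r. The factor 4 serves to make this negative.\<close>

lemma continuous_map_edge_winding:
  assumes "i \<noteq> j"
  shows "continuous_map (star_conf n) (top_of_set (- {0})) (edge_winding n i j)"
  unfolding continuous_map_in_subtopology
proof (intro conjI funcsetI)
  have p: "continuous_map (star_conf n) euclideanreal (\<lambda>z. height n (z 0))"
    and q: "continuous_map (star_conf n) euclideanreal (\<lambda>z. height n (z 1))"
    and m: "continuous_map (star_conf n) euclideanreal (\<lambda>z. min (z 0 i) (z 1 j))"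
    by (intro continuous_map_real_min continuous_map_star_conf_height continuous_map_star_conf_coord; simp)+
  have re: "continuous_map (star_conf n) euclideanreal
      (\<lambda>z. height n (z 0) + height n (z 1) - 4 * min (z 0 i) (z 1 j))"
    by (intro continuous_map_diff continuous_map_add continuous_map_real_mult_left p q m)
  have im: "continuous_map (star_conf n) euclideanreal
      (\<lambda>z. min (z 0 i) (z 1 j) * (height n (z 0) - height n (z 1)))"
    by (intro continuous_map_diff continuous_map_real_mult p q m)
  have "continuous_map euclideanreal euclidean complex_of_real"
    "continuous_map euclideanreal euclidean (\<lambda>x. \<i> * complex_of_real x)"
    by (auto intro!: continuous_intros)
  from continuous_map_add[OF continuous_map_compose[OF re this(1)] continuous_map_compose[OF im this(2)]]
  show "continuous_map (star_conf n) euclidean (edge_winding n i j)"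
    by (simp add: comp_def edge_winding_def[abs_def] Let_def Complex_eq)
  fix z assume "z \<in> topspace (star_conf n)"
  then obtain k r l s where *: "k \<in> {1..n}" "l \<in> {1..n}" "r \<in> {0..1}" "s \<in> {0..1}"
    "leg k r \<noteq> leg l s" "z = conf_point k r l s" by (rule star_confE)
  have "r + s \<noteq> 0"
  proof
    assume "r + s = 0"
    with *(3,4) have "r = 0" "s = 0" by auto
    with *(5) show False by simp
  qed
  with * assms show "edge_winding n i j z \<in> - {0}"
    by (auto simp: edge_winding_conf_point leg_apply complex_eq_iff Let_def min_def)
qed

text \<open>Multiplication by \<open>k\<close> moves the relevant closed half-plane to the right
  one. Without the origin, that half-plane avoids the branch cut of \<open>Ln\<close>.\<close>

lemma continuous_log_half_plane:
  assumes c: "continuous_on S c" and k: "k \<noteq> 0"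
    and half: "\<And>t. t \<in> S \<Longrightarrow> 0 \<le> Re (k * c t) \<and> c t \<noteq> 0"
  shows "continuous_on S (\<lambda>t. Ln (k * c t) - Ln k)"
    "\<And>t. t \<in> S \<Longrightarrow> exp (Ln (k * c t) - Ln k) = c t"
proof -
  have "k * c t \<notin> \<real>\<^sub>\<le>\<^sub>0" if "t \<in> S" for t
  proof -
    have "k * c t \<noteq> 0" "0 \<le> Re (k * c t)"
      using half[OF that] k by auto
    then show ?thesis
      unfolding complex_nonpos_Reals_iff complex_eq_iff by auto
  qed
  then show "continuous_on S (\<lambda>t. Ln (k * c t) - Ln k)"
    by (intro continuous_intros c) auto
  show "exp (Ln (k * c t) - Ln k) = c t" if "t \<in> S" for t
    using half[OF that] k by (simp add: exp_diff)
qed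

text \<open>While the second point moves out, the value runs from 1 to -2 through the closed upper
  half-plane; while the first one retreats, it returns to 1 through the lower one. Each half has a
  principal logarithm after rotation by -i or i and contributes i pi; the terms \<open>Ln 2\<close>
  cancel.\<close>

lemma edge_winding_same:
  assumes ij: "(i, j) \<in> off_diagonal n" and l: "continuous_on {0..1} l"
    and exp_l: "\<And>t. t \<in> {0..1} \<Longrightarrow> edge_winding n i j (edge_path i j t) = exp (l t)"
  shows "l 1 - l 0 = 2 * of_real pi * \<i>"
proof -
  define c where "c t = edge_winding n i j (edge_path i j t)" for t
  have c1: "c t = Complex (1 - 6 * t) (2 * t * (1 - 2 * t))" if "t \<in> {0..1/2}" for t
    using that ij by (auto simp: c_def edge_path_def edge_winding_conf_point leg_apply Let_def off_diagonal_def)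
  have c2: "c t = Complex (6 * t - 5) ((2 - 2 * t) * (1 - 2 * t))" if "t \<in> {1/2..1}" for t
    using that ij by (auto simp: c_def edge_path_def edge_winding_conf_point leg_apply Let_def off_diagonal_def)
  have c: "continuous_on {0..1} c"
    using continuous_on_cong[of "{0..1}" "{0..1}" c "\<lambda>t. exp (l t)"] exp_l l
    by (auto simp: c_def intro!: continuous_intros)
  have c0: "c t \<noteq> 0" if "t \<in> {0..1}" for t
    using exp_l[OF that] by (simp add: c_def)
  have eq: "exp (l t) = c t" if "t \<in> {0..1}" for t
    using exp_l[OF that] by (simp add: c_def)
  have up: "0 \<le> Re (- \<i> * c t) \<and> c t \<noteq> 0" if "t \<in> {0..1/2}" for t
    using c1[OF that] c0[of t] that by auto
  have down: "0 \<le> Re (\<i> * c t) \<and> c t \<noteq> 0" if "t \<in> {1/2..1}" for t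
  proof -
    have "(2 - 2 * t) * (1 - 2 * t) \<le> 0"
      using that by (intro mult_nonneg_nonpos) auto
    then show ?thesis using c2[OF that] c0[of t] that by auto
  qed
  have *: "continuous_on {0..1/2} c" "continuous_on {1/2..1} c"
    "continuous_on {0..1/2} l" "continuous_on {1/2..1} l"
    using c l by (auto elim: continuous_on_subset)
  have 1: "l (1/2) - l 0 = (Ln (- \<i> * c (1/2)) - Ln (- \<i>)) - (Ln (- \<i> * c 0) - Ln (- \<i>))"
    by (rule continuous_log_unique[OF *(3) continuous_log_half_plane(1)[OF *(1) _ up]])
      (use continuous_log_half_plane(2)[OF *(1) _ up] eq in auto)
  have 2: "l 1 - l (1/2) = (Ln (\<i> * c 1) - Ln \<i>) - (Ln (\<i> * c (1/2)) - Ln \<i>)"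
    by (rule continuous_log_unique[OF *(4) continuous_log_half_plane(1)[OF *(2) _ down]])
      (use continuous_log_half_plane(2)[OF *(2) _ down] eq in auto)
  have 3: "c 0 = 1" "c (1/2) = - of_real 2" "c 1 = 1"
    using c1[of 0] c1[of "1/2"] c2[of 1] by (auto simp: complex_eq_iff)
  have 4: "Ln (of_real 2 * \<i>) = Ln (of_real 2) + Ln \<i>" "Ln (of_real 2 * (- \<i>)) = Ln (of_real 2) + Ln (- \<i>)"
    by (rule Ln_times_of_real; simp)+
  have "l (1/2) - l 0 = Ln (of_real 2) + \<i> * pi"
    unfolding 1 3 using 4(1) by (simp add: mult.commute)
  moreover have "l 1 - l (1/2) = \<i> * pi - Ln (of_real 2)"
    unfolding 2 3 using 4(2) by (simp add: mult.commute)
  ultimately have "l 1 - l 0 = (\<i> * pi - Ln (of_real 2)) + (Ln (of_real 2) + \<i> * pi)"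
    by (metis diff_add_cancel add_diff_eq)
  then show ?thesis by simp
qed

text \<open>On an edge path other than that of \<open>(i, j)\<close>, one of the two coordinates in
  the minimum is always 0. The value is then the positive sum of the heights, whose real logarithm
  starts and ends at 0.\<close>

lemma edge_winding_log:
  assumes ij: "(i, j) \<in> off_diagonal n" and kl: "(k, k') \<in> off_diagonal n"
  obtains l where "continuous_on {0..1} l"
    "\<And>t. t \<in> {0..1} \<Longrightarrow> edge_winding n i j (edge_path k k' t) = exp (l t)"
    "l 1 - l 0 = (if (k, k') = (i, j) then 2 * of_real pi * \<i> else 0)"
proof (cases "(k, k') = (i, j)")
  case True
  have "continuous_map (top_of_set {0..1}) (top_of_set (- {0})) (edge_winding n i j \<circ> edge_path k k')"
    using pathin_edge_path[OF kl] continuous_map_edge_winding[of i j n] ij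
    unfolding pathin_def by (intro continuous_map_compose) (auto simp: off_diagonal_def)
  then have "continuous_on {0..1} (edge_winding n i j \<circ> edge_path k k')"
    "\<And>t. t \<in> {0..1} \<Longrightarrow> (edge_winding n i j \<circ> edge_path k k') t \<noteq> 0"
    unfolding continuous_map_in_subtopology by (auto simp: continuous_map_iff_continuous)
  then obtain l where l: "continuous_on {0..1} l"
    "\<And>t. t \<in> {0..1} \<Longrightarrow> (edge_winding n i j \<circ> edge_path k k') t = exp (l t)"
    using continuous_logarithm_on_contractible[OF _ convex_imp_contractible[of "{0..1::real}"]]
    by (metis convex_real_interval(5))
  then show thesis
    using that[OF l(1)] edge_winding_same[OF ij l(1)] True by simp
next
  case False
  define f where "f t = min 1 (2 - 2 * t) + min 1 (2 * t)" for t :: real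
  have pos: "0 < f t" if "t \<in> {0..1}" for t
    using that by (auto simp: f_def min_def)
  have "edge_winding n i j (edge_path k k' t) = of_real (f t)" if "t \<in> {0..1}" for t
    using that kl False
    by (auto simp: edge_path_def edge_winding_conf_point leg_apply off_diagonal_def f_def complex_eq_iff Let_def)
  moreover have "continuous_on {0..1} (\<lambda>t. complex_of_real (ln (f t)))"
    using pos unfolding f_def by (intro continuous_intros) force
  moreover have "exp (complex_of_real (ln (f t))) = of_real (f t)" if "t \<in> {0..1}" for t
    using pos[OF that] by (simp add: exp_of_real)
  moreover have "f 0 = 1" "f 1 = 1"
    by (simp_all add: f_def)
  ultimately show thesis
    using False by (intro that[of "\<lambda>t. complex_of_real (ln (f t))"]) auto
qed

section \<open>The spaces of cycles and the permutation action on them\<close>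

definition cycle_space :: "nat \<Rightarrow> (nat \<times> nat \<Rightarrow>\<^sub>0 rat) set" where
  "cycle_space n = {M. keys M \<subseteq> off_diagonal n \<and>
    (\<forall>i\<in>{1..n}. (\<Sum>j\<in>{1..n}. lookup M (i, j)) = 0) \<and>
    (\<forall>j\<in>{1..n}. (\<Sum>i\<in>{1..n}. lookup M (i, j)) = 0)}"

definition antisymmetric_cycles :: "nat \<Rightarrow> (nat \<times> nat \<Rightarrow>\<^sub>0 rat) set" where
  "antisymmetric_cycles n =
    {M \<in> cycle_space n. \<forall>i j. lookup M (i, j) = - lookup M (j, i)}"

lemma subspace_cycle_space: "qvec.subspace (cycle_space n)"
proof (rule qvec.subspaceI)
  fix M N assume "M \<in> cycle_space n" "N \<in> cycle_space n"
  then show "M + N \<in> cycle_space n"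
    using qvec.subspace_add[OF subspace_keys, of M "off_diagonal n" N]
    by (auto simp: cycle_space_def lookup_add sum.distrib)
next
  fix q M assume "M \<in> cycle_space n"
  then show "qscale q M \<in> cycle_space n"
    using qvec.subspace_scale[OF subspace_keys, of M "off_diagonal n" q]
    by (auto simp: cycle_space_def simp flip: sum_distrib_left)
qed (simp add: cycle_space_def)

lemma antisymmetric_cyclesD:
  "M \<in> antisymmetric_cycles n \<Longrightarrow> lookup M (i, j) = - lookup M (j, i)"
  unfolding antisymmetric_cycles_def by blast

lemma antisymmetric_cyclesI:
  assumes "M \<in> cycle_space n" "\<And>i j. lookup M (i, j) = - lookup M (j, i)"
  shows "M \<in> antisymmetric_cycles n"
  unfolding antisymmetric_cycles_def using assms by blast

lemma antisymmetric_cycles_subset: "antisymmetric_cycles n \<subseteq> cycle_space n"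
  unfolding antisymmetric_cycles_def by blast

lemma subspace_antisymmetric_cycles: "qvec.subspace (antisymmetric_cycles n)"
proof (rule qvec.subspaceI)
  show "0 \<in> antisymmetric_cycles n"
    using qvec.subspace_0[OF subspace_cycle_space] by (simp add: antisymmetric_cyclesI)
next
  fix M N assume *: "M \<in> antisymmetric_cycles n" "N \<in> antisymmetric_cycles n"
  show "M + N \<in> antisymmetric_cycles n"
  proof (rule antisymmetric_cyclesI)
    show "M + N \<in> cycle_space n"
      using * antisymmetric_cycles_subset by (blast intro: qvec.subspace_add[OF subspace_cycle_space])
    show "lookup (M + N) (i, j) = - lookup (M + N) (j, i)" for i j
      unfolding lookup_add using *[THEN antisymmetric_cyclesD, of i j] by linarith
  qed
next
  fix q M assume *: "M \<in> antisymmetric_cycles n"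
  show "qscale q M \<in> antisymmetric_cycles n"
  proof (rule antisymmetric_cyclesI)
    show "qscale q M \<in> cycle_space n"
      using * antisymmetric_cycles_subset by (blast intro: qvec.subspace_scale[OF subspace_cycle_space])
    show "lookup (qscale q M) (i, j) = - lookup (qscale q M) (j, i)" for i j
      unfolding lookup_qscale antisymmetric_cyclesD[OF *, of i j] by simp
  qed
qed

lemma lookup_permuted:
  assumes "bij \<sigma>"
  shows "lookup (qpush (map_prod \<sigma> \<sigma>) M) (\<sigma> i, \<sigma> j) = lookup M (i, j)"
  using lookup_qpush_inj[of "map_prod \<sigma> \<sigma>" M "(i, j)"] assms
  by (simp add: bij_is_inj prod.inj_map)

lemma permuted_cycle:
  assumes \<sigma>: "\<sigma> permutes {1..n}" and M: "M \<in> cycle_space n"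
  shows "qpush (map_prod \<sigma> \<sigma>) M \<in> cycle_space n"
proof -
  let ?M = "qpush (map_prod \<sigma> \<sigma>) M"
  have "map_prod \<sigma> \<sigma> ` off_diagonal n \<subseteq> off_diagonal n"
    by (auto simp: off_diagonal_def permutes_in_image[OF \<sigma>] inj_eq[OF permutes_inj[OF \<sigma>]]
        simp del: atLeastAtMost_iff One_nat_def)
  then have "keys ?M \<subseteq> off_diagonal n"
    using keys_qpush[of "map_prod \<sigma> \<sigma>" M] M unfolding cycle_space_def by blast
  moreover have "(\<Sum>j\<in>{1..n}. lookup ?M (i, j)) = 0" "(\<Sum>j\<in>{1..n}. lookup ?M (j, i)) = 0"
    if i: "i \<in> {1..n}" for i
  proof -
    obtain k where k: "i = \<sigma> k" "k \<in> {1..n}"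
      using permutes_image[OF \<sigma>] i by blast
    have "(\<Sum>j\<in>{1..n}. lookup ?M (i, j)) = (\<Sum>j\<in>{1..n}. lookup M (k, j))"
      "(\<Sum>j\<in>{1..n}. lookup ?M (j, i)) = (\<Sum>j\<in>{1..n}. lookup M (j, k))"
      by (subst sum.permute[OF \<sigma>]; simp add: k(1) comp_def lookup_permuted[OF permutes_bij[OF \<sigma>]])+
    with M k show "(\<Sum>j\<in>{1..n}. lookup ?M (i, j)) = 0"
      "(\<Sum>j\<in>{1..n}. lookup ?M (j, i)) = 0"
      by (auto simp: cycle_space_def)
  qed
  ultimately show ?thesis by (simp add: cycle_space_def)
qed

lemma permuted_antisymmetric:
  assumes \<sigma>: "\<sigma> permutes {1..n}" and M: "M \<in> antisymmetric_cycles n"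
  shows "qpush (map_prod \<sigma> \<sigma>) M \<in> antisymmetric_cycles n"
proof -
  show ?thesis
  proof (rule antisymmetric_cyclesI)
    show "qpush (map_prod \<sigma> \<sigma>) M \<in> cycle_space n"
      using permuted_cycle[OF \<sigma>] M antisymmetric_cycles_subset by blast
    fix i j
    obtain k l where kl: "i = \<sigma> k" "j = \<sigma> l"
      using permutes_surj[OF \<sigma>] by (metis surjD)
    show "lookup (qpush (map_prod \<sigma> \<sigma>) M) (i, j) = - lookup (qpush (map_prod \<sigma> \<sigma>) M) (j, i)"
      unfolding kl lookup_permuted[OF permutes_bij[OF \<sigma>]] by (rule antisymmetric_cyclesD[OF M])
  qed
qed

abbreviation pair_rep :: "(nat \<times> nat \<Rightarrow>\<^sub>0 rat) set \<Rightarrow> (nat \<Rightarrow> nat, nat \<times> nat \<Rightarrow>\<^sub>0 rat) rep" where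
  "pair_rep S \<equiv> with_action (subspace_module S) (\<lambda>\<sigma>. qpush (map_prod \<sigma> \<sigma>))"

lemma representation_permuted:
  assumes "qvec.subspace S"
    and "\<And>\<sigma> M. \<sigma> permutes {1..n} \<Longrightarrow> M \<in> S \<Longrightarrow> qpush (map_prod \<sigma> \<sigma>) M \<in> S"
  shows "representation (sym_group n) (pair_rep S)"
  using assms
  by (intro representation_subspace sym_group_is_group)
    (auto simp: sym_group_carrier sym_group_mult sym_group_one prod.map_comp)

text \<open>Values of \<open>a\<close> and \<open>b\<close> may coincide: the ordered case has two
  separate families of vertices, while the unordered case takes the same family for both.\<close>

lemma edge_boundary_expansion:
  assumes "keys M \<subseteq> off_diagonal n"
  shows "qextend (\<lambda>e. single (b (snd e)) 1 - single (a (fst e)) 1) M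
    = (\<Sum>j\<in>{1..n}. single (b j) (\<Sum>i\<in>{1..n}. lookup M (i, j)))
    - (\<Sum>i\<in>{1..n}. single (a i) (\<Sum>j\<in>{1..n}. lookup M (i, j)))"
proof (rule poly_mapping_eqI)
  fix x
  have "keys M \<subseteq> {1..n} \<times> {1..n}"
    using assms by (auto simp: off_diagonal_def)
  then have "lookup (qextend (\<lambda>e. single (b (snd e)) 1 - single (a (fst e)) 1) M) x
    = (\<Sum>i\<in>{1..n}. \<Sum>j\<in>{1..n}. lookup M (i, j) * ((1 when b j = x) - (1 when a i = x)))"
    by (simp add: qextend_superset[of "{1..n} \<times> {1..n}"] lookup_sum lookup_minus lookup_single
        sum.cartesian_product split_def)
  also have "\<dots> = (\<Sum>i\<in>{1..n}. \<Sum>j\<in>{1..n}. lookup M (i, j) * (1 when b j = x))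
      - (\<Sum>i\<in>{1..n}. \<Sum>j\<in>{1..n}. lookup M (i, j) * (1 when a i = x))"
    by (simp add: right_diff_distrib sum_subtractf)
  also have "(\<Sum>i\<in>{1..n}. \<Sum>j\<in>{1..n}. lookup M (i, j) * (1 when b j = x))
      = (\<Sum>j\<in>{1..n}. (\<Sum>i\<in>{1..n}. lookup M (i, j)) * (1 when b j = x))"
    by (subst sum.swap) (simp add: sum_distrib_right)
  also have "(\<Sum>i\<in>{1..n}. \<Sum>j\<in>{1..n}. lookup M (i, j) * (1 when a i = x))
      = (\<Sum>i\<in>{1..n}. (\<Sum>j\<in>{1..n}. lookup M (i, j)) * (1 when a i = x))"
    by (simp add: sum_distrib_right)
  finally show "lookup (qextend (\<lambda>e. single (b (snd e)) 1 - single (a (fst e)) 1) M) x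
    = lookup ((\<Sum>j\<in>{1..n}. single (b j) (\<Sum>i\<in>{1..n}. lookup M (i, j)))
    - (\<Sum>i\<in>{1..n}. single (a i) (\<Sum>j\<in>{1..n}. lookup M (i, j)))) x"
    by (simp add: lookup_minus lookup_sum lookup_single when_def if_distrib cong: if_cong)
qed

section \<open>Boundaries of edge chains and injectivity\<close>

lemma point_simplex_eq_iff [simp]: "point_simplex x = point_simplex y \<longleftrightarrow> x = y"
proof
  assume "point_simplex x = point_simplex y"
  then have "point_simplex x (\<lambda>j. if j = 0 then 1 else 0) = point_simplex y (\<lambda>j. if j = 0 then 1 else 0)"
    by simp
  then show "x = y" by (simp add: point_simplex_def standard_simplex_0)
qed simp

lemma vertex_eq_iff [simp]:
  "first_vertex i = first_vertex j \<longleftrightarrow> i = j" "second_vertex i = second_vertex j \<longleftrightarrow> i = j"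
  "first_vertex i \<noteq> second_vertex j"
proof -
  have "leg i 1 = leg j 1 \<longleftrightarrow> i = j" "leg i 1 \<noteq> (\<lambda>_. 0)" for i j
    by (metis leg_apply zero_neq_one)+
  then show "first_vertex i = first_vertex j \<longleftrightarrow> i = j" "second_vertex i = second_vertex j \<longleftrightarrow> i = j"
    "first_vertex i \<noteq> second_vertex j"
    by simp_all
qed

lemma path_simplexes_in_qchains:
  assumes "\<And>e. e \<in> E \<Longrightarrow> pathin X (g e)" "keys M \<subseteq> E"
  shows "qpush (\<lambda>e. path_simplex (g e)) M \<in> qchains 1 X"
proof (rule qhom_in_subspace[OF qhom_qpush subspace_qchains])
  fix e assume "e \<in> keys M"
  with assms have "pathin X (g e)" by blast
  from path_chain_in_qchains[OF this]
  show "qpush (\<lambda>e. path_simplex (g e)) (single e 1) \<in> qchains 1 X" by simp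
qed

lemma qboundary_edges:
  assumes "\<And>e. g e 0 = a (fst e)" "\<And>e. g e 1 = b (snd e)"
  shows "qboundary 1 (qpush (\<lambda>e. path_simplex (g e)) M)
    = qextend (\<lambda>e. single (point_simplex (b (snd e))) 1 - single (point_simplex (a (fst e))) 1) M"
proof (rule qhom_eqI[OF qhom_compose[OF qhom_qpush qhom_qboundary] qhom_qextend])
  fix e
  show "qboundary 1 (qpush (\<lambda>e. path_simplex (g e)) (single e 1))
      = qextend (\<lambda>e. single (point_simplex (b (snd e))) 1
          - single (point_simplex (a (fst e))) 1) (single e 1)"
    unfolding qpush_single qextend_single qvec.scale_one qboundary_path_chain assms ..
qed

lemma edge_simplex_abs: "edge_simplex = (\<lambda>e. path_simplex (edge_path (fst e) (snd e)))"
  by (simp add: edge_simplex_def fun_eq_iff)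

text \<open>The vertex configurations are pairwise distinct, so the coefficients of the boundary are
  precisely the column sums and the negated row sums.\<close>

lemma edge_cycle_iff:
  assumes M: "keys M \<subseteq> off_diagonal n"
  shows "qpush edge_simplex M \<in> qcycles 1 (star_conf n) \<longleftrightarrow> M \<in> cycle_space n"
proof -
  let ?a = "\<lambda>i. point_simplex (first_vertex i)" and ?b = "\<lambda>j. point_simplex (second_vertex j)"
  let ?row = "\<lambda>i. \<Sum>j\<in>{1..n}. lookup M (i, j)"
  let ?col = "\<lambda>j. \<Sum>i\<in>{1..n}. lookup M (i, j)"
  have chain: "qpush edge_simplex M \<in> qchains 1 (star_conf n)"
    unfolding edge_simplex_abs
    by (rule path_simplexes_in_qchains[OF _ M]) (metis pathin_edge_path prod.collapse)
  define D where "D = (\<Sum>j\<in>{1..n}. single (?b j) (?col j))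
    - (\<Sum>i\<in>{1..n}. single (?a i) (?row i))"
  have D: "qboundary 1 (qpush edge_simplex M) = D"
    unfolding edge_simplex_abs D_def
    using qboundary_edges[of "\<lambda>e. edge_path (fst e) (snd e)" first_vertex second_vertex M]
      edge_boundary_expansion[OF M, of ?b ?a]
    by (simp add: edge_path_ends)
  have "lookup D (?a k) = - ?row k" "lookup D (?b k) = ?col k" if "k \<in> {1..n}" for k
    using that vertex_eq_iff(3) vertex_eq_iff(3)[symmetric] unfolding D_def
    by (simp_all add: lookup_minus lookup_sum lookup_single when_def del: two_points_eq_iff)
  then have "D = 0 \<Longrightarrow> \<forall>k\<in>{1..n}. ?row k = 0 \<and> ?col k = 0"
    by (metis lookup_zero neg_equal_0_iff_equal)
  moreover have "\<forall>k\<in>{1..n}. ?row k = 0 \<and> ?col k = 0 \<Longrightarrow> D = 0"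
    by (simp add: D_def)
  ultimately show ?thesis
    using chain M unfolding qcycles_def cycle_space_def mem_Collect_eq D by blast
qed

lemma log_cochain_qpush:
  "log_cochain F (qpush s M) = (\<Sum>e\<in>keys M.
    of_rat (lookup M e) * log_cochain F (single (s e) 1))"
proof -
  have "module_hom qscale (\<lambda>q z. of_rat q * z) (log_cochain F \<circ> qpush s)"
    by (rule module_hom_compose[OF qhom_qpush log_cochain_hom])
  from qhom_expansion[OF this, of M] show ?thesis by simp
qed

text \<open>Up to the factor 2 pi i, the cochains of the maps \<open>edge_winding n i j\<close> are
  dual to the edges: each one reads off a single coefficient of \<open>M\<close>, and all of them
  vanish on boundaries.\<close>

lemma edges_not_boundary:
  assumes M: "keys M \<subseteq> off_diagonal n" and b: "qpush edge_simplex M \<in> qboundaries 1 (star_conf n)"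
  shows "M = 0"
proof (rule poly_mapping_eqI)
  fix e :: "nat \<times> nat"
  show "lookup M e = lookup 0 e"
  proof (cases "e \<in> off_diagonal n")
    case True
    obtain i j where e: "e = (i, j)" by fastforce
    have "log_cochain (edge_winding n i j) (single (edge_simplex d) 1)
        = (if d = e then 2 * of_real pi * \<i> else 0)" if off: "d \<in> off_diagonal n" for d
    proof -
      obtain k k' where d: "d = (k, k')" by fastforce
      obtain l where "continuous_on {0..1} l"
        "\<And>t. t \<in> {0..1} \<Longrightarrow> edge_winding n i j (edge_path k k' t) = exp (l t)"
        "l 1 - l 0 = (if (k, k') = (i, j) then 2 * of_real pi * \<i> else 0)"
        using edge_winding_log[OF True[unfolded e] off[unfolded d]] by blast
      then show ?thesis
        using log_var_eqI[of l] by (simp add: edge_simplex_def log_cochain_path_chain d e)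
    qed
    then have "log_cochain (edge_winding n i j) (qpush edge_simplex M)
        = (\<Sum>d\<in>keys M. of_rat (lookup M d) * (if d = e then 2 * of_real pi * \<i> else 0))"
      unfolding log_cochain_qpush using M by (intro sum.cong) auto
    also have "\<dots> = (\<Sum>d\<in>keys M. if d = e then of_rat (lookup M e) * (2 * of_real pi * \<i>) else 0)"
      by (intro sum.cong) auto
    also have "\<dots> = of_rat (lookup M e) * (2 * of_real pi * \<i>)"
      by (simp add: in_keys_iff)
    finally show ?thesis
      using log_cochain_qboundaries[OF continuous_map_edge_winding b, of i j] True
      by (simp add: e off_diagonal_def)
  next
    case False
    then show ?thesis using M by (auto simp: in_keys_iff)
  qed
qed

section \<open>Equivariance and the ordered configuration space\<close>

lemma star_map_leg:
  assumes "bij \<sigma>"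
  shows "star_map \<sigma> (leg i t) = leg (\<sigma> i) t"
proof -
  have "inv_into UNIV \<sigma> j = i \<longleftrightarrow> j = \<sigma> i" for j
    using bij_inv_eq_iff[OF assms, of i j] by metis
  then show ?thesis by (simp add: star_map_def leg_def fun_eq_iff)
qed

lemma Conf_map_two_points: "Conf_map 2 f (two_points x y) = two_points (f x) (f y)"
  by (auto simp: Conf_map_def two_points_def fun_eq_iff restrict_def)

lemma Conf_map_edge_path:
  "bij \<sigma> \<Longrightarrow> Conf_map 2 (star_map \<sigma>) (edge_path i j t) = edge_path (\<sigma> i) (\<sigma> j) t"
  by (simp add: edge_path_def Conf_map_two_points star_map_leg)

lemma continuous_map_Conf_map:
  assumes \<sigma>: "\<sigma> permutes {1..n}"
  shows "continuous_map (star_conf n) (star_conf n) (Conf_map 2 (star_map \<sigma>))"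
  unfolding continuous_map_star_conf
proof (intro conjI allI impI funcsetI)
  fix z assume "z \<in> topspace (star_conf n)"
  then obtain i r j s where *: "i \<in> {1..n}" "j \<in> {1..n}" "r \<in> {0..1}" "s \<in> {0..1}"
    "leg i r \<noteq> leg j s" "z = conf_point i r j s" by (rule star_confE)
  have "leg (\<sigma> i) r \<noteq> leg (\<sigma> j) s"
  proof
    assume "leg (\<sigma> i) r = leg (\<sigma> j) s"
    then have "leg (\<sigma> i) r (\<sigma> k) = leg (\<sigma> j) s (\<sigma> k)" for k by simp
    then have "leg i r = leg j s"
      using permutes_inj[OF \<sigma>] by (auto simp: leg_def fun_eq_iff inj_eq)
    with * show False by simp
  qed
  moreover have "leg (\<sigma> i) r \<in> topspace (star_graph n)" "leg (\<sigma> j) s \<in> topspace (star_graph n)"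
    unfolding topspace_star_graph using *(1-4) permutes_in_image[OF \<sigma>] by blast+
  ultimately show "Conf_map 2 (star_map \<sigma>) z \<in> topspace (star_conf n)"
    unfolding topspace_star_conf *(6) Conf_map_two_points star_map_leg[OF permutes_bij[OF \<sigma>]] by blast
next
  fix k l :: nat assume "k < 2"
  then show "continuous_map (star_conf n) euclideanreal (\<lambda>z. Conf_map 2 (star_map \<sigma>) z k l)"
    by (simp add: Conf_map_def star_map_def continuous_map_star_conf_coord)
qed

theorem cycle_space_iso_homology:
  "rep_iso (sym_group n) (pair_rep (cycle_space n))
    (homology_rep 1 (star_conf n) (\<lambda>\<sigma>. Conf_map 2 (star_map \<sigma>)))"
proof (rule homology_rep_iso[where s = edge_simplex])
  show "representation (sym_group n) (pair_rep (cycle_space n))"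
    by (rule representation_permuted[OF subspace_cycle_space permuted_cycle])
  show "qvec.subspace (cycle_space n)" by (rule subspace_cycle_space)
  fix M assume M: "M \<in> cycle_space n"
  then have keys: "keys M \<subseteq> off_diagonal n" by (simp add: cycle_space_def)
  show "qpush edge_simplex M \<in> qcycles 1 (star_conf n)"
    using edge_cycle_iff[OF keys] M by simp
  show "M = 0" if "qpush edge_simplex M \<in> qboundaries 1 (star_conf n)"
    using edges_not_boundary[OF keys that] .
next
  fix c assume c: "c \<in> qcycles 1 (star_conf n)"
  have "qcycles 1 (star_conf n) \<subseteq> edge_span n"
    by (rule qcycles_1_subset[OF subspace_chain_span star_conf_path])
  with c obtain b M where bM: "b \<in> qboundaries 1 (star_conf n)" "keys M \<subseteq> off_diagonal n"
    "c = b + qpush edge_simplex M"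
    unfolding chain_span_def by blast
  \<comment> \<open>The spanning argument gives only some combination of edges; it is a cycle
    because \<open>c\<close> and the boundary \<open>b\<close> are.\<close>
  then have "qpush edge_simplex M = c - b" by simp
  also have "\<dots> \<in> qcycles 1 (star_conf n)"
    using c bM(1) qboundaries_subset_qcycles by (blast intro: qvec.subspace_diff[OF subspace_qcycles])
  finally have "M \<in> cycle_space n"
    using edge_cycle_iff[OF bM(2)] by simp
  with bM show "\<exists>M\<in>cycle_space n. c - qpush edge_simplex M \<in> qboundaries 1 (star_conf n)"
    by (intro bexI[of _ M]) simp_all
next
  fix \<sigma> assume "\<sigma> \<in> carrier (sym_group n)"
  then have \<sigma>: "\<sigma> permutes {1..n}" by (simp add: sym_group_carrier)
  show "continuous_map (star_conf n) (star_conf n) (Conf_map 2 (star_map \<sigma>))"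
    by (rule continuous_map_Conf_map[OF \<sigma>])
  show "simplex_map 1 (Conf_map 2 (star_map \<sigma>)) (edge_simplex e) = edge_simplex (map_prod \<sigma> \<sigma> e)" for e
    unfolding edge_simplex_def simplex_map_path Conf_map_edge_path[OF permutes_bij[OF \<sigma>]]
    by simp
qed

section \<open>Two unordered points on a star\<close>

abbreviation star_uconf :: "nat \<Rightarrow> (nat \<Rightarrow> nat \<Rightarrow> real) set topology" where
  "star_uconf n \<equiv> UConf 2 (star_graph n)"

definition swap_points :: "(nat \<Rightarrow> nat \<Rightarrow> real) \<Rightarrow> nat \<Rightarrow> nat \<Rightarrow> real" where
  "swap_points z = two_points (z 1) (z 0)"

lemma swap_two_points [simp]: "swap_points (two_points x y) = two_points y x"
  by (simp add: swap_points_def)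

lemma swap_swap: "z \<in> extensional {..<2} \<Longrightarrow> swap_points (swap_points z) = z"
  using extensional_two_points[of z] by (simp add: swap_points_def)

lemma perm_orbit_2:
  assumes "z \<in> extensional {..<2}"
  shows "perm_orbit 2 z = {z, swap_points z}"
proof -
  have two: "{..<2::nat} = {0, 1}" by auto
  have "perm_orbit 2 z = {z \<circ> id, z \<circ> Transposition.transpose 0 1}"
    unfolding perm_orbit_def two permutes_doubleton_iff by blast
  moreover have "z \<circ> Transposition.transpose 0 1 = swap_points z"
    using assms
    by (auto simp: fun_eq_iff swap_points_def two_points_def extensional_def Transposition.transpose_def
        less_2_cases_iff)
  ultimately show ?thesis by (simp only: comp_id)
qed

lemma perm_orbit_swap: "z \<in> extensional {..<2} \<Longrightarrow> perm_orbit 2 (swap_points z) = perm_orbit 2 z"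
  using swap_swap[of z] by (auto simp: perm_orbit_2 swap_points_def)

lemma perm_orbit_two_points: "perm_orbit 2 (two_points x y) = perm_orbit 2 (two_points y x)"
  by (auto simp: perm_orbit_2)

lemma swap_in_star_conf: "z \<in> topspace (star_conf n) \<Longrightarrow> swap_points z \<in> topspace (star_conf n)"
  by (auto simp: topspace_star_conf)

lemma perm_orbit_eqD:
  assumes "z \<in> extensional {..<2}" "w \<in> extensional {..<2}" "perm_orbit 2 w = perm_orbit 2 z"
  shows "w = z \<or> w = swap_points z"
  using assms by (auto simp: perm_orbit_2)

lemma topspace_star_uconf: "topspace (star_uconf n) = perm_orbit 2 ` topspace (star_conf n)"
  by (simp add: UConf_def)

lemma quotient_map_star_uconf: "quotient_map (star_conf n) (star_uconf n) (perm_orbit 2)"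
  unfolding UConf_def by (rule quotient_map_quotient_topology)

lemma continuous_map_perm_orbit: "continuous_map (star_conf n) (star_uconf n) (perm_orbit 2)"
  by (rule quotient_imp_continuous_map[OF quotient_map_star_uconf])

lemma continuous_map_swap: "continuous_map (star_conf n) (star_conf n) swap_points"
  unfolding continuous_map_star_conf
proof (intro conjI allI impI)
  fix k l :: nat assume k: "k < 2"
  then have "(\<lambda>z. swap_points z k l) = (\<lambda>z. z (1 - k) l)"
    by (auto simp: swap_points_def two_points_def less_2_cases_iff)
  with k show "continuous_map (star_conf n) euclideanreal (\<lambda>z. swap_points z k l)"
    by (simp add: continuous_map_star_conf_coord)
qed (use swap_in_star_conf in blast)

text \<open>The preimage of the image of \<open>U\<close> is \<open>U\<close> together with its
  swapped copy, so the quotient map is open.\<close>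

lemma openin_perm_orbit_image:
  assumes U: "openin (star_conf n) U"
  shows "openin (star_uconf n) (perm_orbit 2 ` U)"
proof -
  have sub: "U \<subseteq> topspace (star_conf n)" using U by (rule openin_subset)
  have "{z \<in> topspace (star_conf n). perm_orbit 2 z \<in> perm_orbit 2 ` U}
      = U \<union> {z \<in> topspace (star_conf n). swap_points z \<in> U}"
  proof (intro equalityI subsetI)
    fix z assume "z \<in> {z \<in> topspace (star_conf n). perm_orbit 2 z \<in> perm_orbit 2 ` U}"
    then have z: "z \<in> topspace (star_conf n)" and "perm_orbit 2 z \<in> perm_orbit 2 ` U"
      by blast+
    then obtain w where w: "w \<in> U" "perm_orbit 2 w = perm_orbit 2 z"
      by (elim imageE) auto
    with sub have "w = z \<or> w = swap_points z"
      by (intro perm_orbit_eqD star_conf_extensional[OF z] star_conf_extensional[of w n]) auto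
    with w z show "z \<in> U \<union> {z \<in> topspace (star_conf n). swap_points z \<in> U}" by blast
  next
    fix z assume z: "z \<in> U \<union> {z \<in> topspace (star_conf n). swap_points z \<in> U}"
    then have top: "z \<in> topspace (star_conf n)" using sub by blast
    have "perm_orbit 2 (swap_points z) = perm_orbit 2 z"
      by (rule perm_orbit_swap[OF star_conf_extensional[OF top]])
    with z have "perm_orbit 2 z \<in> perm_orbit 2 ` U"
      by (metis (no_types, lifting) UnE image_eqI mem_Collect_eq)
    with top show "z \<in> {z \<in> topspace (star_conf n). perm_orbit 2 z \<in> perm_orbit 2 ` U}"
      by blast
  qed
  moreover have "openin (star_conf n) {z \<in> topspace (star_conf n). swap_points z \<in> U}"
    by (rule openin_continuous_map_preimage[OF continuous_map_swap U])
  ultimately show ?thesis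
    using U sub by (auto simp: UConf_def openin_quotient_topology)
qed

text \<open>An open map has a continuous inverse wherever it is injective. This lifts short paths to
  ordered configurations and takes the place of covering space theory.\<close>

lemma uconf_section:
  assumes S: "openin (star_conf n) S" and inj: "inj_on (perm_orbit 2) S"
  obtains s where "continuous_map (subtopology (star_uconf n) (perm_orbit 2 ` S)) (star_conf n) s"
    "\<And>w. w \<in> perm_orbit 2 ` S \<Longrightarrow> s w \<in> S \<and> perm_orbit 2 (s w) = w"
proof -
  let ?q = "perm_orbit 2 :: _ \<Rightarrow> (nat \<Rightarrow> nat \<Rightarrow> real) set"
  have sub: "S \<subseteq> topspace (star_conf n)" using S by (rule openin_subset)
  have "continuous_map (subtopology (star_uconf n) (?q ` S)) (star_conf n) (inv_into S ?q)"
    unfolding continuous_map_def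
  proof (intro conjI allI impI funcsetI)
    fix w assume "w \<in> topspace (subtopology (star_uconf n) (?q ` S))"
    then show "inv_into S ?q w \<in> topspace (star_conf n)"
      using sub inv_into_into[of w ?q S] by auto
  next
    fix U assume "openin (star_conf n) U"
    with S have "openin (star_uconf n) (?q ` (U \<inter> S))"
      by (intro openin_perm_orbit_image openin_Int)
    moreover have "{w \<in> topspace (subtopology (star_uconf n) (?q ` S)). inv_into S ?q w \<in> U} = ?q ` (U \<inter> S)"
      using sub inj by (auto simp: topspace_star_uconf inv_into_f_f)
    ultimately show "openin (subtopology (star_uconf n) (?q ` S))
        {w \<in> topspace (subtopology (star_uconf n) (?q ` S)). inv_into S ?q w \<in> U}"
      using openin_open_subtopology[OF openin_perm_orbit_image[OF S]] by auto
  qed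
  moreover have "inv_into S ?q w \<in> S \<and> ?q (inv_into S ?q w) = w" if "w \<in> ?q ` S" for w
    using that by (simp add: inv_into_into f_inv_into_f)
  ultimately show thesis by (rule that)
qed

lemma inj_on_perm_orbit:
  assumes "S \<subseteq> topspace (star_conf n)" "\<And>z. z \<in> S \<Longrightarrow> swap_points z \<notin> S"
  shows "inj_on (perm_orbit 2) S"
  using assms perm_orbit_eqD star_conf_extensional by (intro inj_onI) blast

lemma star_conf_coords:
  assumes "z \<in> topspace (star_conf n)"
  shows "z 0 i \<le> height n (z 0)" "z 1 i \<le> height n (z 1)" "0 < z 0 i \<Longrightarrow> 0 < z 0 j \<Longrightarrow> i = j"
  using assms by (auto elim!: star_confE simp: leg_apply split: if_splits)

text \<open>Exchanging the points reverses the strict inequality that defines the first two kinds of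
  sets; for \<open>apart\<close> it would put one point on two different legs off the
  vertex.\<close>

lemma inj_on_cover:
  "inj_on (perm_orbit 2) (first_outer n i)" "inj_on (perm_orbit 2) (second_outer n j)"
  "i \<noteq> j \<Longrightarrow> inj_on (perm_orbit 2) (apart n i j)"
proof -
  have "swap_points z \<notin> first_outer n i" if "z \<in> first_outer n i" for z
    using that star_conf_coords[of z n i] by (force simp: first_outer_def swap_points_def)
  then show "inj_on (perm_orbit 2) (first_outer n i)"
    by (intro inj_on_perm_orbit[of _ n]) (auto simp: first_outer_def)
  have "swap_points z \<notin> second_outer n j" if "z \<in> second_outer n j" for z
    using that star_conf_coords[of z n j] by (force simp: second_outer_def swap_points_def)
  then show "inj_on (perm_orbit 2) (second_outer n j)"
    by (intro inj_on_perm_orbit[of _ n]) (auto simp: second_outer_def)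
  assume "i \<noteq> j"
  then have "swap_points z \<notin> apart n i j" if "z \<in> apart n i j" for z
    using that star_conf_coords(3)[of z n i j] by (auto simp: apart_def swap_points_def)
  then show "inj_on (perm_orbit 2) (apart n i j)"
    by (intro inj_on_perm_orbit[of _ n]) (auto simp: apart_def)
qed

section \<open>Surjectivity for unordered points\<close>

abbreviation orbit_chain where
  "orbit_chain \<equiv> qpush (simplex_map 1 (perm_orbit 2))"

definition uedge_simplex :: "nat \<times> nat \<Rightarrow> (nat \<Rightarrow> real) \<Rightarrow> (nat \<Rightarrow> nat \<Rightarrow> real) set" where
  "uedge_simplex e = path_simplex (\<lambda>t. perm_orbit 2 (edge_path (fst e) (snd e) t))"

lemma simplex_map_edge_simplex: "simplex_map 1 (perm_orbit 2) (edge_simplex e) = uedge_simplex e"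
  unfolding edge_simplex_def uedge_simplex_def simplex_map_path ..

lemma orbit_chain_path_chain: "orbit_chain (path_chain g) = path_chain (\<lambda>t. perm_orbit 2 (g t))"
  unfolding qpush_single simplex_map_path ..

abbreviation uedge_span where
  "uedge_span n \<equiv> chain_span (star_uconf n) uedge_simplex (off_diagonal n)"

lemma orbit_chain_edge_span:
  assumes "c \<in> edge_span n"
  shows "orbit_chain c \<in> uedge_span n"
proof -
  obtain b M where *: "b \<in> qboundaries 1 (star_conf n)" "keys M \<subseteq> off_diagonal n"
    "c = b + qpush edge_simplex M"
    using assms unfolding chain_span_def by blast
  have "orbit_chain c = orbit_chain b + qpush uedge_simplex M"
    unfolding *(3) qextend_simps qpush_qpush simplex_map_edge_simplex ..
  with * qpush_qboundaries[OF continuous_map_perm_orbit *(1)] show ?thesis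
    unfolding chain_span_def by blast
qed

lemma straight_swap:
  assumes "z \<in> extensional {..<2}" "c \<in> extensional {..<2}"
  shows "perm_orbit 2 (straight (swap_points c) (swap_points z) u) = perm_orbit 2 (straight c z u)"
proof -
  have "straight (swap_points c) (swap_points z) u = swap_points (straight c z u)"
    by (auto simp: straight_def swap_points_def two_points_def fun_eq_iff)
  then show ?thesis
    by (simp add: perm_orbit_swap straight_def)
qed

lemma orbit_straight_swap:
  assumes "z \<in> extensional {..<2}" "c \<in> extensional {..<2}"
  shows "orbit_chain (straight_chain (swap_points c) (swap_points z)) = orbit_chain (straight_chain c z)"
  unfolding orbit_chain_path_chain straight_swap[OF assms] ..

lemma potential_swap_first:
  assumes z: "z \<in> first_outer n i"
  shows "orbit_chain (potential n (swap_points z)) = orbit_chain (potential n z)"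
proof -
  have "z \<in> topspace (star_conf n)" using z by (simp add: first_outer_def)
  note ext = star_conf_extensional[OF this]
  have "swap_points z \<in> second_outer n i"
    using z swap_in_star_conf by (auto simp: first_outer_def second_outer_def swap_points_def)
  from potential_second[OF this] potential_first[OF z]
  show ?thesis
    using orbit_straight_swap[OF ext, of "first_vertex i"] by (simp del: qpush_single)
qed

text \<open>The formulas for unequal heights are mirror images of each other, so their orbit chains
  agree exactly. Only the convention for ties is asymmetric: the swapped route leads to the orbit of
  \<open>second_vertex j\<close> rather than that of \<open>first_vertex i\<close>, and these base
  points are joined by an edge.\<close>

lemma potential_swap:
  assumes z: "z \<in> topspace (star_conf n)"
  shows "orbit_chain (potential n (swap_points z)) - orbit_chain (potential n z) \<in> uedge_span n"
  using z
proof (cases rule: conf_point_cases)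
  case (first i)
  from potential_swap_first[OF this] show ?thesis
    by (simp add: qvec.subspace_0[OF subspace_chain_span])
next
  case (second j)
  have "swap_points z \<in> first_outer n j"
    using second swap_in_star_conf by (auto simp: first_outer_def second_outer_def swap_points_def)
  from potential_swap_first[OF this] show ?thesis
    by (simp add: qvec.subspace_0[OF subspace_chain_span] swap_swap[OF star_conf_extensional[OF z]])
next
  case (equal i j r)
  let ?c = "conf_point i 1 j 1"
  have ij: "i \<in> {1..n}" "j \<in> {1..n}" using equal by (auto simp: off_diagonal_def)
  have 1: "potential n z = straight_chain ?c z - straight_chain ?c (first_vertex i)"
    unfolding equal(4) by (rule potential_equal[OF ij equal(2)])
  \<comment> \<open>The base point for the swapped configuration is \<open>first_vertex j\<close>,
    written as a swap so that \<open>orbit_straight_swap\<close> applies.\<close>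
  have 2: "potential n (swap_points z) = straight_chain (swap_points ?c) (swap_points z)
      - straight_chain (swap_points ?c) (swap_points (second_vertex j))"
    unfolding equal(4) swap_two_points by (rule potential_equal[OF ij(2,1) equal(2)])
  have "orbit_chain (potential n (swap_points z)) - orbit_chain (potential n z)
      = orbit_chain (straight_chain ?c (first_vertex i) - straight_chain ?c (second_vertex j))"
    unfolding 1 2 qhom_qpush[THEN module_hom.diff]
      orbit_straight_swap[OF star_conf_extensional[OF z] two_points_extensional]
      orbit_straight_swap[OF two_points_extensional two_points_extensional]
    by (simp only: diff_diff_eq2 diff_add_eq diff_diff_eq add_diff_cancel) (simp only: algebra_simps)
  then show ?thesis
    using orbit_chain_edge_span[OF vertex_difference_in_edge_span[OF equal(1)]] by simp
qed

text \<open>The chosen representative matters, but only up to an element of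
  \<open>uedge_span n\<close>, which is all that the path argument requires.\<close>

definition upotential :: "nat \<Rightarrow> (nat \<Rightarrow> nat \<Rightarrow> real) set \<Rightarrow> ((nat \<Rightarrow> real) \<Rightarrow> (nat \<Rightarrow> nat \<Rightarrow> real) set) \<Rightarrow>\<^sub>0 rat" where
  "upotential n w = orbit_chain (potential n (SOME z. z \<in> topspace (star_conf n) \<and> perm_orbit 2 z = w))"

lemma upotential_orbit:
  assumes z: "z \<in> topspace (star_conf n)"
  shows "upotential n (perm_orbit 2 z) - orbit_chain (potential n z) \<in> uedge_span n"
proof -
  define z' where "z' = (SOME z'. z' \<in> topspace (star_conf n) \<and> perm_orbit 2 z' = perm_orbit 2 z)"
  have z': "z' \<in> topspace (star_conf n)" "perm_orbit 2 z' = perm_orbit 2 z"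
    using someI[of "\<lambda>z'. z' \<in> topspace (star_conf n) \<and> perm_orbit 2 z' = perm_orbit 2 z" z] z
    by (simp_all add: z'_def)
  then consider "z' = z" | "z' = swap_points z"
    using perm_orbit_eqD[OF star_conf_extensional[OF z] star_conf_extensional[OF z'(1)]] by blast
  then have "orbit_chain (potential n z') - orbit_chain (potential n z) \<in> uedge_span n"
    using potential_swap[OF z] qvec.subspace_0[OF subspace_chain_span] by cases simp_all
  then show ?thesis by (simp add: upotential_def z'_def)
qed

text \<open>Locally the path lifts to ordered configurations, where \<open>star_conf_path\<close>
  applies; pushing the result down again replaces the potential of the lift by
  \<open>upotential\<close> at both ends, modulo edges.\<close>

lemma star_uconf_path:
  assumes g: "pathin (star_uconf n) g"
  shows "path_chain g - (upotential n (g 0) - upotential n (g 1)) \<in> uedge_span n"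
proof (rule path_local_to_global[OF subspace_chain_span qboundaries_subset_chain_span _ g])
  have *: "\<exists>V. openin (star_uconf n) V \<and> perm_orbit 2 z \<in> V \<and> (\<forall>g. pathin (subtopology (star_uconf n) V) g \<longrightarrow>
      path_chain g - (upotential n (g 0) - upotential n (g 1)) \<in> uedge_span n)"
    if S: "openin (star_conf n) S" "z \<in> S" and inj: "inj_on (perm_orbit 2) S" for S z
  proof (intro exI[of _ "perm_orbit 2 ` S"] conjI allI impI imageI S openin_perm_orbit_image)
    fix g assume g: "pathin (subtopology (star_uconf n) (perm_orbit 2 ` S)) g"
    obtain s where s: "continuous_map (subtopology (star_uconf n) (perm_orbit 2 ` S)) (star_conf n) s"
      "\<And>w. w \<in> perm_orbit 2 ` S \<Longrightarrow> s w \<in> S \<and> perm_orbit 2 (s w) = w"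
      using uconf_section[OF S(1) inj] by blast
    have gS: "g t \<in> perm_orbit 2 ` S" if "t \<in> {0..1}" for t
      using g that unfolding pathin_def continuous_map_in_subtopology topspace_euclidean_subtopology
      by blast
    have path: "pathin (star_conf n) (s \<circ> g)"
      using g s(1) unfolding pathin_def by (rule continuous_map_compose)
    have top: "s (g t) \<in> topspace (star_conf n)" if "t \<in> {0..1}" for t
      using s(2)[OF gS[OF that]] openin_subset[OF S(1)] by blast
    have eq: "perm_orbit 2 (s (g t)) = g t" if "t \<in> {0..1}" for t
      using s(2)[OF gS[OF that]] by blast
    have 1: "orbit_chain (path_chain (s \<circ> g) - (potential n (s (g 0)) - potential n (s (g 1)))) \<in> uedge_span n"
      using orbit_chain_edge_span[OF star_conf_path[OF path]] unfolding comp_def .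
    have "path_simplex (\<lambda>t. perm_orbit 2 ((s \<circ> g) t)) = path_simplex g"
      using eq by (intro path_simplex_cong) simp
    then have 2: "orbit_chain (path_chain (s \<circ> g)) = path_chain g"
      unfolding orbit_chain_path_chain by simp
    have 3: "upotential n (g t) - orbit_chain (potential n (s (g t))) \<in> uedge_span n" if "t \<in> {0, 1}" for t
      using upotential_orbit[OF top, of t] eq[of t] that by auto
    from qvec.subspace_add[OF subspace_chain_span qvec.subspace_diff[OF subspace_chain_span 1 3[of 0]] 3[of 1]]
    show "path_chain g - (upotential n (g 0) - upotential n (g 1)) \<in> uedge_span n"
      unfolding qhom_qpush[THEN module_hom.diff] 2 by (simp add: algebra_simps)
  qed
  fix w assume "w \<in> topspace (star_uconf n)"
  then obtain z where z: "z \<in> topspace (star_conf n)" "w = perm_orbit 2 z"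
    unfolding topspace_star_uconf by blast
  from z(1) have "\<exists>V. openin (star_uconf n) V \<and> perm_orbit 2 z \<in> V \<and> (\<forall>g. pathin (subtopology (star_uconf n) V) g \<longrightarrow>
      path_chain g - (upotential n (g 0) - upotential n (g 1)) \<in> uedge_span n)"
  proof (cases rule: conf_point_cases)
    case (first i)
    show ?thesis by (rule *[OF openin_cover(1) first inj_on_cover(1)])
  next
    case (second j)
    show ?thesis by (rule *[OF openin_cover(2) second inj_on_cover(2)])
  next
    case (equal i j r)
    then have "i \<in> {1..n}" "j \<in> {1..n}" "i \<noteq> j" by (auto simp: off_diagonal_def)
    with equal z(1) have "z \<in> apart n i j"
      by (simp add: apart_def leg_apply)
    show ?thesis
      by (rule *[OF openin_cover(3) \<open>z \<in> apart n i j\<close> inj_on_cover(3)[OF \<open>i \<noteq> j\<close>]])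
  qed
  then show "\<exists>V. openin (star_uconf n) V \<and> w \<in> V \<and> (\<forall>g. pathin (subtopology (star_uconf n) V) g \<longrightarrow>
      path_chain g - (upotential n (g 0) - upotential n (g 1)) \<in> uedge_span n)"
    by (simp only: z(2))
qed

section \<open>Winding numbers for unordered points\<close>

definition uedge_winding :: "nat \<Rightarrow> nat \<Rightarrow> nat \<Rightarrow> (nat \<Rightarrow> nat \<Rightarrow> real) set \<Rightarrow> complex" where
  "uedge_winding n i j w =
    (let z = SOME z. z \<in> topspace (star_conf n) \<and> perm_orbit 2 z = w
     in edge_winding n i j z * cnj (edge_winding n j i z))"

text \<open>By this identity \<open>uedge_winding n i j\<close> is the product of
  \<open>edge_winding n i j\<close> over both points of an orbit, hence independent of the
  representative. The conjugate is also why its winding along the edge \<open>(j, i)\<close> is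
  -1.\<close>

lemma edge_winding_swap: "edge_winding n i j (swap_points z) = cnj (edge_winding n j i z)"
  by (auto simp: edge_winding_def Let_def swap_points_def complex_eq_iff min.commute algebra_simps)

lemma uedge_winding_orbit:
  assumes z: "z \<in> topspace (star_conf n)"
  shows "uedge_winding n i j (perm_orbit 2 z) = edge_winding n i j z * cnj (edge_winding n j i z)"
proof -
  define z' where "z' = (SOME z'. z' \<in> topspace (star_conf n) \<and> perm_orbit 2 z' = perm_orbit 2 z)"
  have z': "z' \<in> topspace (star_conf n)" "perm_orbit 2 z' = perm_orbit 2 z"
    using someI[of "\<lambda>z'. z' \<in> topspace (star_conf n) \<and> perm_orbit 2 z' = perm_orbit 2 z" z] z
    by (simp_all add: z'_def)
  then consider "z' = z" | "z' = swap_points z"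
    using perm_orbit_eqD[OF star_conf_extensional[OF z] star_conf_extensional[OF z'(1)]] by blast
  then have "edge_winding n i j z' * cnj (edge_winding n j i z') = edge_winding n i j z * cnj (edge_winding n j i z)"
    by cases (simp_all add: edge_winding_swap mult.commute)
  then show ?thesis by (simp add: uedge_winding_def z'_def Let_def)
qed

lemma continuous_map_uedge_winding:
  assumes "i \<noteq> j"
  shows "continuous_map (star_uconf n) (top_of_set (- {0})) (uedge_winding n i j)"
proof (rule continuous_compose_quotient_map[OF quotient_map_star_uconf])
  have f: "continuous_map (star_conf n) (top_of_set (- {0})) (edge_winding n i j)"
    "continuous_map (star_conf n) (top_of_set (- {0})) (edge_winding n j i)"
    using assms by (auto intro: continuous_map_edge_winding)
  have "continuous_map (prod_topology (top_of_set (- {0})) (top_of_set (- {0}))) (top_of_set (- {0}))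
      (\<lambda>p. fst p * cnj (snd p))"
    by (auto simp: prod_topology_subtopology subtopology_subtopology continuous_map_in_subtopology
        continuous_map_iff_continuous intro!: continuous_intros)
  from continuous_map_compose[OF continuous_map_pairedI[OF f] this]
  have "continuous_map (star_conf n) (top_of_set (- {0})) (\<lambda>z. edge_winding n i j z * cnj (edge_winding n j i z))"
    by (simp add: comp_def)
  then show "continuous_map (star_conf n) (top_of_set (- {0})) (uedge_winding n i j \<circ> perm_orbit 2)"
    by (rule continuous_map_eq) (simp add: uedge_winding_orbit)
qed

lemma edge_path_in_conf:
  assumes "(i, j) \<in> off_diagonal n" "t \<in> {0..1}"
  shows "edge_path i j t \<in> topspace (star_conf n)"
proof -
  have "i \<in> {1..n}" "j \<in> {1..n}" "i \<noteq> j" using assms(1) by (auto simp: off_diagonal_def)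
  from on_legs_subset[OF this] edge_path_on_legs[OF assms(2), of i j n] show ?thesis by blast
qed

lemma log_cochain_uedge:
  assumes ij: "(i, j) \<in> off_diagonal n" and d: "d \<in> off_diagonal n"
  shows "log_cochain (uedge_winding n i j) (single (uedge_simplex d) 1)
    = 2 * of_real pi * \<i> * ((if d = (i, j) then 1 else 0) - (if d = (j, i) then 1 else 0))"
proof -
  obtain k k' where dk: "d = (k, k')" by fastforce
  have kk: "(k, k') \<in> off_diagonal n" using d dk by simp
  have ji: "(j, i) \<in> off_diagonal n" using ij by (auto simp: off_diagonal_def)
  obtain l where l: "continuous_on {0..1} l"
    "\<And>t. t \<in> {0..1} \<Longrightarrow> edge_winding n i j (edge_path k k' t) = exp (l t)"
    "l 1 - l 0 = (if (k, k') = (i, j) then 2 * of_real pi * \<i> else 0)"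
    using edge_winding_log[OF ij kk] by blast
  obtain l' where l': "continuous_on {0..1} l'"
    "\<And>t. t \<in> {0..1} \<Longrightarrow> edge_winding n j i (edge_path k k' t) = exp (l' t)"
    "l' 1 - l' 0 = (if (k, k') = (j, i) then 2 * of_real pi * \<i> else 0)"
    using edge_winding_log[OF ji kk] by blast
  have "log_var (\<lambda>t. uedge_winding n i j (perm_orbit 2 (edge_path k k' t)))
      = (l 1 + cnj (l' 1)) - (l 0 + cnj (l' 0))"
  proof (rule log_var_eqI)
    show "continuous_on {0..1} (\<lambda>t. l t + cnj (l' t))"
      by (intro continuous_intros l(1) l'(1))
    fix t :: real assume t: "t \<in> {0..1}"
    show "uedge_winding n i j (perm_orbit 2 (edge_path k k' t)) = exp (l t + cnj (l' t))"
      unfolding uedge_winding_orbit[OF edge_path_in_conf[OF kk t]] l(2)[OF t] l'(2)[OF t]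
      by (simp add: exp_add exp_cnj)
  qed
  also have "\<dots> = (l 1 - l 0) + cnj (l' 1 - l' 0)"
    by simp
  also have "\<dots> = 2 * of_real pi * \<i> * ((if d = (i, j) then 1 else 0) - (if d = (j, i) then 1 else 0))"
    unfolding l(3) l'(3) dk
    by (cases "(k, k') = (i, j)"; cases "(k, k') = (j, i)") (simp_all del: prod.inject)
  finally show ?thesis
    by (simp add: uedge_simplex_def log_cochain_path_chain dk)
qed

text \<open>The cochain returns 2 pi i times the difference of the entries at \<open>(i, j)\<close>
  and \<open>(j, i)\<close>. Antisymmetry turns this into twice the entry at \<open>(i, j)\<close>;
  on symmetric matrices it would be zero.\<close>

lemma uedges_not_boundary:
  assumes M: "M \<in> antisymmetric_cycles n" and b: "qpush uedge_simplex M \<in> qboundaries 1 (star_uconf n)"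
  shows "M = 0"
proof (rule poly_mapping_eqI)
  fix e :: "nat \<times> nat"
  have keys: "keys M \<subseteq> off_diagonal n"
    using M by (simp add: antisymmetric_cycles_def cycle_space_def)
  show "lookup M e = lookup 0 e"
  proof (cases "e \<in> off_diagonal n")
    case True
    obtain i j where e: "e = (i, j)" by fastforce
    have ij: "(i, j) \<in> off_diagonal n" using True e by simp
    let ?m = "\<lambda>d. complex_of_rat (lookup M d)"
    have "log_cochain (uedge_winding n i j) (qpush uedge_simplex M)
        = (\<Sum>d\<in>keys M. ?m d * (2 * of_real pi * \<i> * ((if d = (i, j) then 1 else 0) - (if d = (j, i) then 1 else 0))))"
      unfolding log_cochain_qpush
    proof (rule sum.cong[OF refl])
      fix d assume "d \<in> keys M"
      with keys have "d \<in> off_diagonal n" by blast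
      from log_cochain_uedge[OF ij this]
      show "?m d * log_cochain (uedge_winding n i j) (single (uedge_simplex d) 1)
        = ?m d * (2 * of_real pi * \<i> * ((if d = (i, j) then 1 else 0) - (if d = (j, i) then 1 else 0)))"
        by (simp only:)
    qed
    also have "\<dots> = (\<Sum>d\<in>keys M. (if d = (i, j) then 2 * of_real pi * \<i> * ?m (i, j) else 0)
        - (if d = (j, i) then 2 * of_real pi * \<i> * ?m (j, i) else 0))"
    proof (rule sum.cong[OF refl])
      fix d
      show "?m d * (2 * of_real pi * \<i> * ((if d = (i, j) then 1 else 0) - (if d = (j, i) then 1 else 0)))
        = (if d = (i, j) then 2 * of_real pi * \<i> * ?m (i, j) else 0)
          - (if d = (j, i) then 2 * of_real pi * \<i> * ?m (j, i) else 0)"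
        by (cases "d = (i, j)"; cases "d = (j, i)") (simp_all del: prod.inject)
    qed
    also have "\<dots> = 2 * of_real pi * \<i> * ?m (i, j) - 2 * of_real pi * \<i> * ?m (j, i)"
      unfolding sum_subtractf by (simp add: in_keys_iff)
    also have "\<dots> = 4 * of_real pi * \<i> * ?m (i, j)"
      unfolding antisymmetric_cyclesD[OF M, of j i] by (simp add: of_rat_minus)
    finally show ?thesis
      using log_cochain_qboundaries[OF continuous_map_uedge_winding b, of i j] ij
      by (simp add: e off_diagonal_def)
  next
    case False
    then show ?thesis using keys by (auto simp: in_keys_iff)
  qed
qed

section \<open>Boundaries and reversal of unordered edges\<close>

lemma pathin_uedge:
  assumes "e \<in> off_diagonal n"
  shows "pathin (star_uconf n) (\<lambda>t. perm_orbit 2 (edge_path (fst e) (snd e) t))"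
proof -
  have "pathin (star_conf n) (edge_path (fst e) (snd e))"
    using assms by (intro pathin_edge_path) simp
  then show ?thesis
    using continuous_map_compose[OF _ continuous_map_perm_orbit] unfolding pathin_def comp_def by blast
qed

lemma orbit_vertex_eq_iff: "perm_orbit 2 (first_vertex i) = perm_orbit 2 (first_vertex j) \<longleftrightarrow> i = j"
proof
  assume "perm_orbit 2 (first_vertex i) = perm_orbit 2 (first_vertex j)"
  then have "first_vertex i = first_vertex j \<or> first_vertex i = second_vertex j"
    using perm_orbit_eqD[of "first_vertex j" "first_vertex i"] by simp
  then show "i = j" using vertex_eq_iff(1,3) by blast
qed simp

text \<open>Both kinds of vertex configurations have the same orbits, so the coefficient at the k-th
  one is a column sum minus a row sum. For antisymmetric \<open>M\<close> this is -2 times the row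
  sum.\<close>

lemma uedge_cycle_iff:
  assumes M: "keys M \<subseteq> off_diagonal n"
    and anti: "\<And>i j. lookup M (i, j) = - lookup M (j, i)"
  shows "qpush uedge_simplex M \<in> qcycles 1 (star_uconf n) \<longleftrightarrow> M \<in> cycle_space n"
proof -
  let ?a = "\<lambda>i. point_simplex (perm_orbit 2 (first_vertex i))"
  let ?row = "\<lambda>i. \<Sum>j\<in>{1..n}. lookup M (i, j)"
  let ?col = "\<lambda>j. \<Sum>i\<in>{1..n}. lookup M (i, j)"
  have uedge_abs: "uedge_simplex = (\<lambda>e. path_simplex (\<lambda>t. perm_orbit 2 (edge_path (fst e) (snd e) t)))"
    by (simp add: uedge_simplex_def fun_eq_iff)
  have chain: "qpush uedge_simplex M \<in> qchains 1 (star_uconf n)"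
    unfolding uedge_abs by (rule path_simplexes_in_qchains[OF pathin_uedge M])
  define D where "D = (\<Sum>j\<in>{1..n}. single (?a j) (?col j))
    - (\<Sum>i\<in>{1..n}. single (?a i) (?row i))"
  have D: "qboundary 1 (qpush uedge_simplex M) = D"
    unfolding uedge_abs D_def edge_boundary_expansion[OF M, symmetric]
    by (rule qboundary_edges)
      (simp_all only: edge_path_ends perm_orbit_two_points[of "\<lambda>_. 0"])
  have "?col k = - ?row k" for k
    unfolding sum_negf[symmetric] by (rule sum.cong[OF refl anti])
  note col = this
  have "lookup D (?a k) = - 2 * ?row k" if "k \<in> {1..n}" for k
    using that unfolding D_def col
    by (simp add: lookup_minus lookup_sum lookup_single when_def orbit_vertex_eq_iff)
  then have "D = 0 \<Longrightarrow> \<forall>k\<in>{1..n}. ?row k = 0"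
    by (metis (no_types, lifting) lookup_zero mult_eq_0_iff neg_equal_0_iff_equal zero_neq_numeral)
  moreover have "\<forall>k\<in>{1..n}. ?row k = 0 \<Longrightarrow> D = 0"
    unfolding D_def col by simp
  moreover have "M \<in> cycle_space n \<longleftrightarrow> (\<forall>k\<in>{1..n}. ?row k = 0)"
    unfolding cycle_space_def mem_Collect_eq col neg_equal_0_iff_equal using M by blast
  ultimately show ?thesis
    using chain unfolding qcycles_def mem_Collect_eq D by blast
qed

lemma uedge_reverse:
  assumes "e \<in> off_diagonal n"
  shows "single (uedge_simplex e) 1 + single (uedge_simplex (prod.swap e)) 1
    \<in> qboundaries 1 (star_uconf n)"
proof -
  have "perm_orbit 2 (edge_path (snd e) (fst e) t) = perm_orbit 2 (edge_path (fst e) (snd e) (1 - t))" for t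
    unfolding edge_path_def
    by (subst perm_orbit_two_points) (simp add: algebra_simps)
  then show ?thesis
    using path_reverse_in_qboundaries[OF pathin_uedge[OF assms]] by (simp add: uedge_simplex_def)
qed

definition antisymmetrize :: "(nat \<times> nat \<Rightarrow>\<^sub>0 rat) \<Rightarrow> (nat \<times> nat \<Rightarrow>\<^sub>0 rat)" where
  "antisymmetrize M = qscale (1/2) (M - qpush prod.swap M)"

lemma lookup_qpush_swap: "lookup (qpush prod.swap M) (i, j) = lookup M (j, i)"
  using lookup_qpush_inj[OF inj_swap, of M "(j, i)"] by simp

text \<open>By \<open>uedge_reverse\<close>, the sum of \<open>M\<close> and its transpose is sent
  to a boundary; half of that sum is \<open>M - antisymmetrize M\<close>.\<close>

lemma antisymmetrize_homologous:
  assumes M: "keys M \<subseteq> off_diagonal n"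
  shows "qpush uedge_simplex M - qpush uedge_simplex (antisymmetrize M) \<in> qboundaries 1 (star_uconf n)"
proof -
  have "qpush uedge_simplex M + qpush uedge_simplex (qpush prod.swap M) \<in> qboundaries 1 (star_uconf n)"
  proof (rule qhom_in_subspace[where f = "\<lambda>M. qpush uedge_simplex M + qpush uedge_simplex (qpush prod.swap M)",
        OF _ subspace_qboundaries])
    show "qhom (\<lambda>M. qpush uedge_simplex M + qpush uedge_simplex (qpush prod.swap M))"
      by (auto simp: module_hom_iff qvec.module_axioms qvec.scale_right_distrib)
    fix e assume "e \<in> keys M"
    then have "e \<in> off_diagonal n" using M by blast
    from uedge_reverse[OF this]
    show "qpush uedge_simplex (single e 1)
        + qpush uedge_simplex (qpush prod.swap (single e 1)) \<in> qboundaries 1 (star_uconf n)"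
      unfolding qpush_single .
  qed
  from qvec.subspace_scale[OF subspace_qboundaries this, of "1/2"]
  have "qscale (1/2) (qpush uedge_simplex M + qpush uedge_simplex (qpush prod.swap M)) \<in> qboundaries 1 (star_uconf n)" .
  moreover have "qscale (1/2) (c + d) = c - qscale (1/2) (c - d)"
    for c d :: "((nat \<Rightarrow> real) \<Rightarrow> (nat \<Rightarrow> nat \<Rightarrow> real) set) \<Rightarrow>\<^sub>0 rat"
    by (rule poly_mapping_eqI) (simp add: lookup_add lookup_minus field_simps)
  ultimately show ?thesis
    unfolding antisymmetrize_def by simp
qed

lemma UConf_map_orbit:
  fixes f :: "(nat \<Rightarrow> real) \<Rightarrow> nat \<Rightarrow> real"
  assumes "z \<in> topspace (star_conf n)"
  shows "UConf_map 2 f (perm_orbit 2 z) = perm_orbit 2 (Conf_map 2 f z)"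
proof -
  obtain x y where z: "z = two_points x y" using assms unfolding topspace_star_conf by blast
  show ?thesis
    unfolding z UConf_map_def perm_orbit_2[OF two_points_extensional] Conf_map_two_points swap_two_points
    by (simp add: Conf_map_two_points perm_orbit_2)
qed

theorem antisymmetric_cycles_iso_homology:
  "rep_iso (sym_group n) (pair_rep (antisymmetric_cycles n))
    (homology_rep 1 (star_uconf n) (\<lambda>\<sigma>. UConf_map 2 (star_map \<sigma>)))"
proof (rule homology_rep_iso[where s = uedge_simplex])
  show "representation (sym_group n)
      (pair_rep (antisymmetric_cycles n))"
    by (rule representation_permuted[OF subspace_antisymmetric_cycles permuted_antisymmetric])
  show "qvec.subspace (antisymmetric_cycles n)" by (rule subspace_antisymmetric_cycles)
  fix M assume M: "M \<in> antisymmetric_cycles n"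
  then have Z: "M \<in> cycle_space n" using antisymmetric_cycles_subset by blast
  then have keys: "keys M \<subseteq> off_diagonal n" by (simp add: cycle_space_def)
  show "qpush uedge_simplex M \<in> qcycles 1 (star_uconf n)"
    using uedge_cycle_iff[OF keys antisymmetric_cyclesD[OF M]] Z by blast
  show "M = 0" if "qpush uedge_simplex M \<in> qboundaries 1 (star_uconf n)"
    using uedges_not_boundary[OF M that] .
next
  fix c assume c: "c \<in> qcycles 1 (star_uconf n)"
  have "qcycles 1 (star_uconf n) \<subseteq> uedge_span n"
    by (rule qcycles_1_subset[OF subspace_chain_span star_uconf_path])
  with c obtain b M where bM: "b \<in> qboundaries 1 (star_uconf n)" "keys M \<subseteq> off_diagonal n"
    "c = b + qpush uedge_simplex M"
    unfolding chain_span_def by blast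
  define N where "N = antisymmetrize M"
  have lookup_N: "lookup N (i, j) = (lookup M (i, j) - lookup M (j, i)) / 2" for i j
    unfolding N_def antisymmetrize_def lookup_qscale lookup_minus lookup_qpush_swap by simp
  have keys_N: "keys N \<subseteq> off_diagonal n"
  proof
    fix e assume e: "e \<in> keys N"
    obtain i j where ij: "e = (i, j)" by fastforce
    have "(i, j) \<in> keys M \<or> (j, i) \<in> keys M"
      using e unfolding ij in_keys_iff lookup_N by auto
    then show "e \<in> off_diagonal n" using bM(2) by (auto simp: ij off_diagonal_def)
  qed
  have anti: "lookup N (i, j) = - lookup N (j, i)" for i j
    unfolding lookup_N by (simp add: field_simps)
  have "c - qpush uedge_simplex N = b + (qpush uedge_simplex M - qpush uedge_simplex N)"
    unfolding bM(3) by (rule add_diff_eq[symmetric])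
  then have diff: "c - qpush uedge_simplex N \<in> qboundaries 1 (star_uconf n)"
    using qvec.subspace_add[OF subspace_qboundaries bM(1) antisymmetrize_homologous[OF bM(2)]]
    by (simp only: N_def)
  have "c - (c - qpush uedge_simplex N) \<in> qcycles 1 (star_uconf n)"
    using c diff qboundaries_subset_qcycles by (blast intro: qvec.subspace_diff[OF subspace_qcycles])
  then have "N \<in> cycle_space n"
    using uedge_cycle_iff[OF keys_N anti] by simp
  then have "N \<in> antisymmetric_cycles n"
    using anti by (rule antisymmetric_cyclesI)
  with diff show "\<exists>M\<in>antisymmetric_cycles n. c - qpush uedge_simplex M \<in> qboundaries 1 (star_uconf n)"
    by blast
next
  fix \<sigma> assume "\<sigma> \<in> carrier (sym_group n)"
  then have \<sigma>: "\<sigma> permutes {1..n}" by (simp add: sym_group_carrier)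
  show "continuous_map (star_uconf n) (star_uconf n) (UConf_map 2 (star_map \<sigma>))"
  proof (rule continuous_compose_quotient_map[OF quotient_map_star_uconf])
    have "continuous_map (star_conf n) (star_uconf n) (perm_orbit 2 \<circ> Conf_map 2 (star_map \<sigma>))"
      by (rule continuous_map_compose[OF continuous_map_Conf_map[OF \<sigma>] continuous_map_perm_orbit])
    then show "continuous_map (star_conf n) (star_uconf n) (UConf_map 2 (star_map \<sigma>) \<circ> perm_orbit 2)"
      by (rule continuous_map_eq) (simp add: UConf_map_orbit)
  qed
  fix M e assume "M \<in> antisymmetric_cycles n" "e \<in> keys M"
  then have "e \<in> off_diagonal n"
    using antisymmetric_cycles_subset unfolding cycle_space_def by blast
  then have in_conf: "edge_path (fst e) (snd e) t \<in> topspace (star_conf n)" if "t \<in> {0..1}" for t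
    using that by (intro edge_path_in_conf) simp_all
  show "simplex_map 1 (UConf_map 2 (star_map \<sigma>)) (uedge_simplex e) = uedge_simplex (map_prod \<sigma> \<sigma> e)"
    unfolding uedge_simplex_def simplex_map_path
    by (rule path_simplex_cong)
      (simp add: UConf_map_orbit[OF in_conf] Conf_map_edge_path[OF permutes_bij[OF \<sigma>]])
qed

section \<open>Specht modules as spaces of cycles\<close>

definition row_sum :: "nat \<Rightarrow> (nat \<times> nat \<Rightarrow>\<^sub>0 rat) \<Rightarrow> nat \<Rightarrow> rat" where
  "row_sum n M k = (\<Sum>j\<in>{1..n}. lookup M (k, j))"

lemma row_sum_simps [simp]:
  "row_sum n (M + N) k = row_sum n M k + row_sum n N k"
  "row_sum n (M - N) k = row_sum n M k - row_sum n N k"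
  "row_sum n (- M) k = - row_sum n M k"
  "row_sum n (qscale q M) k = q * row_sum n M k"
  "row_sum n 0 k = 0"
  by (simp_all add: row_sum_def lookup_add lookup_minus sum.distrib sum_subtractf sum_negf sum_distrib_left)

lemma row_sum_single [simp]:
  "j \<in> {1..n} \<Longrightarrow> row_sum n (single (i, j) q) k = (if k = i then q else 0)"
  by (auto simp: row_sum_def lookup_single when_def)

text \<open>Transposition written as \<open>qpush prod.swap\<close> can be simplified by linearity.
  Since the transpose exchanges row and column sums up to sign, the rows suffice.\<close>

lemma antisymmetric_cycles_iff:
  "M \<in> antisymmetric_cycles n \<longleftrightarrow>
    keys M \<subseteq> off_diagonal n \<and> qpush prod.swap M = - M \<and> (\<forall>k\<in>{1..n}. row_sum n M k = 0)"
proof -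
  have swap: "qpush prod.swap M = - M \<longleftrightarrow> (\<forall>i j. lookup M (i, j) = - lookup M (j, i))"
    by (auto simp: poly_mapping_eq_iff fun_eq_iff lookup_qpush_swap)
  have "(\<Sum>i\<in>{1..n}. lookup M (i, j)) = 0 \<longleftrightarrow> row_sum n M j = 0"
    if *: "\<forall>i j. lookup M (i, j) = - lookup M (j, i)" for j
  proof -
    have "(\<Sum>i\<in>{1..n}. lookup M (i, j)) = (\<Sum>i\<in>{1..n}. - lookup M (j, i))"
      by (rule sum.cong[OF refl]) (rule *[rule_format])
    then show ?thesis by (simp add: row_sum_def sum_negf)
  qed
  then show ?thesis
    unfolding antisymmetric_cycles_def cycle_space_def mem_Collect_eq swap row_sum_def[symmetric] by blast
qed

definition symmetric_cycles :: "nat \<Rightarrow> (nat \<times> nat \<Rightarrow>\<^sub>0 rat) set" where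
  "symmetric_cycles n = {M. keys M \<subseteq> off_diagonal n \<and> qpush prod.swap M = M \<and>
    (\<forall>k\<in>{1..n}. row_sum n M k = 0)}"

lemma lookup_symmetric:
  assumes "M \<in> symmetric_cycles n"
  shows "lookup M (i, j) = lookup M (j, i)"
proof -
  have "qpush prod.swap M = M" using assms by (simp add: symmetric_cycles_def)
  then show ?thesis using lookup_qpush_swap[of M i j] by simp
qed

lemma symmetric_cycles_subset: "symmetric_cycles n \<subseteq> cycle_space n"
proof
  fix M assume M: "M \<in> symmetric_cycles n"
  have "(\<Sum>i\<in>{1..n}. lookup M (i, j)) = row_sum n M j" for j
    unfolding row_sum_def by (rule sum.cong[OF refl lookup_symmetric[OF M]])
  with M show "M \<in> cycle_space n"
    by (simp add: cycle_space_def symmetric_cycles_def row_sum_def)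
qed

lemma subspace_symmetric_cycles: "qvec.subspace (symmetric_cycles n)"
proof (rule qvec.subspaceI)
  fix M N assume "M \<in> symmetric_cycles n" "N \<in> symmetric_cycles n"
  then show "M + N \<in> symmetric_cycles n"
    using qvec.subspace_add[OF subspace_keys, of M "off_diagonal n" N] by (simp add: symmetric_cycles_def)
next
  fix q M assume "M \<in> symmetric_cycles n"
  then show "qscale q M \<in> symmetric_cycles n"
    using qvec.subspace_scale[OF subspace_keys, of M "off_diagonal n" q] by (simp add: symmetric_cycles_def)
qed (simp add: symmetric_cycles_def)

section \<open>Triangles and squares as generators\<close>

lemma single_in_keys:
  "e \<in> A \<Longrightarrow> single e q \<in> {c. keys c \<subseteq> A}"
  by simp

text \<open>The signed sum over the permutations of \<open>{a, b, c}\<close> of the images of the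
  entry \<open>(b, c)\<close>. The column stabilizer of a hook tableau with first column
  \<open>a\<close>, \<open>b\<close>, \<open>c\<close> produces the same sum.\<close>

definition triangle :: "nat \<Rightarrow> nat \<Rightarrow> nat \<Rightarrow> (nat \<times> nat \<Rightarrow>\<^sub>0 rat)" where
  "triangle a b c =
    single (b, c) 1 - single (c, b) 1
    + single (c, a) 1 - single (a, c) 1
    + single (a, b) 1 - single (b, a) 1"

text \<open>The symmetric matrix that \<open>two_row_tabloid\<close> sends to the tabloid with
  second row \<open>{i, j}\<close>. Both entries go to this one tabloid, so 1/2 gives it coefficient
  1.\<close>

definition edge_average :: "nat \<Rightarrow> nat \<Rightarrow> (nat \<times> nat \<Rightarrow>\<^sub>0 rat)" where
  "edge_average i j = single (i, j) (1/2) + single (j, i) (1/2)"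

text \<open>Here \<open>a\<close> above \<open>b\<close> and \<open>c\<close> above \<open>d\<close>
  are the first two columns of a tableau; the signs are those of the column exchanges.\<close>

definition square :: "nat \<Rightarrow> nat \<Rightarrow> nat \<Rightarrow> nat \<Rightarrow> (nat \<times> nat \<Rightarrow>\<^sub>0 rat)" where
  "square a b c d = edge_average b d - edge_average a d - edge_average b c + edge_average a c"

definition triangles :: "nat \<Rightarrow> (nat \<times> nat \<Rightarrow>\<^sub>0 rat) set" where
  "triangles n = {triangle a b c | a b c. {a, b, c} \<subseteq> {1..n} \<and> distinct [a, b, c]}"

definition squares :: "nat \<Rightarrow> (nat \<times> nat \<Rightarrow>\<^sub>0 rat) set" where
  "squares n = {square a b c d | a b c d. {a, b, c, d} \<subseteq> {1..n} \<and> distinct [a, b, c, d]}"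

lemma triangles_subset: "triangles n \<subseteq> antisymmetric_cycles n"
proof
  fix M assume "M \<in> triangles n"
  then obtain a b c where abc: "{a, b, c} \<subseteq> {1..n}" "distinct [a, b, c]" "M = triangle a b c"
    unfolding triangles_def by blast
  have "triangle a b c \<in> {M. keys M \<subseteq> off_diagonal n}"
    unfolding triangle_def using abc(1,2)
    by (intro qvec.subspace_add qvec.subspace_diff subspace_keys single_in_keys) (auto simp: off_diagonal_def)
  moreover have "qpush prod.swap (triangle a b c) = - triangle a b c"
    by (simp add: triangle_def)
  moreover have "row_sum n (triangle a b c) k = 0" for k
    using abc(1) by (simp add: triangle_def)
  ultimately show "M \<in> antisymmetric_cycles n"
    unfolding antisymmetric_cycles_iff abc(3) by blast
qed

lemma squares_subset: "squares n \<subseteq> symmetric_cycles n"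
proof
  fix M assume "M \<in> squares n"
  then obtain a b c d where abcd: "{a, b, c, d} \<subseteq> {1..n}" "distinct [a, b, c, d]" "M = square a b c d"
    unfolding squares_def by blast
  have "square a b c d \<in> {M. keys M \<subseteq> off_diagonal n}"
    unfolding square_def edge_average_def using abcd(1,2)
    by (intro qvec.subspace_add qvec.subspace_diff subspace_keys single_in_keys) (auto simp: off_diagonal_def)
  moreover have "qpush prod.swap (square a b c d) = square a b c d"
    by (simp add: square_def edge_average_def add.commute)
  moreover have "row_sum n (square a b c d) k = 0" for k
    using abcd(1) by (simp add: square_def edge_average_def)
  ultimately show "M \<in> symmetric_cycles n"
    unfolding symmetric_cycles_def abcd(3) by blast
qed

lemma lookup_off: "keys M \<subseteq> off_diagonal n \<Longrightarrow> (i, j) \<notin> off_diagonal n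
    \<Longrightarrow> lookup M (i, j) = 0"
  by (auto simp: in_keys_iff)

text \<open>Row sums recover the entries in column 1, and antisymmetry those in row 1, so the block
  with indices at least 2 determines everything.\<close>

lemma antisymmetric_cycle_eq_0:
  assumes M: "M \<in> antisymmetric_cycles n"
    and zero: "\<And>k l. k \<in> {2..n} \<Longrightarrow> l \<in> {2..n} \<Longrightarrow> lookup M (k, l) = 0"
  shows "M = 0"
proof (rule poly_mapping_eqI)
  have keys: "keys M \<subseteq> off_diagonal n" and rows: "\<And>k. k \<in> {1..n} \<Longrightarrow> row_sum n M k = 0"
    using M by (auto simp: antisymmetric_cycles_iff)
  have col1: "lookup M (k, 1) = 0" if k: "k \<in> {2..n}" for k
  proof -
    have "row_sum n M k = lookup M (k, 1) + (\<Sum>j\<in>{2..n}. lookup M (k, j))"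
      unfolding row_sum_def using k by (subst sum.atLeast_Suc_atMost) (auto simp: numeral_2_eq_2)
    then show ?thesis using rows[of k] zero[OF k] k by simp
  qed
  fix e :: "nat \<times> nat"
  obtain i j where e: "e = (i, j)" by fastforce
  have "lookup M (i, j) = 0" if "(i, j) \<in> off_diagonal n"
  proof -
    consider "i \<in> {2..n}" "j \<in> {2..n}" | "i \<in> {2..n}" "j = 1" | "j \<in> {2..n}" "i = 1"
      using \<open>(i, j) \<in> off_diagonal n\<close> unfolding off_diagonal_def by force
    then show ?thesis
      using zero col1 antisymmetric_cyclesD[OF M, of 1 j] by cases simp_all
  qed
  then show "lookup M e = lookup 0 e"
    using lookup_off[OF keys] by (auto simp: e)
qed

text \<open>The prescribed zeros, on unordered pairs off the diagonal, number n(n-3)/2, the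
  dimension of this space. Rows k \<ge> 4 yield the entries \<open>(2, k)\<close>, which leaves only
  the entries among 1, 2, 3.\<close>

lemma symmetric_cycle_eq_0:
  assumes M: "M \<in> symmetric_cycles n" and n: "n \<ge> 3"
    and zero: "\<And>k l. k \<in> {3..n} \<Longrightarrow> l \<in> {3..n} \<Longrightarrow> lookup M (k, l) = 0"
    and zero1: "\<And>l. l \<in> {4..n} \<Longrightarrow> lookup M (1, l) = 0"
  shows "M = 0"
proof (rule poly_mapping_eqI)
  let ?f = "\<lambda>i j. lookup M (i, j)"
  have keys: "keys M \<subseteq> off_diagonal n"
    using M by (auto simp: symmetric_cycles_def)
  note sym = lookup_symmetric[OF M]
  have diag: "?f i i = 0" for i
    by (rule lookup_off[OF keys]) (simp add: off_diagonal_def)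
  have rows: "?f k 1 + ?f k 2 + ?f k 3 + (\<Sum>j\<in>{4..n}. ?f k j) = 0" if k: "k \<in> {1..n}" for k
  proof -
    have "{1..n} = insert 1 (insert 2 (insert 3 {4..n}))" using n by auto
    then have "row_sum n M k = ?f k 1 + (?f k 2 + (?f k 3 + (\<Sum>j\<in>{4..n}. ?f k j)))"
      unfolding row_sum_def by simp
    then show ?thesis using M k by (simp add: symmetric_cycles_def)
  qed
  have z2: "?f 2 k = 0" if k: "k \<in> {4..n}" for k
  proof -
    have "(\<Sum>j\<in>{4..n}. ?f k j) = 0"
      using zero[of k] k by (intro sum.neutral) auto
    then show ?thesis
      using rows[of k] zero[of k 3] zero1[OF k] sym[of 1 k] sym[of 2 k] k n by simp
  qed
  \<comment> \<open>Rows 1, 2 and 3 now say that the pairwise sums of three unknowns vanish, so the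
    unknowns do.\<close>
  have "?f 1 2 + ?f 1 3 = 0"
    using rows[of 1] zero1 diag[of 1] n by simp
  moreover have "?f 1 2 + ?f 2 3 = 0"
    using rows[of 2] z2 diag[of 2] sym[of 2 1] n by simp
  moreover have "?f 1 3 + ?f 2 3 = 0"
  proof -
    have "(\<Sum>j\<in>{4..n}. ?f 3 j) = 0"
      using zero[of 3] n by (intro sum.neutral) auto
    then show ?thesis
      using rows[of 3] diag[of 3] sym[of 3 1] sym[of 3 2] n by simp
  qed
  ultimately have z: "?f 1 2 = 0" "?f 1 3 = 0" "?f 2 3 = 0" by linarith+
  have up: "?f i j = 0" if "i < j" "(i, j) \<in> off_diagonal n" for i j
  proof -
    have "i \<in> {3..n} \<and> j \<in> {3..n} \<or> i = 1 \<and> j = 2 \<or> i \<in> {1, 2} \<and> j = 3 \<or> i \<in> {1, 2} \<and> j \<in> {4..n}"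
      using that unfolding off_diagonal_def by force
    then show ?thesis using zero zero1 z2 z by blast
  qed
  fix e :: "nat \<times> nat"
  obtain i j where e: "e = (i, j)" by fastforce
  consider "i < j" | "j < i" | "i = j" by linarith
  then have "?f i j = 0"
  proof cases
    case 1 then show ?thesis using up[of i j] lookup_off[OF keys] by blast
  next
    case 2 then show ?thesis using up[of j i] lookup_off[OF keys] sym[of i j] by metis
  qed (simp add: diag)
  then show "lookup M e = lookup 0 e" by (simp add: e)
qed

lemma double_sum_delta:
  assumes "finite A" "k \<in> A" "l \<in> A"
  shows "(\<Sum>i\<in>A. \<Sum>j\<in>A. f i j * (if i = k \<and> j = l then 1 else 0)) = (f k l :: rat)"
proof -
  have "(\<Sum>j\<in>A. f i j * (if i = k \<and> j = l then 1 else 0)) = (if i = k then f k l else 0)" for i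
    using assms by (cases "i = k") (simp_all add: if_distrib cong: if_cong)
  then show ?thesis using assms by simp
qed

lemma lookup_triangle:
  assumes "1 < i" "1 < j" "1 < k" "1 < l"
  shows "lookup (triangle 1 i j) (k, l)
    = (if i = k \<and> j = l then 1 else 0) - (if i = l \<and> j = k then 1 else 0)"
  using assms unfolding triangle_def lookup_add lookup_minus lookup_single when_def by simp

lemma lookup_edge_average:
  "lookup (edge_average i j) (k, l)
    = (if i = k \<and> j = l then 1/2 else 0) + (if i = l \<and> j = k then 1/2 else 0)"
  unfolding edge_average_def lookup_add lookup_single when_def by (simp add: conj_commute)

lemma lookup_square: "lookup (square a b c d) e
    = lookup (edge_average b d) e - lookup (edge_average a d) e
      - lookup (edge_average b c) e + lookup (edge_average a c) e"
  by (simp add: square_def lookup_add lookup_minus)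

lemma lookup_square_12:
  assumes "2 < i" "2 < j" "2 < k" "2 < l"
  shows "lookup (square 1 i 2 j) (k, l)
    = (if i = k \<and> j = l then 1/2 else 0) + (if i = l \<and> j = k then 1/2 else 0)"
proof -
  have "1 \<noteq> k" "1 \<noteq> l" "2 \<noteq> k" "2 \<noteq> l" using assms by auto
  then show ?thesis unfolding lookup_square lookup_edge_average by simp
qed

lemma lookup_square_21:
  "2 < k \<Longrightarrow> 2 < l \<Longrightarrow> lookup (square 2 1 3 i) (k, l) = 0"
  "3 < i \<Longrightarrow> 3 < l \<Longrightarrow> lookup (square 2 1 3 i) (1, l) = (if i = l then 1/2 else 0)"
proof -
  show "lookup (square 2 1 3 i) (k, l) = 0" if "2 < k" "2 < l"
  proof -
    have "1 \<noteq> k" "1 \<noteq> l" "2 \<noteq> k" "2 \<noteq> l" using that by auto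
    then show ?thesis unfolding lookup_square lookup_edge_average by simp
  qed
  show "lookup (square 2 1 3 i) (1, l) = (if i = l then 1/2 else 0)" if "3 < i" "3 < l"
  proof -
    have "1 \<noteq> i" "3 \<noteq> l" "1 \<noteq> l" "2 \<noteq> l" using that by auto
    then show ?thesis unfolding lookup_square lookup_edge_average by simp
  qed
qed

text \<open>A cone from vertex 1: among indices at least 2, \<open>triangle 1 i j\<close> has
  entries only at \<open>(i, j)\<close> and \<open>(j, i)\<close>, so weighting these triangles by
  the entries of \<open>M\<close> reproduces the block that determines \<open>M\<close>.\<close>

lemma antisymmetric_cycles_span:
  "antisymmetric_cycles n = qspan (triangles n)"
proof (intro equalityI subsetI)
  fix M assume "M \<in> qspan (triangles n)"
  then show "M \<in> antisymmetric_cycles n"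
    using qvec.span_minimal[OF triangles_subset subspace_antisymmetric_cycles] by blast
next
  fix M assume M: "M \<in> antisymmetric_cycles n"
  let ?f = "\<lambda>i j. lookup M (i, j)"
  define N where "N = (\<Sum>i\<in>{2..n}. \<Sum>j\<in>{2..n}. qscale (?f i j) (triangle 1 i j))"
  have N: "N \<in> qspan (triangles n)"
    unfolding N_def
  proof (intro qvec.span_sum)
    fix i j assume ij: "i \<in> {2..n}" "j \<in> {2..n}"
    show "qscale (?f i j) (triangle 1 i j) \<in> qspan (triangles n)"
    proof (cases "i = j")
      case True
      then have "triangle 1 i j = 0" by (simp add: triangle_def)
      then show ?thesis by (simp add: qvec.span_zero)
    next
      case False
      with ij show ?thesis
        by (intro qvec.span_scale qvec.span_base) (force simp: triangles_def)
    qed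
  qed
  \<comment> \<open>The ordered pairs \<open>(i, j)\<close> and \<open>(j, i)\<close> contribute the
    same term to \<open>N\<close>, hence the factor.\<close>
  have "qscale (1/2) N - M = 0"
  proof (rule antisymmetric_cycle_eq_0)
    have "N \<in> antisymmetric_cycles n"
      using N qvec.span_minimal[OF triangles_subset subspace_antisymmetric_cycles] by blast
    then show "qscale (1/2) N - M \<in> antisymmetric_cycles n"
      by (intro qvec.subspace_diff qvec.subspace_scale subspace_antisymmetric_cycles M)
    fix k l assume kl: "k \<in> {2..n}" "l \<in> {2..n}"
    have "lookup N (k, l)
        = (\<Sum>i\<in>{2..n}. \<Sum>j\<in>{2..n}. ?f i j * (if i = k \<and> j = l then 1 else 0) - ?f i j * (if i = l \<and> j = k then 1 else 0))"
      unfolding N_def lookup_sum lookup_qscale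
      using kl by (intro sum.cong refl, subst lookup_triangle) (simp_all only: right_diff_distrib, simp_all)
    also have "\<dots> = ?f k l - ?f l k"
      unfolding sum_subtractf using kl by (simp add: double_sum_delta)
    finally show "lookup (qscale (1/2) N - M) (k, l) = 0"
      using antisymmetric_cyclesD[OF M, of l k] by (simp add: lookup_minus)
  qed
  then show "M \<in> qspan (triangles n)"
    using qvec.span_scale[OF N, of "1/2"] by simp
qed

text \<open>Elimination in two rounds, following \<open>symmetric_cycle_eq_0\<close>: the squares
  \<open>square 1 i 2 j\<close> clear the block with indices at least 3; the squares
  \<open>square 2 1 3 k\<close> vanish on that block and clear the rest of row 1.\<close>

lemma symmetric_cycles_span:
  assumes n: "n \<ge> 4"
  shows "symmetric_cycles n = qspan (squares n)"
proof (intro equalityI subsetI)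
  have span_sub: "qspan (squares n) \<subseteq> symmetric_cycles n"
    by (rule qvec.span_minimal[OF squares_subset subspace_symmetric_cycles])
  then show "M \<in> symmetric_cycles n" if "M \<in> qspan (squares n)" for M
    using that by blast
  fix M assume M: "M \<in> symmetric_cycles n"
  let ?f = "\<lambda>i j. lookup M (i, j)"
  have diag: "?f i i = 0" for i
    using M by (intro lookup_off[of M n]) (auto simp: symmetric_cycles_def off_diagonal_def)
  \<comment> \<open>Each unordered pair occurs twice, which makes up for the entries 1/2 of
    \<open>edge_average\<close>.\<close>
  define N where "N = (\<Sum>i\<in>{3..n}. \<Sum>j\<in>{3..n}. qscale (?f i j) (square 1 i 2 j))"
  have N: "N \<in> qspan (squares n)"
    unfolding N_def
  proof (intro qvec.span_sum)
    fix i j assume ij: "i \<in> {3..n}" "j \<in> {3..n}"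
    show "qscale (?f i j) (square 1 i 2 j) \<in> qspan (squares n)"
    proof (cases "i = j")
      case True
      then show ?thesis by (simp add: diag qvec.span_zero)
    next
      case False
      with ij show ?thesis
        by (intro qvec.span_scale qvec.span_base) (force simp: squares_def)
    qed
  qed
  define R where "R = M - N"
  have R: "R \<in> symmetric_cycles n"
    unfolding R_def using M N span_sub by (blast intro: qvec.subspace_diff[OF subspace_symmetric_cycles])
  have R0: "lookup R (k, l) = 0" if kl: "k \<in> {3..n}" "l \<in> {3..n}" for k l
  proof -
    have "lookup N (k, l) = (\<Sum>i\<in>{3..n}. \<Sum>j\<in>{3..n}.
        (?f i j / 2) * (if i = k \<and> j = l then 1 else 0) + (?f i j / 2) * (if i = l \<and> j = k then 1 else 0))"
      unfolding N_def lookup_sum lookup_qscale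
    proof (intro sum.cong refl)
      fix i j assume "i \<in> {3..n}" "j \<in> {3..n}"
      with kl have "2 < i" "2 < j" "2 < k" "2 < l" by auto
      note lookup = lookup_square_12[OF this]
      have half: "x * (if c then 1/2 else 0) = (x / 2) * (if c then 1 else 0)" for x :: rat and c
        by simp
      show "?f i j * lookup (square 1 i 2 j) (k, l)
        = (?f i j / 2) * (if i = k \<and> j = l then 1 else 0) + (?f i j / 2) * (if i = l \<and> j = k then 1 else 0)"
        unfolding lookup distrib_left half ..
    qed
    also have "\<dots> = ?f k l / 2 + ?f l k / 2"
      unfolding sum.distrib using kl by (simp only: double_sum_delta[OF finite_atLeastAtMost])
    finally show ?thesis
      using lookup_symmetric[OF M, of l k] by (simp add: R_def lookup_minus)
  qed
  \<comment> \<open>Here each pair \<open>(1, k)\<close> occurs once, so the entry 1/2 is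
    compensated by the factor 2.\<close>
  define N' where "N' = (\<Sum>k\<in>{4..n}. qscale (2 * lookup R (1, k)) (square 2 1 3 k))"
  have N': "N' \<in> qspan (squares n)"
    unfolding N'_def using n
    by (intro qvec.span_sum qvec.span_scale qvec.span_base) (force simp: squares_def)
  have "R - N' = 0"
  proof (rule symmetric_cycle_eq_0)
    show "R - N' \<in> symmetric_cycles n"
      using R N' span_sub by (blast intro: qvec.subspace_diff[OF subspace_symmetric_cycles])
    fix k l assume kl: "k \<in> {3..n}" "l \<in> {3..n}"
    then have "lookup N' (k, l) = 0"
      unfolding N'_def lookup_sum lookup_qscale
      by (intro sum.neutral ballI) (simp add: lookup_square_21(1)[unfolded One_nat_def])
    then show "lookup (R - N') (k, l) = 0"
      using R0[OF kl] by (simp add: lookup_minus)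
  next
    fix l assume l: "l \<in> {4..n}"
    have "lookup N' (1, l) = (\<Sum>k\<in>{4..n}. if k = l then lookup R (1, l) else 0)"
      unfolding N'_def lookup_sum lookup_qscale using l
      by (intro sum.cong refl) (simp add: lookup_square_21(2)[unfolded One_nat_def])
    then show "lookup (R - N') (1, l) = 0"
      using l by (simp add: lookup_minus)
  qed (use n in simp)
  then have "M = N' + N" by (simp add: R_def diff_eq_eq)
  then show "M \<in> qspan (squares n)"
    using qvec.span_add[OF N' N] by simp
qed

section \<open>Tabloids as ordered and unordered pairs, and their polytabloids\<close>

definition hook_tabloid :: "nat \<Rightarrow> nat \<times> nat \<Rightarrow> nat set list" where
  "hook_tabloid n e = [{1..n} - {fst e, snd e}, {fst e}, {snd e}]"

definition two_row_tabloid :: "nat \<Rightarrow> nat \<times> nat \<Rightarrow> nat set list" where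
  "two_row_tabloid n e = [{1..n} - {fst e, snd e}, {fst e, snd e}]"

text \<open>Completes entries prescribed in a few cells to a whole tableau.\<close>

lemma bij_betw_extend:
  assumes fin: "finite A" "finite B" "card A = card B" and f: "A' \<subseteq> A" "inj_on f A'" "f ` A' \<subseteq> B"
  obtains g where "bij_betw g A B" "\<And>x. x \<in> A' \<Longrightarrow> g x = f x"
proof -
  have "card (A - A') = card (B - f ` A')"
    using fin f by (simp add: card_Diff_subset finite_subset card_image)
  then obtain h where h: "bij_betw h (A - A') (B - f ` A')"
    using finite_same_card_bij[of "A - A'" "B - f ` A'"] fin by auto
  let ?g = "\<lambda>x. if x \<in> A' then f x else h x"
  have "bij_betw ?g A' (f ` A')"
    using f(2) by (auto simp: bij_betw_def inj_on_def)
  moreover have "bij_betw ?g (A - A') (B - f ` A')"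
    using h by (rule bij_betw_cong[THEN iffD1, rotated]) simp
  ultimately have "bij_betw ?g (A' \<union> (A - A')) (f ` A' \<union> (B - f ` A'))"
    by (rule bij_betw_combine) blast
  then have "bij_betw ?g A B"
    using f by (simp add: Un_absorb1)
  then show thesis by (rule that) simp
qed

lemma cells_hook: "cells [m, 1, 1] = {0} \<times> {..<m} \<union> {(1, 0), (2, 0)}"
  by (auto simp: cells_def less_Suc_eq numeral_2_eq_2)

lemma cells_two_row: "cells [m, 2] = {0} \<times> {..<m} \<union> {(1, 0), (1, 1)}"
  by (auto simp: cells_def less_Suc_eq numeral_2_eq_2)

lemmas cells_simps = cells_hook cells_hook[unfolded One_nat_def] cells_two_row cells_two_row[unfolded One_nat_def]

lemma tabloid_hook:
  assumes "tableau [m, 1, 1] t"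
  shows "tabloid [m, 1, 1] t = hook_tabloid (m + 2) (t (1, 0), t (2, 0))"
proof -
  have t: "bij_betw t (cells [m, 1, 1]) {1..m + 2}"
    using assms by (simp add: tableau_def)
  have "t ` ({0} \<times> {..<m}) = t ` (cells [m, 1, 1] - {(1, 0), (2, 0)})"
    unfolding cells_hook by (rule arg_cong[where f = "image t"]) auto
  also have "\<dots> = {1..m + 2} - {t (1, 0), t (2, 0)}"
    using t by (subst inj_on_image_set_diff[of t "cells [m, 1, 1]"]) (auto simp: bij_betw_def cells_simps)
  finally have "{t (0, j) | j. j < m} = {1..m + 2} - {t (1, 0), t (2, 0)}"
    by (auto simp: image_def)
  then show ?thesis
    by (simp add: tabloid_def hook_tabloid_def upt_rec numeral_2_eq_2)
qed

lemma tabloid_two_row: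
  assumes "tableau [m, 2] t"
  shows "tabloid [m, 2] t = two_row_tabloid (m + 2) (t (1, 0), t (1, 1))"
proof -
  have t: "bij_betw t (cells [m, 2]) {1..m + 2}"
    using assms by (simp add: tableau_def)
  have "t ` ({0} \<times> {..<m}) = t ` (cells [m, 2] - {(1, 0), (1, 1)})"
    unfolding cells_two_row by (rule arg_cong[where f = "image t"]) auto
  also have "\<dots> = {1..m + 2} - {t (1, 0), t (1, 1)}"
    using t by (subst inj_on_image_set_diff[of t "cells [m, 2]"]) (auto simp: bij_betw_def cells_simps)
  finally have "{t (0, j) | j. j < m} = {1..m + 2} - {t (1, 0), t (1, 1)}"
    by (auto simp: image_def)
  moreover have "{t (1, j) | j. j < 2} = {t (1, 0), t (1, 1)}"
    by (auto simp: less_2_cases_iff)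
  ultimately show ?thesis
    by (simp add: tabloid_def two_row_tabloid_def upt_rec)
qed

lemma tableau_permuted:
  assumes "tableau \<mu> t" "\<sigma> permutes {1..sum_list \<mu>}"
  shows "tableau \<mu> (\<sigma> \<circ> t)"
  using assms bij_betw_trans permutes_imp_bij unfolding tableau_def by blast

text \<open>Only the first column has more than one cell. Entries elsewhere must stay put, and the
  three entries of the first column may be permuted at will.\<close>

lemma column_stabilizer_hook:
  assumes t: "tableau [m, 1, 1] t" and m: "m > 0"
  shows "column_stabilizer [m, 1, 1] t = {\<sigma>. \<sigma> permutes {t (0, 0), t (1, 0), t (2, 0)}}"
proof -
  let ?S = "{t (0, 0), t (1, 0), t (2, 0)}" and ?C = "cells [m, 1, 1]"
  have bij: "bij_betw t ?C {1..m + 2}"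
    using t by (simp add: tableau_def)
  then have inj: "inj_on t ?C" and img: "t ` ?C = {1..m + 2}" by (auto simp: bij_betw_def)
  have col0: "(i, 0) \<in> ?C \<longleftrightarrow> i \<in> {0, 1, 2}" for i
    using m by (auto simp: cells_simps)
  have S: "?S \<subseteq> {1..m + 2}"
    using img col0 by blast
  have in_S: "t (i, j) \<in> ?S \<longleftrightarrow> j = 0" if "(i, j) \<in> ?C" for i j
  proof
    assume "t (i, j) \<in> ?S"
    then obtain i' where "i' \<in> {0, 1, 2}" "t (i, j) = t (i', 0)" by blast
    with inj that col0 show "j = 0" by (metis inj_onD prod.inject)
  next
    assume "j = 0"
    with that show "t (i, j) \<in> ?S" using col0[of i] by blast
  qed
  have row0: "i = 0" if "(i, j) \<in> ?C" "j \<noteq> 0" for i j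
    using that by (auto simp: cells_simps)
  show ?thesis
  proof (intro equalityI subsetI CollectI)
    fix \<sigma> assume "\<sigma> \<in> column_stabilizer [m, 1, 1] t"
    then have \<sigma>: "\<sigma> permutes {1..m + 2}"
      and st: "\<And>i j. (i, j) \<in> ?C \<Longrightarrow> \<exists>i'. (i', j) \<in> ?C \<and> \<sigma> (t (i, j)) = t (i', j)"
      by (auto simp: column_stabilizer_def)
    show "\<sigma> permutes ?S"
    proof (rule permutes_superset[OF \<sigma>])
      fix x assume x: "x \<in> {1..m + 2} - ?S"
      then obtain i j where ij: "(i, j) \<in> ?C" "x = t (i, j)"
        using img by (metis DiffD1 imageE surj_pair)
      then have "j \<noteq> 0" using in_S x by blast
      then show "\<sigma> x = x"
        using st[OF ij(1)] row0 ij by metis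
    qed
  next
    fix \<sigma> assume "\<sigma> \<in> {\<sigma>. \<sigma> permutes ?S}"
    then have \<sigma>: "\<sigma> permutes ?S" by simp
    have "\<exists>i'. (i', j) \<in> ?C \<and> \<sigma> (t (i, j)) = t (i', j)" if ij: "(i, j) \<in> ?C" for i j
    proof (cases "j = 0")
      case True
      then have "\<sigma> (t (i, j)) \<in> ?S"
        using in_S[OF ij] permutes_in_image[OF \<sigma>] by blast
      then show ?thesis using col0 True by blast
    next
      case False
      then have "\<sigma> (t (i, j)) = t (i, j)"
        using in_S[OF ij] permutes_not_in[OF \<sigma>] by blast
      with ij show ?thesis by blast
    qed
    then show "\<sigma> \<in> column_stabilizer [m, 1, 1] t"
      using permutes_subset[OF \<sigma> S] by (auto simp: column_stabilizer_def)
  qed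
qed

text \<open>A permutation of \<open>{a, b, c}\<close> is uniquely a permutation of
  \<open>{b, c}\<close> followed by a transposition of \<open>a\<close> with some element. The
  summand sees only the images of \<open>b\<close> and \<open>c\<close>, since a hook tabloid is
  determined by its two lower rows.\<close>

lemma sum_permutations_3:
  assumes "a \<noteq> b" "a \<noteq> c" "b \<noteq> c"
  shows "(\<Sum>\<sigma> | \<sigma> permutes {a, b, c}. f (sign \<sigma>) (\<sigma> b) (\<sigma> c))
    = f 1 b c + f (-1) c b + f (-1) a c + f 1 c a + f (-1) b a + f 1 a b"
proof -
  have perm: "{\<sigma>. \<sigma> permutes {b, c}} = {id, Transposition.transpose b c}"
    by (auto simp: permutes_doubleton_iff)
  have "id b \<noteq> Transposition.transpose b c b"
    using assms by simp
  then have neq: "id \<noteq> Transposition.transpose b c" by metis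
  have "sign (Transposition.transpose a x \<circ> Transposition.transpose b c)
      = sign (Transposition.transpose a x) * sign (Transposition.transpose b c)" for x
    by (intro sign_compose permutation_swap_id)
  note sign = this sign_swap_id
  have "(\<Sum>\<sigma> | \<sigma> permutes insert a {b, c}. f (sign \<sigma>) (\<sigma> b) (\<sigma> c))
    = (\<Sum>x\<in>{a, b, c}. \<Sum>\<tau>\<in>{id, Transposition.transpose b c}.
        f (sign (Transposition.transpose a x \<circ> \<tau>)) ((Transposition.transpose a x \<circ> \<tau>) b) ((Transposition.transpose a x \<circ> \<tau>) c))"
    using assms by (subst sum_over_permutations_insert) (auto simp: perm)
  also have "\<dots> = (\<Sum>x\<in>{a, b, c}. f (sign (Transposition.transpose a x)) (Transposition.transpose a x b) (Transposition.transpose a x c)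
      + f (- sign (Transposition.transpose a x)) (Transposition.transpose a x c) (Transposition.transpose a x b))"
    using neq assms by (simp add: sign)
  also have "\<dots> = f 1 b c + f (-1) c b + f (-1) a c + f 1 c a + f (-1) b a + f 1 a b"
    using assms by (simp add: sign_swap_id Transposition.transpose_def add.assoc)
  finally show ?thesis by simp
qed

lemma polytabloid_hook:
  assumes t: "tableau [m, 1, 1] t" and m: "m > 0"
  shows "polytabloid [m, 1, 1] t = qpush (hook_tabloid (m + 2)) (triangle (t (0, 0)) (t (1, 0)) (t (2, 0)))"
proof -
  let ?T = "hook_tabloid (m + 2)"
  have inj: "inj_on t (cells [m, 1, 1])"
    using t by (auto simp: tableau_def bij_betw_def)
  have neq: "t (0, 0) \<noteq> t (1, 0)" "t (0, 0) \<noteq> t (2, 0)" "t (1, 0) \<noteq> t (2, 0)"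
    using inj m by (auto simp: inj_on_def cells_simps)
  have "tabloid [m, 1, 1] (\<sigma> \<circ> t) = ?T (\<sigma> (t (1, 0)), \<sigma> (t (2, 0)))"
    if "\<sigma> \<in> column_stabilizer [m, 1, 1] t" for \<sigma>
    using tabloid_hook[OF tableau_permuted[OF t]] that by (simp add: column_stabilizer_def)
  then have "polytabloid [m, 1, 1] t = (\<Sum>\<sigma>\<in>column_stabilizer [m, 1, 1] t.
      single (?T (\<sigma> (t (1, 0)), \<sigma> (t (2, 0)))) (of_int (sign \<sigma>)))"
    unfolding polytabloid_def by (intro sum.cong refl) simp
  also have "\<dots> = qpush ?T (triangle (t (0, 0)) (t (1, 0)) (t (2, 0)))"
    unfolding column_stabilizer_hook[OF t m]
      sum_permutations_3[OF neq, where f = "\<lambda>s x y. single (?T (x, y)) (of_int s)"]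
    by (simp add: triangle_def single_uminus algebra_simps)
  finally show ?thesis .
qed

lemma card_cells: "card (cells [m, 1, 1]) = m + 2" "card (cells [m, 2]) = m + 2"
  "finite (cells [m, 1, 1])" "finite (cells [m, 2])"
proof -
  show "card (cells [m, 1, 1]) = m + 2" "card (cells [m, 2]) = m + 2"
    unfolding cells_hook cells_two_row by (subst card_Un_disjoint; auto)+
qed (simp_all add: cells_simps)

lemma polytabloids_hook:
  assumes "m > 0"
  shows "{polytabloid [m, 1, 1] t | t. tableau [m, 1, 1] t} = qpush (hook_tabloid (m + 2)) ` triangles (m + 2)"
proof (intro equalityI subsetI)
  fix x assume "x \<in> {polytabloid [m, 1, 1] t | t. tableau [m, 1, 1] t}"
  then obtain t where t: "tableau [m, 1, 1] t" "x = polytabloid [m, 1, 1] t" by blast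
  then have inj: "inj_on t (cells [m, 1, 1])" and img: "t ` cells [m, 1, 1] = {1..m + 2}"
    by (auto simp: tableau_def bij_betw_def)
  have "{t (0, 0), t (1, 0), t (2, 0)} \<subseteq> {1..m + 2}"
    unfolding img[symmetric] using assms by (auto simp: cells_simps)
  moreover have "distinct [t (0, 0), t (1, 0), t (2, 0)]"
    using inj assms by (auto simp: inj_on_def cells_simps)
  ultimately have "triangle (t (0, 0)) (t (1, 0)) (t (2, 0)) \<in> triangles (m + 2)"
    unfolding triangles_def by blast
  then show "x \<in> qpush (hook_tabloid (m + 2)) ` triangles (m + 2)"
    unfolding t(2) polytabloid_hook[OF t(1) assms] by (rule imageI)
next
  fix x assume "x \<in> qpush (hook_tabloid (m + 2)) ` triangles (m + 2)"
  then obtain a b c where abc: "{a, b, c} \<subseteq> {1..m + 2}" "distinct [a, b, c]"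
    and x: "x = qpush (hook_tabloid (m + 2)) (triangle a b c)"
    unfolding triangles_def by blast
  define f where "f p = (if p = (0, 0) then a else if p = (1, 0) then b else c)" for p :: "nat \<times> nat"
  obtain t where t: "bij_betw t (cells [m, 1, 1]) {1..m + 2}"
    "\<And>p. p \<in> {(0, 0), (1, 0), (2, 0)} \<Longrightarrow> t p = f p"
  proof (rule bij_betw_extend[of "cells [m, 1, 1]" "{1..m + 2}" "{(0, 0), (1, 0), (2, 0)}" f])
    show "{(0, 0), (1, 0), (2, 0)} \<subseteq> cells [m, 1, 1]"
      using assms by (auto simp: cells_simps)
    show "inj_on f {(0, 0), (1, 0), (2, 0)}" "f ` {(0, 0), (1, 0), (2, 0)} \<subseteq> {1..m + 2}"
      using abc by (auto simp: f_def inj_on_def)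
  qed (use card_cells in auto)
  have tab: "tableau [m, 1, 1] t" using t(1) by (simp add: tableau_def)
  have "t (0, 0) = a" "t (1, 0) = b" "t (2, 0) = c"
    using t(2) by (auto simp: f_def)
  then have "x = polytabloid [m, 1, 1] t"
    unfolding x polytabloid_hook[OF tab assms] by simp
  with tab show "x \<in> {polytabloid [m, 1, 1] t | t. tableau [m, 1, 1] t}" by blast
qed

text \<open>Exactly two columns have two cells, and the entries of each may be exchanged
  independently; this gives a Klein four-group.\<close>

lemma column_stabilizer_two_row:
  assumes t: "tableau [m, 2] t" and m: "m > 1"
    and abcd: "a = t (0, 0)" "b = t (1, 0)" "c = t (0, 1)" "d = t (1, 1)"
  shows "column_stabilizer [m, 2] t = {id, Transposition.transpose a b, Transposition.transpose c d,
    Transposition.transpose a b \<circ> Transposition.transpose c d}"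
proof -
  let ?C = "cells [m, 2]" and ?S = "{a, b, c, d}"
  have bij: "bij_betw t ?C {1..m + 2}"
    using t by (simp add: tableau_def)
  then have inj: "inj_on t ?C" and img: "t ` ?C = {1..m + 2}" by (auto simp: bij_betw_def)
  have C: "(0, 0) \<in> ?C" "(1, 0) \<in> ?C" "(0, 1) \<in> ?C" "(1, 1) \<in> ?C"
    using m by (auto simp: cells_simps)
  have rows: "i = 0 \<or> i = 1" if "(i, j) \<in> ?C" for i j
    using that by (auto simp: cells_simps)
  have dist: "distinct [a, b, c, d]"
    unfolding abcd using inj C by (auto simp: inj_on_def)
  have S: "?S \<subseteq> {1..m + 2}"
    unfolding img[symmetric] abcd using C by blast
  have rest: "i = 0 \<and> t (i, j) \<notin> ?S" if "(i, j) \<in> ?C" "j \<noteq> 0" "j \<noteq> 1" for i j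
  proof
    show "i = 0" using that by (auto simp: cells_simps)
    show "t (i, j) \<notin> ?S"
      unfolding abcd using inj C that by (auto simp: inj_on_def)
  qed
  show ?thesis
  proof (intro equalityI subsetI)
    fix \<sigma> assume "\<sigma> \<in> column_stabilizer [m, 2] t"
    then have \<sigma>: "\<sigma> permutes {1..m + 2}"
      and st: "\<And>i j. (i, j) \<in> ?C \<Longrightarrow> \<exists>i'. (i', j) \<in> ?C \<and> \<sigma> (t (i, j)) = t (i', j)"
      by (auto simp: column_stabilizer_def)
    have col: "\<sigma> (t (i, j)) = t (0, j) \<or> \<sigma> (t (i, j)) = t (1, j)" if "(i, j) \<in> ?C" for i j
      using st[OF that] rows by metis
    have "\<sigma> a = a \<or> \<sigma> a = b" "\<sigma> b = a \<or> \<sigma> b = b" "\<sigma> c = c \<or> \<sigma> c = d" "\<sigma> d = c \<or> \<sigma> d = d"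
      unfolding abcd by (rule col C)+
    moreover have "\<sigma> a \<noteq> \<sigma> b" "\<sigma> c \<noteq> \<sigma> d"
      using dist permutes_inj[OF \<sigma>] by (auto simp: inj_eq)
    ultimately have cases: "\<sigma> a = a \<and> \<sigma> b = b \<or> \<sigma> a = b \<and> \<sigma> b = a" "\<sigma> c = c \<and> \<sigma> d = d \<or> \<sigma> c = d \<and> \<sigma> d = c"
      by metis+
    have fix_rest: "\<sigma> x = x" if "x \<notin> ?S" for x
    proof (cases "x \<in> {1..m + 2}")
      case True
      then obtain i j where ij: "(i, j) \<in> ?C" "x = t (i, j)"
        using img by (metis imageE surj_pair)
      have "\<not> (j = 0 \<or> j = 1)"
      proof
        assume "j = 0 \<or> j = 1"
        with rows[OF ij(1)] have "x \<in> ?S" unfolding abcd ij(2) by auto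
        with \<open>x \<notin> ?S\<close> show False by blast
      qed
      then have "j \<noteq> 0" "j \<noteq> 1" by simp_all
      then show ?thesis
        using st[OF ij(1)] rest ij by metis
    next
      case False then show ?thesis by (rule permutes_not_in[OF \<sigma>])
    qed
    have eqI: "\<sigma> = \<tau>" if "\<tau> a = \<sigma> a" "\<tau> b = \<sigma> b" "\<tau> c = \<sigma> c" "\<tau> d = \<sigma> d" "\<And>x. x \<notin> ?S \<Longrightarrow> \<tau> x = x" for \<tau>
      using that fix_rest by (metis empty_iff ext insert_iff)
    from cases show "\<sigma> \<in> {id, Transposition.transpose a b, Transposition.transpose c d,
        Transposition.transpose a b \<circ> Transposition.transpose c d}"
    proof (elim disjE conjE, goal_cases)
      case 1 then have "\<sigma> = id" by (intro eqI) auto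
      then show ?case by blast
    next
      case 2 then have "\<sigma> = Transposition.transpose c d"
        using dist by (intro eqI) (auto simp: Transposition.transpose_def)
      then show ?case by blast
    next
      case 3 then have "\<sigma> = Transposition.transpose a b"
        using dist by (intro eqI) (auto simp: Transposition.transpose_def)
      then show ?case by blast
    next
      case 4 then have "\<sigma> = Transposition.transpose a b \<circ> Transposition.transpose c d"
        using dist by (intro eqI) (auto simp: Transposition.transpose_def)
      then show ?case by blast
    qed
  next
    fix \<sigma> assume "\<sigma> \<in> {id, Transposition.transpose a b, Transposition.transpose c d,
        Transposition.transpose a b \<circ> Transposition.transpose c d}"
    then have "\<sigma> permutes ?S" and ab: "\<sigma> a \<in> {a, b}" "\<sigma> b \<in> {a, b}" and cd: "\<sigma> c \<in> {c, d}" "\<sigma> d \<in> {c, d}"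
      using dist by (auto intro!: permutes_swap_id permutes_compose permutes_id simp: Transposition.transpose_def)
    note \<sigma> = permutes_subset[OF this(1) S]
    have "\<exists>i'. (i', j) \<in> ?C \<and> \<sigma> (t (i, j)) = t (i', j)" if ij: "(i, j) \<in> ?C" for i j
    proof -
      consider "j = 0" | "j = 1" | "j \<noteq> 0" "j \<noteq> 1" by blast
      then show ?thesis
      proof cases
        case 1
        with rows[OF ij] ab have "\<sigma> (t (i, j)) = t (0, 0) \<or> \<sigma> (t (i, j)) = t (1, 0)"
          unfolding abcd by auto
        then show ?thesis using C 1 by blast
      next
        case 2
        with rows[OF ij] cd have "\<sigma> (t (i, j)) = t (0, 1) \<or> \<sigma> (t (i, j)) = t (1, 1)"
          unfolding abcd by auto
        then show ?thesis using C 2 by blast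
      next
        case 3
        then have "\<sigma> (t (i, j)) = t (i, j)"
          using rest[OF ij] permutes_not_in[OF \<open>\<sigma> permutes ?S\<close>] by blast
        with ij show ?thesis by blast
      qed
    qed
    then show "\<sigma> \<in> column_stabilizer [m, 2] t"
      using \<sigma> by (auto simp: column_stabilizer_def)
  qed
qed

lemma two_row_tabloid_swap: "two_row_tabloid n (j, i) = two_row_tabloid n (i, j)"
  by (simp add: two_row_tabloid_def insert_commute)

lemma qpush_edge_average:
  "qpush (two_row_tabloid n) (edge_average i j) = single (two_row_tabloid n (i, j)) 1"
  by (simp add: edge_average_def two_row_tabloid_swap[of n j i] flip: single_add)

lemma polytabloid_two_row:
  assumes t: "tableau [m, 2] t" and m: "m > 1"
  shows "polytabloid [m, 2] t
    = qpush (two_row_tabloid (m + 2)) (square (t (0, 0)) (t (1, 0)) (t (0, 1)) (t (1, 1)))"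
proof -
  let ?T = "two_row_tabloid (m + 2)"
  define a b c d where abcd: "a = t (0, 0)" "b = t (1, 0)" "c = t (0, 1)" "d = t (1, 1)"
  let ?ab = "Transposition.transpose a b" and ?cd = "Transposition.transpose c d"
  have "inj_on t (cells [m, 2])"
    using t by (auto simp: tableau_def bij_betw_def)
  then have dist: "distinct [a, b, c, d]"
    unfolding abcd using m by (auto simp: inj_on_def cells_simps)
  define f where "f \<sigma> = single (?T (\<sigma> b, \<sigma> d)) (of_int (sign \<sigma>) :: rat)" for \<sigma> :: "nat \<Rightarrow> nat"
  have "tabloid [m, 2] (\<sigma> \<circ> t) = ?T (\<sigma> b, \<sigma> d)"
    if "\<sigma> \<in> column_stabilizer [m, 2] t" for \<sigma>
    using tabloid_two_row[OF tableau_permuted[OF t]] that by (simp add: column_stabilizer_def abcd)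
  then have "polytabloid [m, 2] t = (\<Sum>\<sigma>\<in>{id, ?ab, ?cd, ?ab \<circ> ?cd}. f \<sigma>)"
    unfolding polytabloid_def column_stabilizer_two_row[OF t m abcd, symmetric] f_def
    by (intro sum.cong refl) simp
  also have "\<dots> = f id + f ?ab + f ?cd + f (?ab \<circ> ?cd)"
  proof -
    \<comment> \<open>The values at \<open>a\<close> and \<open>c\<close> tell which of the two
      exchanges were made, so the four permutations are distinct.\<close>
    have neqI: "\<sigma> \<noteq> \<tau>" if "\<sigma> a \<noteq> \<tau> a \<or> \<sigma> c \<noteq> \<tau> c" for \<sigma> \<tau> :: "nat \<Rightarrow> nat"
      using that by auto
    have "id \<noteq> ?ab" "id \<noteq> ?cd" "id \<noteq> ?ab \<circ> ?cd" "?ab \<noteq> ?cd" "?ab \<noteq> ?ab \<circ> ?cd" "?cd \<noteq> ?ab \<circ> ?cd"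
      by (rule neqI; use dist in \<open>simp add: Transposition.transpose_def\<close>)+
    then show ?thesis by (simp add: add.assoc)
  qed
  also have "\<dots> = single (?T (b, d)) 1 - single (?T (a, d)) 1
      - single (?T (b, c)) 1 + single (?T (a, c)) 1"
    using dist
    by (simp add: f_def sign_swap_id sign_compose permutation_swap_id Transposition.transpose_def single_uminus)
  also have "\<dots> = qpush ?T (square a b c d)"
    by (simp add: square_def qpush_edge_average)
  finally show ?thesis unfolding abcd .
qed

lemma polytabloids_two_row:
  assumes "m > 1"
  shows "{polytabloid [m, 2] t | t. tableau [m, 2] t} = qpush (two_row_tabloid (m + 2)) ` squares (m + 2)"
proof (intro equalityI subsetI)
  fix x assume "x \<in> {polytabloid [m, 2] t | t. tableau [m, 2] t}"
  then obtain t where t: "tableau [m, 2] t" "x = polytabloid [m, 2] t" by blast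
  then have inj: "inj_on t (cells [m, 2])" and img: "t ` cells [m, 2] = {1..m + 2}"
    by (auto simp: tableau_def bij_betw_def)
  have "{t (0, 0), t (1, 0), t (0, 1), t (1, 1)} \<subseteq> {1..m + 2}"
    unfolding img[symmetric] using assms by (auto simp: cells_simps)
  moreover have "distinct [t (0, 0), t (1, 0), t (0, 1), t (1, 1)]"
    using inj assms by (auto simp: inj_on_def cells_simps)
  ultimately have "square (t (0, 0)) (t (1, 0)) (t (0, 1)) (t (1, 1)) \<in> squares (m + 2)"
    unfolding squares_def by blast
  then show "x \<in> qpush (two_row_tabloid (m + 2)) ` squares (m + 2)"
    unfolding t(2) polytabloid_two_row[OF t(1) assms] by (rule imageI)
next
  fix x assume "x \<in> qpush (two_row_tabloid (m + 2)) ` squares (m + 2)"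
  then obtain a b c d where abcd: "{a, b, c, d} \<subseteq> {1..m + 2}" "distinct [a, b, c, d]"
    and x: "x = qpush (two_row_tabloid (m + 2)) (square a b c d)"
    unfolding squares_def by blast
  define f where "f p = (if p = (0, 0) then a else if p = (1, 0) then b else if p = (0, 1) then c else d)"
    for p :: "nat \<times> nat"
  let ?P = "{(0, 0), (1, 0), (0, 1), (1, 1)} :: (nat \<times> nat) set"
  obtain t where t: "bij_betw t (cells [m, 2]) {1..m + 2}" "\<And>p. p \<in> ?P \<Longrightarrow> t p = f p"
  proof (rule bij_betw_extend[of "cells [m, 2]" "{1..m + 2}" ?P f])
    show "?P \<subseteq> cells [m, 2]"
      using assms by (auto simp: cells_simps)
    show "inj_on f ?P" "f ` ?P \<subseteq> {1..m + 2}"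
      using abcd by (auto simp: f_def inj_on_def)
  qed (use card_cells in auto)
  have tab: "tableau [m, 2] t" using t(1) by (simp add: tableau_def)
  have "t (0, 0) = a" "t (1, 0) = b" "t (0, 1) = c" "t (1, 1) = d"
    using t(2) by (auto simp: f_def)
  then have "x = polytabloid [m, 2] t"
    unfolding x polytabloid_two_row[OF tab assms] by simp
  with tab show "x \<in> {polytabloid [m, 2] t | t. tableau [m, 2] t}" by blast
qed

section \<open>Isomorphisms with the Specht modules\<close>

lemma qspan_image: "qhom f \<Longrightarrow> qspan (f ` S) = f ` qspan S"
  using module_hom.span_image[of qscale qscale f S] by (simp add: qspan_def)

lemma Sp_simps:
  "carrier (Sp n \<nu>) = qspan {polytabloid ((n - sum_list \<nu>) # \<nu>) t | t. tableau ((n - sum_list \<nu>) # \<nu>) t}"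
  "add (Sp n \<nu>) = (+)" "zero (Sp n \<nu>) = 0" "smult (Sp n \<nu>) = qscale"
  "action (Sp n \<nu>) = (\<lambda>\<sigma>. qpush (map ((`) \<sigma>)))"
  by (simp_all add: Sp_def specht_def)

lemma carrier_Sp_hook:
  assumes "n \<ge> 3"
  shows "carrier (Sp n [1, 1]) = qpush (hook_tabloid n) ` antisymmetric_cycles n"
proof -
  have "n - 2 > 0" and n: "n - 2 + 2 = n" and two: "sum_list [1, 1] = (2::nat)"
    using assms by simp_all
  from polytabloids_hook[OF this(1)] show ?thesis
    unfolding Sp_simps two n by (simp only: qspan_image[OF qhom_qpush] antisymmetric_cycles_span)
qed

lemma carrier_Sp_two_row:
  assumes "n \<ge> 4"
  shows "carrier (Sp n [2]) = qpush (two_row_tabloid n) ` symmetric_cycles n"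
proof -
  have "n - 2 > 1" and n: "n - 2 + 2 = n" and two: "sum_list [2] = (2::nat)"
    using assms by simp_all
  from polytabloids_two_row[OF this(1)] show ?thesis
    unfolding Sp_simps two n by (simp only: qspan_image[OF qhom_qpush] symmetric_cycles_span[OF assms])
qed

lemma permute_tabloid:
  assumes "\<sigma> permutes {1..n}"
  shows "map ((`) \<sigma>) (hook_tabloid n e) = hook_tabloid n (map_prod \<sigma> \<sigma> e)"
    "map ((`) \<sigma>) (two_row_tabloid n e) = two_row_tabloid n (map_prod \<sigma> \<sigma> e)"
  using permutes_image[OF assms]
  by (simp_all add: hook_tabloid_def two_row_tabloid_def image_set_diff[OF permutes_inj[OF assms]])

lemma hook_tabloid_left_inverse:
  "qpush (\<lambda>T. (the_elem (T ! 1), the_elem (T ! 2))) (qpush (hook_tabloid n) M) = M"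
  unfolding qpush_qpush by (rule qpush_ident) (simp add: hook_tabloid_def)

theorem antisymmetric_cycles_iso_Sp:
  assumes "n \<ge> 3"
  shows "rep_iso (sym_group n) (pair_rep (antisymmetric_cycles n))
    (Sp n [1, 1])"
proof (rule rep_iso_transport[where f = "qpush (hook_tabloid n)"])
  show "representation (sym_group n)
      (pair_rep (antisymmetric_cycles n))"
    by (rule representation_permuted[OF subspace_antisymmetric_cycles permuted_antisymmetric])
  show "bij_betw (qpush (hook_tabloid n))
      (carrier (pair_rep (antisymmetric_cycles n)))
      (carrier (Sp n [1, 1]))"
    unfolding carrier_Sp_hook[OF assms] bij_betw_def
    using hook_tabloid_left_inverse by (auto intro: inj_on_inverseI)
  show "linear_map (pair_rep (antisymmetric_cycles n))
      (Sp n [1, 1]) (qpush (hook_tabloid n))"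
    unfolding linear_map_def carrier_Sp_hook[OF assms] by (auto simp: Sp_simps)
qed (auto simp: Sp_simps sym_group_carrier qpush_qpush permute_tabloid)

definition symmetrize :: "(nat \<times> nat \<Rightarrow>\<^sub>0 rat) \<Rightarrow> (nat \<times> nat \<Rightarrow>\<^sub>0 rat)" where
  "symmetrize M = qscale (1/2) (M + qpush prod.swap M)"

lemma symmetrize_add_antisymmetrize: "symmetrize M + antisymmetrize M = M"
  by (rule poly_mapping_eqI)
    (simp only: symmetrize_def antisymmetrize_def lookup_add lookup_minus lookup_qscale, simp add: field_simps)

lemma qhom_symmetrize: "qhom symmetrize" and qhom_antisymmetrize: "qhom antisymmetrize"
  by (auto simp: module_hom_iff qvec.module_axioms symmetrize_def antisymmetrize_def
      qvec.scale_right_distrib qvec.scale_right_diff_distrib mult.commute)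

text \<open>The second row does not remember the order of the pair; the arbitrary choice is harmless
  because \<open>edge_average\<close> is symmetric.\<close>

definition average_tabloid :: "nat set list \<Rightarrow> (nat \<times> nat \<Rightarrow>\<^sub>0 rat)" where
  "average_tabloid T = (let p = SOME p. T ! 1 = {fst p, snd p} in edge_average (fst p) (snd p))"

lemma average_two_row_tabloid: "average_tabloid (two_row_tabloid n (i, j)) = edge_average i j"
proof -
  define p where "p = (SOME p. {i, j} = {fst p, snd p})"
  have "{i, j} = {fst p, snd p}"
    unfolding p_def by (rule someI[of _ "(i, j)"]) simp
  then have "p = (i, j) \<or> p = (j, i)"
    by (cases p) (auto simp: doubleton_eq_iff)
  then have "edge_average (fst p) (snd p) = edge_average i j"
    by (auto simp: edge_average_def add.commute)
  then show ?thesis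
    by (simp add: average_tabloid_def two_row_tabloid_def p_def Let_def)
qed

text \<open>Passing to unordered pairs loses the antisymmetric part of a matrix, so its symmetric
  part is all that can be recovered.\<close>

lemma two_row_tabloid_left_inverse: "qextend average_tabloid (qpush (two_row_tabloid n) M) = symmetrize M"
proof (rule qhom_eqI[OF qhom_compose[OF qhom_qpush qhom_qextend] qhom_symmetrize])
  fix e :: "nat \<times> nat"
  show "qextend average_tabloid (qpush (two_row_tabloid n) (single e 1))
      = symmetrize (single e 1)"
    by (cases e) (simp add: average_two_row_tabloid edge_average_def symmetrize_def qvec.scale_right_distrib)
qed

lemma two_row_symmetrize: "qpush (two_row_tabloid n) (symmetrize M) = qpush (two_row_tabloid n) M"
proof -
  have "qpush (two_row_tabloid n) (qpush prod.swap M) = qpush (two_row_tabloid n) M"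
    unfolding qpush_qpush by (rule qpush_cong) (auto simp: two_row_tabloid_swap)
  moreover have "qscale (1/2) (c + c) = c" for c :: "nat set list \<Rightarrow>\<^sub>0 rat"
    by (rule poly_mapping_eqI) (simp add: lookup_add)
  ultimately show ?thesis by (simp add: symmetrize_def)
qed

lemma symmetrize_cycle:
  assumes M: "M \<in> cycle_space n"
  shows "symmetrize M \<in> symmetric_cycles n" "antisymmetrize M \<in> antisymmetric_cycles n"
proof -
  have swap_swap: "qpush prod.swap (qpush prod.swap M) = M"
    unfolding qpush_qpush by (rule qpush_ident) simp
  have keys: "keys M \<subseteq> off_diagonal n" and rows: "\<And>k. k \<in> {1..n} \<Longrightarrow> row_sum n M k = 0"
    using M by (auto simp: cycle_space_def row_sum_def)
  have swap_keys: "keys (qpush prod.swap M) \<subseteq> off_diagonal n"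
    using keys keys_qpush[of prod.swap M] by (fastforce simp: off_diagonal_def)
  have swap_rows: "row_sum n (qpush prod.swap M) k = 0" if "k \<in> {1..n}" for k
    using M that by (simp add: cycle_space_def row_sum_def lookup_qpush_swap)
  have "symmetrize M \<in> {M. keys M \<subseteq> off_diagonal n}"
    "antisymmetrize M \<in> {M. keys M \<subseteq> off_diagonal n}"
    unfolding symmetrize_def antisymmetrize_def using keys swap_keys
    by (intro qvec.subspace_scale qvec.subspace_add qvec.subspace_diff subspace_keys; simp)+
  then show "symmetrize M \<in> symmetric_cycles n" "antisymmetrize M \<in> antisymmetric_cycles n"
    using rows swap_rows
    by (simp_all add: symmetric_cycles_def antisymmetric_cycles_iff symmetrize_def antisymmetrize_def
        swap_swap add.commute flip: qvec.scale_minus_right)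
qed

lemma rep_sum_simps:
  "carrier (rep_sum V W) = carrier V \<times> carrier W"
  "add (rep_sum V W) = (\<lambda>(v, w) (v', w'). (v \<oplus>\<^bsub>V\<^esub> v', w \<oplus>\<^bsub>W\<^esub> w'))"
  "zero (rep_sum V W) = (\<zero>\<^bsub>V\<^esub>, \<zero>\<^bsub>W\<^esub>)"
  "smult (rep_sum V W) = (\<lambda>q (v, w). (q \<odot>\<^bsub>V\<^esub> v, q \<odot>\<^bsub>W\<^esub> w))"
  "action (rep_sum V W) = (\<lambda>g (v, w). (action V g v, action W g w))"
  by (simp_all add: rep_sum_def)

theorem cycle_space_iso_Sp:
  assumes n: "n \<ge> 4"
  shows "rep_iso (sym_group n) (pair_rep (cycle_space n))
    (rep_sum (Sp n [1, 1]) (Sp n [2]))"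
proof -
  \<comment> \<open>The hook component must be antisymmetrized, since \<open>hook_tabloid\<close>
    keeps the whole matrix. The other component needs no \<open>symmetrize\<close>: by
    \<open>two_row_symmetrize\<close> the map to two-row tabloids already factors through
    it.\<close>
  define f where "f M = (qpush (hook_tabloid n) (antisymmetrize M), qpush (two_row_tabloid n) M)" for M
  have n3: "n \<ge> 3" using n by simp
  have carr: "carrier (rep_sum (Sp n [1, 1]) (Sp n [2]))
      = qpush (hook_tabloid n) ` antisymmetric_cycles n \<times> qpush (two_row_tabloid n) ` symmetric_cycles n"
    by (simp only: rep_sum_simps carrier_Sp_hook[OF n3] carrier_Sp_two_row[OF n])
  have f_in: "f M \<in> carrier (rep_sum (Sp n [1, 1]) (Sp n [2]))" if "M \<in> cycle_space n" for M
    unfolding f_def carr two_row_symmetrize[of n M, symmetric] using symmetrize_cycle[OF that] by blast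
  show ?thesis
  proof (rule rep_iso_transport[where f = f])
    show "representation (sym_group n) (pair_rep (cycle_space n))"
      by (rule representation_permuted[OF subspace_cycle_space permuted_cycle])
    show "bij_betw f (carrier (pair_rep (cycle_space n)))
        (carrier (rep_sum (Sp n [1, 1]) (Sp n [2])))"
      unfolding bij_betw_def
    proof (intro conjI inj_onI equalityI subsetI)
      fix M N assume "f M = f N"
      then have "antisymmetrize M = antisymmetrize N" "symmetrize M = symmetrize N"
        unfolding f_def by (metis hook_tabloid_left_inverse two_row_tabloid_left_inverse prod.inject)+
      then show "M = N"
        by (metis symmetrize_add_antisymmetrize)
    next
      fix x assume "x \<in> f ` carrier (pair_rep (cycle_space n))"
      then show "x \<in> carrier (rep_sum (Sp n [1, 1]) (Sp n [2]))"
        using f_in by auto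
    next
      fix x assume "x \<in> carrier (rep_sum (Sp n [1, 1]) (Sp n [2]))"
      then obtain A S where A: "A \<in> antisymmetric_cycles n" and S: "S \<in> symmetric_cycles n"
        and x: "x = (qpush (hook_tabloid n) A, qpush (two_row_tabloid n) S)"
        unfolding carr by blast
      have "qpush prod.swap A = - A" "qpush prod.swap S = S"
        using A S by (auto simp: antisymmetric_cycles_iff symmetric_cycles_def)
      then have "symmetrize A = 0" "antisymmetrize S = 0" "antisymmetrize A + symmetrize A = A"
        using symmetrize_add_antisymmetrize[of A]
        by (auto simp: symmetrize_def antisymmetrize_def add.commute)
      then have "antisymmetrize (A + S) = A" "qpush (two_row_tabloid n) A = 0"
        using two_row_symmetrize[of n A]
        by (simp_all add: module_hom.add[OF qhom_antisymmetrize])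
      then have "f (A + S) = x"
        by (simp add: f_def x)
      moreover have "A + S \<in> cycle_space n"
        using A S antisymmetric_cycles_subset symmetric_cycles_subset
        by (blast intro: qvec.subspace_add[OF subspace_cycle_space])
      ultimately show "x \<in> f ` carrier (pair_rep (cycle_space n))"
        by auto
    qed
    show "linear_map (pair_rep (cycle_space n))
        (rep_sum (Sp n [1, 1]) (Sp n [2])) f"
      unfolding linear_map_def using f_in
      by (auto simp: rep_sum_simps Sp_simps f_def module_hom.add[OF qhom_antisymmetrize]
          module_hom.scale[OF qhom_antisymmetrize])
    show "f \<zero>\<^bsub>pair_rep (cycle_space n)\<^esub>
        = \<zero>\<^bsub>rep_sum (Sp n [1, 1]) (Sp n [2])\<^esub>"
      by (simp add: rep_sum_simps Sp_simps f_def module_hom.zero[OF qhom_antisymmetrize])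
    fix \<sigma> M assume "\<sigma> \<in> carrier (sym_group n)"
    then have \<sigma>: "\<sigma> permutes {1..n}" by (simp add: sym_group_carrier)
    have "antisymmetrize (qpush (map_prod \<sigma> \<sigma>) M) = qpush (map_prod \<sigma> \<sigma>) (antisymmetrize M)"
      by (simp add: antisymmetrize_def qpush_qpush prod.swap_def)
    then show "f (action (pair_rep (cycle_space n)) \<sigma> M)
        = action (rep_sum (Sp n [1, 1]) (Sp n [2])) \<sigma> (f M)"
      by (simp add: f_def rep_sum_simps Sp_simps qpush_qpush permute_tabloid[OF \<sigma>])
  qed
qed

theorem theorem3p3:
  fixes n :: nat
  assumes "n \<ge> 4"
  shows "rep_iso (sym_group n)
           (homology_rep 1 (Conf 2 (star_graph n)) (\<lambda>\<sigma>. Conf_map 2 (star_map \<sigma>)))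
           (rep_sum (Sp n [1, 1]) (Sp n [2]))
       \<and> rep_iso (sym_group n)
           (homology_rep 1 (UConf 2 (star_graph n)) (\<lambda>\<sigma>. UConf_map 2 (star_map \<sigma>)))
           (Sp n [1, 1])"
proof
  show "rep_iso (sym_group n) (homology_rep 1 (star_conf n) (\<lambda>\<sigma>. Conf_map 2 (star_map \<sigma>)))
      (rep_sum (Sp n [1, 1]) (Sp n [2]))"
    by (rule rep_iso_span[OF cycle_space_iso_homology cycle_space_iso_Sp[OF assms]])
  have "n \<ge> 3" using assms by simp
  then show "rep_iso (sym_group n) (homology_rep 1 (star_uconf n) (\<lambda>\<sigma>. UConf_map 2 (star_map \<sigma>))) (Sp n [1, 1])"
    by (rule rep_iso_span[OF antisymmetric_cycles_iso_homology antisymmetric_cycles_iso_Sp])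
qed

end
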